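(* The Kishino virtual knot is non-classical; that is, the Kishino virtual knot diagram cannot be transformed, by a finite sequence of planar isotopies and virtual knot moves, into a diagram having only classical crossings.
   Context: A virtual knot diagram is a generic immersed oriented closed curve in the plane (or $S^2$) each of whose double points is either a classical crossing (with over/under information) or a virtual crossing. Virtual knot equivalence is generated by isotopy and the following moves: the three classical Reidemeister moves; the virtual versions of all three Reidemeister moves (all crossings virtual; the first and second types add/remove one or two virtual crossings); and the mixed move in which a strand with two virtual crossings is slid past a classical crossing. (The moves sliding a strand classically over, or classically under, a virtual crossing are not allowed.) The Kishino virtual knot is represented by the following diagram with four classical and two virtual crossings. Place points $1,2,3,4,5,6$ at $(0,0),(1,0),\dots,(5,0)$ in $\mathbb{R}^2$ and take the closed curve obtained by following in order: $A$, the lower semicircle from $(0,0)$ to $(2,0)$; $B$, the upper semicircle from $(2,0)$ to $(3,0)$; $C$, the lower semicircle from $(3,0)$ to $(1,0)$; $D$, the upper semicircle from $(1,0)$ to $(2.5,0)$ followed by the lower semicircle from $(2.5,0)$ to $(5,0)$; $E$, the upper half-ellipse from $(5,0)$ to $(0.5,0)$ followed by the lower semicircle from $(0.5,0)$ to $(4,0)$; $F$, the upper semicircle from $(4,0)$ to $(0,0)$. The upper arcs may be deformed so that arcs with nested endpoint intervals are disjoint and arcs with interleaved endpoint intervals meet exactly once. All crossings involving $B$ or $F$ (there are two: $B$ with $D$, and $E$ with $F$) are virtual. The other crossings are classical, with $E$ over $D$, $E$ over $A$, $D$ over $C$, $A$ over $C$. Equivalently, it is the virtual knot with signed Gauss code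 (cyclic word, O = over, U = under) $$O_w^{+}\,U_y^{-}\,U_w^{+}\,O_y^{-}\,U_z^{-}\,O_x^{+}\,O_z^{-}\,U_x^{+},$$ where a crossing has sign $+$ if (over-strand tangent, under-strand tangent) is a positively oriented basis of the plane and $-$ otherwise. *)

theory Defs
  imports "HOL-Analysis.Analysis"
begin

section \<open>Virtual knot diagrams\<close>

text \<open>
  The plane is the type of complex numbers.  A closed curve is a function on the reals of
  period 1, so that two parameters denote the same point of the circle iff their difference is
  an integer.  The relation \<open>over\<close> holds the crossing information: \<open>over D s t\<close> means that at the
  double point with parameters \<open>s\<close> and \<open>t\<close> there is a classical crossing at which the strand
  through \<open>s\<close> passes over the strand through \<open>t\<close>.  A double point at which neither strand is
  over the other one is a virtual crossing.
\<close>

record diagram =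
  curve :: "real \<Rightarrow> complex"
  over :: "real \<Rightarrow> real \<Rightarrow> bool"

definition double_pt :: "(real \<Rightarrow> complex) \<Rightarrow> real \<Rightarrow> real \<Rightarrow> bool" where
  "double_pt \<gamma> s t \<longleftrightarrow> \<gamma> s = \<gamma> t \<and> s - t \<notin> \<int>"

text \<open>The last-but-one conjunct is transversality: \<open>Im (cnj v * w)\<close> is the determinant of \<open>(v, w)\<close>.\<close>

definition generic_immersion :: "(real \<Rightarrow> complex) \<Rightarrow> bool" where
  "generic_immersion \<gamma> \<longleftrightarrow>
     (\<forall>t. \<gamma> (t + 1) = \<gamma> t) \<and>
     \<gamma> C1_differentiable_on UNIV \<and>
     (\<forall>t. vector_derivative \<gamma> (at t) \<noteq> 0) \<and>
     finite {(s, t). s \<in> {0..<1} \<and> t \<in> {0..<1} \<and> double_pt \<gamma> s t} \<and>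
     (\<forall>s t. double_pt \<gamma> s t \<longrightarrow>
        Im (cnj (vector_derivative \<gamma> (at s)) * vector_derivative \<gamma> (at t)) \<noteq> 0) \<and>
     (\<forall>s t u. double_pt \<gamma> s t \<and> double_pt \<gamma> t u \<longrightarrow> s - u \<in> \<int>)"

definition virtual_diagram :: "diagram \<Rightarrow> bool" where
  "virtual_diagram D \<longleftrightarrow>
     generic_immersion (curve D) \<and>
     (\<forall>s t. over D s t \<longrightarrow> double_pt (curve D) s t \<and> \<not> over D t s) \<and>
     (\<forall>s t. over D (s + 1) t = over D s t \<and> over D s (t + 1) = over D s t)"

definition classical_at :: "diagram \<Rightarrow> real \<Rightarrow> real \<Rightarrow> bool" where
  "classical_at D s t \<longleftrightarrow> double_pt (curve D) s t \<and> (over D s t \<or> over D t s)"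

definition virtual_at :: "diagram \<Rightarrow> real \<Rightarrow> real \<Rightarrow> bool" where
  "virtual_at D s t \<longleftrightarrow> double_pt (curve D) s t \<and> \<not> over D s t \<and> \<not> over D t s"

definition only_classical :: "diagram \<Rightarrow> bool" where
  "only_classical D \<longleftrightarrow> (\<forall>s t. double_pt (curve D) s t \<longrightarrow> classical_at D s t)"


section \<open>Planar isotopy\<close>

text \<open>Ambient isotopies of the plane through \<open>C\<^sup>1\<close>-diffeomorphisms, starting at the identity.\<close>

definition ambient_isotopy :: "(real \<Rightarrow> complex \<Rightarrow> complex) \<Rightarrow> bool" where
  "ambient_isotopy h \<longleftrightarrow>
     h 0 = id \<and>
     (\<forall>\<tau>\<in>{0..1}. bij (h \<tau>)) \<and>
     continuous_on ({0..1} \<times> UNIV) (\<lambda>(\<tau>, z). h \<tau> z) \<and>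
     (\<exists>h' :: real \<Rightarrow> complex \<Rightarrow> complex \<Rightarrow>\<^sub>L complex.
        (\<forall>\<tau>\<in>{0..1}. \<forall>z. (h \<tau> has_derivative blinfun_apply (h' \<tau> z)) (at z) \<and>
                         bij (blinfun_apply (h' \<tau> z))) \<and>
        continuous_on ({0..1} \<times> UNIV) (\<lambda>(\<tau>, z). h' \<tau> z))"

text \<open>Orientation preserving reparametrizations of the circle (rotations of it included).\<close>

definition circle_reparam :: "(real \<Rightarrow> real) \<Rightarrow> bool" where
  "circle_reparam \<rho> \<longleftrightarrow>
     (\<forall>t. \<rho> (t + 1) = \<rho> t + 1) \<and>
     \<rho> C1_differentiable_on UNIV \<and>
     (\<forall>t. vector_derivative \<rho> (at t) > 0)"

definition planar_isotopic :: "diagram \<Rightarrow> diagram \<Rightarrow> bool" where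
  "planar_isotopic D E \<longleftrightarrow>
     (\<exists>h \<rho>. ambient_isotopy h \<and> circle_reparam \<rho> \<and>
        (\<forall>t. curve E t = h 1 (curve D (\<rho> t))) \<and>
        (\<forall>s t. over E s t = over D (\<rho> s) (\<rho> t)))"


section \<open>The local moves\<close>

text \<open>
  A local move changes a diagram only inside a disc which the diagram meets in the \<open>k\<close> proper
  strands with parameter intervals \<open>{a i..b i}\<close>, \<open>i < k\<close>.  Up to planar isotopy the disc is round
  and the base point of the curve (parameter 0) lies outside of it.  The strands are numbered
  arbitrarily, not in the order in which the curve runs through them.
\<close>

definition strands_in_disc ::
  "(real \<Rightarrow> complex) \<Rightarrow> complex \<Rightarrow> real \<Rightarrow> nat \<Rightarrow> (nat \<Rightarrow> real) \<Rightarrow> (nat \<Rightarrow> real) \<Rightarrow> bool" where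
  "strands_in_disc \<gamma> c r k a b \<longleftrightarrow>
     (\<forall>i<k. 0 < a i \<and> a i < b i \<and> b i < 1) \<and>
     disjoint_family_on (\<lambda>i. {a i..b i}) {..<k} \<and>
     {t \<in> {0..1}. \<gamma> t \<in> cball c r} = (\<Union>i<k. {a i..b i}) \<and>
     (\<forall>i<k. \<forall>t\<in>{a i<..<b i}. \<gamma> t \<in> ball c r)"

definition same_outside_disc ::
  "diagram \<Rightarrow> diagram \<Rightarrow> nat \<Rightarrow> (nat \<Rightarrow> real) \<Rightarrow> (nat \<Rightarrow> real) \<Rightarrow> bool" where
  "same_outside_disc D E k a b \<longleftrightarrow>
     (\<exists>c r. r > 0 \<and> strands_in_disc (curve D) c r k a b \<and> strands_in_disc (curve E) c r k a b) \<and>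
     (\<forall>t \<in> {0..1} - (\<Union>i<k. {a i..b i}). curve D t = curve E t) \<and>
     (\<forall>s \<in> {0..1} - (\<Union>i<k. {a i..b i}). \<forall>t \<in> {0..1} - (\<Union>i<k. {a i..b i}).
        over D s t = over E s t)"

definition strand_crossings ::
  "(real \<Rightarrow> complex) \<Rightarrow> (nat \<Rightarrow> real) \<Rightarrow> (nat \<Rightarrow> real) \<Rightarrow> nat \<Rightarrow> nat \<Rightarrow> (real \<times> real) set" where
  "strand_crossings \<gamma> a b i j = {(u, v). u \<in> {a i..b i} \<and> v \<in> {a j..b j} \<and> \<gamma> u = \<gamma> v}"

text \<open>
  First moves: a simple strand is replaced by a strand with exactly one double point.  The
  predicate \<open>T\<close>, to be instantiated with \<open>classical_at\<close> or \<open>virtual_at\<close>, says of which kind it is.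
\<close>

definition move1 :: "(diagram \<Rightarrow> real \<Rightarrow> real \<Rightarrow> bool) \<Rightarrow> diagram \<Rightarrow> diagram \<Rightarrow> bool" where
  "move1 T D E \<longleftrightarrow>
     (\<exists>a b s t. same_outside_disc D E 1 a b \<and>
        inj_on (curve D) {a 0..b 0} \<and>
        {(u, v) \<in> strand_crossings (curve E) a b 0 0. u < v} = {(s, t)} \<and>
        T E s t)"

text \<open>
  Second moves: two disjoint simple strands are replaced by two simple strands which meet in
  exactly two points.  For the classical move one strand (by choice of the numbering, strand 0)
  is over the other one at both crossings; for the virtual move both crossings are virtual.
\<close>

definition move2 :: "(diagram \<Rightarrow> real \<Rightarrow> real \<Rightarrow> bool) \<Rightarrow> diagram \<Rightarrow> diagram \<Rightarrow> bool" where
  "move2 T D E \<longleftrightarrow>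
     (\<exists>a b. same_outside_disc D E 2 a b \<and>
        (\<forall>i<2. inj_on (curve D) {a i..b i} \<and> inj_on (curve E) {a i..b i}) \<and>
        strand_crossings (curve D) a b 0 1 = {} \<and>
        card (strand_crossings (curve E) a b 0 1) = 2 \<and>
        (\<forall>(u, v) \<in> strand_crossings (curve E) a b 0 1. T E u v))"

text \<open>
  Third moves: three simple strands, any two of which meet in exactly one point, before and after
  the move; the number \<open>x i j\<close> is the parameter on strand \<open>i\<close> of its crossing with strand \<open>j\<close>.  The move
  turns the triangle formed by the strands over, that is, each strand meets the other two
  in the opposite order afterwards.  Strand \<open>i\<close> is over strand \<open>j\<close> iff \<open>P i j\<close>, before and after.
\<close>

definition triple_crossings ::
  "(nat \<Rightarrow> nat \<Rightarrow> bool) \<Rightarrow> diagram \<Rightarrow> (nat \<Rightarrow> real) \<Rightarrow> (nat \<Rightarrow> real) \<Rightarrow> (nat \<Rightarrow> nat \<Rightarrow> real) \<Rightarrow> bool" where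
  "triple_crossings P D a b x \<longleftrightarrow>
     (\<forall>i<3. inj_on (curve D) {a i..b i}) \<and>
     (\<forall>i<3. \<forall>j<3. i \<noteq> j \<longrightarrow>
        strand_crossings (curve D) a b i j = {(x i j, x j i)} \<and>
        over D (x i j) (x j i) = P i j)"

definition move3 :: "(nat \<Rightarrow> nat \<Rightarrow> bool) \<Rightarrow> diagram \<Rightarrow> diagram \<Rightarrow> bool" where
  "move3 P D E \<longleftrightarrow>
     (\<exists>a b x y. same_outside_disc D E 3 a b \<and>
        triple_crossings P D a b x \<and> triple_crossings P E a b y \<and>
        (\<forall>i<3. \<forall>j<3. \<forall>k<3. i \<noteq> j \<and> j \<noteq> k \<and> i \<noteq> k \<longrightarrow> (x i j < x i k \<longleftrightarrow> y i k < y i j)))"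

definition reidemeister1 :: "diagram \<Rightarrow> diagram \<Rightarrow> bool" where
  "reidemeister1 = move1 classical_at"

definition reidemeister2 :: "diagram \<Rightarrow> diagram \<Rightarrow> bool" where
  "reidemeister2 = move2 over"

definition reidemeister3 :: "diagram \<Rightarrow> diagram \<Rightarrow> bool" where
  "reidemeister3 = move3 (\<lambda>i j. i < j)"

definition virtual1 :: "diagram \<Rightarrow> diagram \<Rightarrow> bool" where
  "virtual1 = move1 virtual_at"

definition virtual2 :: "diagram \<Rightarrow> diagram \<Rightarrow> bool" where
  "virtual2 = move2 virtual_at"

definition virtual3 :: "diagram \<Rightarrow> diagram \<Rightarrow> bool" where
  "virtual3 = move3 (\<lambda>i j. False)"

text \<open>
  In the mixed move the crossing of the strands 1 and 2 is classical, and strand 0 meets both of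
  them in virtual crossings.
\<close>

definition mixed :: "diagram \<Rightarrow> diagram \<Rightarrow> bool" where
  "mixed = move3 (\<lambda>i j. i = 1 \<and> j = 2)"

definition virtual_move :: "diagram \<Rightarrow> diagram \<Rightarrow> bool" where
  "virtual_move D E \<longleftrightarrow>
     virtual_diagram D \<and> virtual_diagram E \<and>
     (planar_isotopic D E \<or>
      reidemeister1 D E \<or> reidemeister2 D E \<or> reidemeister3 D E \<or>
      virtual1 D E \<or> virtual2 D E \<or> virtual3 D E \<or> mixed D E)"

text \<open>Finite sequences of isotopies and moves, each of which may be applied in either direction.\<close>

definition virtually_equivalent :: "diagram \<Rightarrow> diagram \<Rightarrow> bool" where
  "virtually_equivalent = equivclp virtual_move"


section \<open>The Kishino diagram\<close>

text \<open>
  Lower and upper semicircles from \<open>(p, 0)\<close> to \<open>(q, 0)\<close>, where \<open>p < q\<close> or \<open>q < p\<close>, parametrized by \<open>{0..1}\<close>.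
\<close>

definition lower_arc :: "real \<Rightarrow> real \<Rightarrow> real \<Rightarrow> complex" where
  "lower_arc p q u = Complex ((p + q) / 2 - (q - p) / 2 * cos (pi * u)) (- \<bar>q - p\<bar> / 2 * sin (pi * u))"

definition upper_arc :: "real \<Rightarrow> real \<Rightarrow> real \<Rightarrow> complex" where
  "upper_arc p q u = Complex ((p + q) / 2 - (q - p) / 2 * cos (pi * u)) (\<bar>q - p\<bar> / 2 * sin (pi * u))"

text \<open>
  The curve is parametrized with constant speed: the time spent on each semicircle is its diameter,
  and the diameters add up to 21; this makes the curve \<open>C\<^sup>1\<close>.  The upper half-ellipse of \<open>E\<close> is
  a semicircle, too.  With this choice upper arcs with nested endpoint intervals are
  disjoint and upper arcs with interleaved ones meet exactly once.
\<close>

definition kishino_curve :: "real \<Rightarrow> complex" where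
  "kishino_curve t = (let x = 21 * frac t in
     if x < 2 then lower_arc 0 2 (x / 2)
     else if x < 3 then upper_arc 2 3 (x - 2)
     else if x < 5 then lower_arc 3 1 ((x - 3) / 2)
     else if x < 13/2 then upper_arc 1 (5/2) ((x - 5) / (3/2))
     else if x < 9 then lower_arc (5/2) 5 ((x - 13/2) / (5/2))
     else if x < 27/2 then upper_arc 5 (1/2) ((x - 9) / (9/2))
     else if x < 17 then lower_arc (1/2) 4 ((x - 27/2) / (7/2))
     else upper_arc 4 0 ((x - 17) / 4))"

datatype kishino_arc = A | B | C | D | E | F

definition kishino_arc_at :: "real \<Rightarrow> kishino_arc" where
  "kishino_arc_at t = (let x = 21 * frac t in
     if x < 2 then A
     else if x < 3 then B
     else if x < 5 then C
     else if x < 9 then D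
     else if x < 17 then E
     else F)"

definition kishino :: diagram where
  "kishino = \<lparr> curve = kishino_curve,
     over = (\<lambda>s t. double_pt kishino_curve s t \<and>
       (kishino_arc_at s, kishino_arc_at t) \<in> {(E, D), (E, A), (D, C), (A, C)}) \<rparr>"

hide_const (open) A B C D E F

end

theory Submission
  imports Defs "HOL-Complex_Analysis.Complex_Analysis"
begin

text \<open>
  Forget the over/under information at the classical crossings but keep the sign \<open>\<epsilon> = \<plusminus>1\<close> of the two
  tangents, that is, pass to the flat virtual knot.  For a chord \<open>c\<close> with end points \<open>s\<close>, \<open>t\<close> let
  \<open>\<sigma>\<^sub>c\<close> be the function on the circle which is \<open>1\<close> on the arc from \<open>s\<close> to \<open>t\<close>, \<open>-1\<close> on the arc from
  \<open>t\<close> to \<open>s\<close> and \<open>0\<close> at the end points.  With the skew form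
  \<open>B f g = (\<Sum>(p, q). \<epsilon> (p, q) * f p * g q)\<close>, the sum ranging over the crossings, put \<open>n c = B \<sigma>\<^sub>c 1\<close> and
  \<open>\<beta> c d = B \<sigma>\<^sub>c \<sigma>\<^sub>d\<close>; these are intersection numbers of loops as in Turaev's based matrix of a virtual
  string.  The number \<open>\<Sum>c d. \<epsilon> c * \<epsilon> d * n c * n d * (\<beta> c d)\<^sup>2\<close> is invariant: an
  isolated chord has \<open>n c = 0\<close>, the two chords of a second move have equal \<open>n\<close> and \<open>\<beta>\<close> but
  opposite signs, and a third move preserves \<open>n\<close> and \<open>\<beta>\<close>.  If all crossings are classical,
  \<open>n c\<close> is twice the algebraic intersection number of two closed plane curves, hence \<open>0\<close>, so that
  the invariant vanishes; for the Kishino diagram it is \<open>-1024\<close>.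

  The signs and the order of the crossings inside the disc of a move are controlled through the
  winding number of a strand closed up outside of the disc: it jumps by the crossing sign along the
  other strands, and on the boundary circle it takes only two values, which do not depend on the
  position of the strand inside the disc.
\<close>

section \<open>Signed chord diagrams\<close>

text \<open>The weights \<open>n\<close> are essential: for an isolated chord \<open>c\<close> the
  pairing of \<open>c\<close> with \<open>d\<close> equals \<open>n d\<close> up to sign and not 0,
  so an unweighted sum of squares would change under first moves. The indices alone do not suffice
  either: for the Kishino diagram the products of sign and index at the four crossings are -2, 2,
  -2, 2, so every sum of \<epsilon> c * f (n c) with an odd function f cancels. The pairing has to
  enter. Each crossing is stored as two ordered pairs. Reversing a chord negates its sign, its index
  and its pairings, so a summand does not depend on the directions chosen, the pairing being
  squared; an unordered pair of distinct chords is counted eight times. The chord functions take the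
  values 1 and -1 rather than 1 and 0 so that reversal is a change of sign, and they vanish at the
  two ends so that a chord does not contribute to its own index.\<close>

text \<open>
  For parameters in \<open>{0..<1}\<close> of points of the circle: \<open>1\<close> if \<open>x\<close> lies on the arc from \<open>a\<close> to \<open>b\<close>, also if
  this arc runs through the base point, \<open>-1\<close> if it lies on the complementary arc, \<open>0\<close> at the end points.
\<close>

definition cyclic_sign :: "real \<Rightarrow> real \<Rightarrow> real \<Rightarrow> real" where
  "cyclic_sign a b x = sgn (x - a) * sgn (b - x) * sgn (b - a)"

definition chord_index :: "(real \<times> real) set \<Rightarrow> (real \<times> real \<Rightarrow> real) \<Rightarrow> real \<times> real \<Rightarrow> real" where
  "chord_index P e c = (\<Sum>p\<in>P. e p * cyclic_sign (fst c) (snd c) (fst p))"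

definition chord_pairing :: "(real \<times> real) set \<Rightarrow> (real \<times> real \<Rightarrow> real) \<Rightarrow> real \<times> real \<Rightarrow> real \<times> real \<Rightarrow> real" where
  "chord_pairing P e c d = (\<Sum>p\<in>P. e p * cyclic_sign (fst c) (snd c) (fst p) * cyclic_sign (fst d) (snd d) (snd p))"

definition gauss_invariant :: "(real \<times> real) set \<Rightarrow> (real \<times> real \<Rightarrow> real) \<Rightarrow> real" where
  "gauss_invariant P e = (\<Sum>c\<in>P. \<Sum>d\<in>P. e c * e d * chord_index P e c * chord_index P e d * (chord_pairing P e c d)\<^sup>2)"

definition alternating :: "(real \<times> real) set \<Rightarrow> (real \<times> real \<Rightarrow> real) \<Rightarrow> bool" where
  "alternating P e \<longleftrightarrow> finite P \<and> (\<forall>(p, q)\<in>P. (q, p) \<in> P \<and> e (q, p) = - e (p, q))"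

lemma cyclic_sign_ends [simp]: "cyclic_sign a b a = 0" "cyclic_sign a b b = 0"
  by (simp_all add: cyclic_sign_def)

lemma cyclic_sign_swap: "cyclic_sign b a x = - cyclic_sign a b x"
  unfolding cyclic_sign_def by (simp add: sgn_if)

lemma chord_pairing_swap: "chord_pairing P e (b, a) d = - chord_pairing P e (a, b) d"
  unfolding chord_pairing_def by (simp add: cyclic_sign_swap[of b a] sum_negf)

section \<open>Antisymmetry of the chord sums\<close>

lemma sum_alternating:
  assumes "alternating P e" and "\<And>p q. (p, q) \<in> P \<Longrightarrow> f (q, p) = (- f (p, q) :: real)"
  shows "sum f P = 0"
proof -
  have "sum f P = (\<Sum>p\<in>prod.swap ` P. f p)"
    using assms(1) by (intro sum.cong) (auto simp: alternating_def image_iff Bex_def split: prod.splits)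
  also have "\<dots> = (\<Sum>p\<in>P. f (prod.swap p))"
    by (subst sum.reindex) auto
  also have "\<dots> = (\<Sum>p\<in>P. - f p)"
    using assms(2) by (intro sum.cong) auto
  finally show ?thesis by (simp add: sum_negf)
qed

lemma chord_pairing_skew:
  assumes "alternating P e"
  shows "chord_pairing P e d c = - chord_pairing P e c d"
proof -
  have "(\<Sum>p\<in>P. e p * cyclic_sign (fst d) (snd d) (fst p) * cyclic_sign (fst c) (snd c) (snd p) +
               e p * cyclic_sign (fst c) (snd c) (fst p) * cyclic_sign (fst d) (snd d) (snd p)) = 0"
    by (rule sum_alternating[OF assms])
       (use assms in \<open>auto simp: alternating_def algebra_simps\<close>)
  then show ?thesis by (simp add: chord_pairing_def sum.distrib)
qed

lemma chord_pairing_self: "alternating P e \<Longrightarrow> chord_pairing P e c c = 0"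
  using chord_pairing_skew[of P e c c] by simp

section \<open>Transport of the invariant between chord diagrams\<close>

lemma gauss_invariant_reindex:
  assumes "inj_on f K" "inj_on g K"
    and "\<And>k. k \<in> K \<Longrightarrow> e' (g k) = e (f k)"
    and "\<And>k. k \<in> K \<Longrightarrow> chord_index (g ` K) e' (g k) = chord_index (f ` K) e (f k)"
    and "\<And>k l. k \<in> K \<Longrightarrow> l \<in> K \<Longrightarrow> chord_pairing (g ` K) e' (g k) (g l) = chord_pairing (f ` K) e (f k) (f l)"
  shows "gauss_invariant (g ` K) e' = gauss_invariant (f ` K) e"
  unfolding gauss_invariant_def using assms by (simp add: sum.reindex)

text \<open>Ends enter the invariant only through their cyclic order. The map \<psi> may therefore
  move points across the base point, as a rotation of the circle does, and need not be
  monotone.\<close>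

lemma gauss_invariant_map:
  assumes inj: "inj_on \<psi> S" and PS: "P \<subseteq> S \<times> S"
    and cyclic_sign: "\<And>a b x. a \<in> S \<Longrightarrow> b \<in> S \<Longrightarrow> x \<in> S \<Longrightarrow> cyclic_sign (\<psi> a) (\<psi> b) (\<psi> x) = cyclic_sign a b x"
    and e: "\<And>p. p \<in> P \<Longrightarrow> e' (map_prod \<psi> \<psi> p) = e p"
  shows "gauss_invariant (map_prod \<psi> \<psi> ` P) e' = gauss_invariant P e"
proof -
  have i: "inj_on (map_prod \<psi> \<psi>) P"
    using map_prod_inj_on[OF inj inj] PS by (rule inj_on_subset)
  have "gauss_invariant (map_prod \<psi> \<psi> ` P) e' = gauss_invariant ((\<lambda>p. p) ` P) e"
  proof (rule gauss_invariant_reindex)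
    fix k assume k: "k \<in> P"
    then have "fst k \<in> S" "snd k \<in> S" using PS by auto
    then show "chord_index (map_prod \<psi> \<psi> ` P) e' (map_prod \<psi> \<psi> k) = chord_index ((\<lambda>p. p) ` P) e k"
      using PS e cyclic_sign unfolding chord_index_def
      by (subst sum.reindex[OF i]) (auto intro!: sum.cong simp: subset_iff)
  next
    fix k l assume k: "k \<in> P" "l \<in> P"
    then have "fst k \<in> S" "snd k \<in> S" "fst l \<in> S" "snd l \<in> S" using PS by auto
    then show "chord_pairing (map_prod \<psi> \<psi> ` P) e' (map_prod \<psi> \<psi> k) (map_prod \<psi> \<psi> l) = chord_pairing ((\<lambda>p. p) ` P) e k l"
      using PS e cyclic_sign unfolding chord_pairing_def
      by (subst sum.reindex[OF i]) (auto intro!: sum.cong simp: subset_iff)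
  qed (use i e in auto)
  then show ?thesis by simp
qed

lemma gauss_invariant_cong: "(\<And>p. p \<in> P \<Longrightarrow> e' p = e p) \<Longrightarrow> gauss_invariant P e' = gauss_invariant P e"
  using gauss_invariant_map[of "\<lambda>x. x" UNIV P e' e] by (simp add: map_prod_def)

section \<open>Effect of the local moves on chord diagrams\<close>

lemma alternating_mono: "alternating P e \<Longrightarrow> Q \<subseteq> P \<Longrightarrow> (\<And>p q. (p,q) \<in> Q \<Longrightarrow> (q,p) \<in> Q) \<Longrightarrow> alternating Q e"
  unfolding alternating_def by (auto intro: finite_subset)

text \<open>No end of another chord separates \<open>s\<close> from \<open>t\<close>. Hence an old
  chord has the same value at both, and the contributions of \<open>(s, t)\<close> and
  \<open>(t, s)\<close> to it cancel. The new chord is constantly -1 on the old ends, so its index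
  is minus the total sum of signs, which is 0; this index is a factor of every summand that contains
  the new chord.\<close>

lemma gauss_invariant_add_isolated:
  assumes alt: "alternating Q e" and st: "s < t" and e: "e (t, s) = - e (s, t)"
    and out: "\<And>p q. (p, q) \<in> Q \<Longrightarrow> p \<notin> {s..t}"
  shows "gauss_invariant (Q \<union> {(s, t), (t, s)}) e = gauss_invariant Q e"
proof -
  define P where "P = Q \<union> {(s, t), (t, s)}"
  have out2: "\<And>p q. (p, q) \<in> Q \<Longrightarrow> p \<notin> {s..t} \<and> q \<notin> {s..t}"
    using alt out unfolding alternating_def by blast
  have fin: "finite Q" using alt by (simp add: alternating_def)
  have dis: "Q \<inter> {(s, t), (t, s)} = {}" using out st by force
  have S: "sum f P = sum f Q + f (s, t) + f (t, s)" for f :: "_ \<Rightarrow> real"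
    unfolding P_def using fin dis st by (subst sum.union_disjoint) auto
  have cy: "cyclic_sign (fst c) (snd c) t = cyclic_sign (fst c) (snd c) s" if "c \<in> Q" for c
  proof -
    have "sgn (t - fst c) = sgn (s - fst c)" "sgn (snd c - t) = sgn (snd c - s)"
      using out2[of "fst c" "snd c"] that st by (auto simp: sgn_if)
    then show ?thesis by (simp add: cyclic_sign_def)
  qed
  have idx: "chord_index P e c = chord_index Q e c" if "c \<in> Q" for c
    unfolding chord_index_def S using cy[OF that] e by simp
  have pair: "chord_pairing P e c d = chord_pairing Q e c d" if "c \<in> Q" "d \<in> Q" for c d
    unfolding chord_pairing_def S using cy[OF that(1)] cy[OF that(2)] e by simp
  have c1: "cyclic_sign s t p = -1" if "(p, q) \<in> Q" for p q
    using out[OF that] st by (auto simp: cyclic_sign_def sgn_if)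
  have "sum e Q = 0"
    by (rule sum_alternating[OF alt]) (use alt in \<open>auto simp: alternating_def\<close>)
  moreover have "(\<Sum>p\<in>Q. e p * cyclic_sign s t (fst p)) = (\<Sum>p\<in>Q. - e p)"
    using c1 by (intro sum.cong) auto
  ultimately have i0: "chord_index P e (s, t) = 0"
    unfolding chord_index_def S by (simp add: sum_negf)
  have i1: "chord_index P e (t, s) = 0"
    using i0 unfolding chord_index_def by (simp add: cyclic_sign_swap[of t s] sum_negf)
  define F where "F c d = e c * e d * chord_index P e c * chord_index P e d * (chord_pairing P e c d)\<^sup>2" for c d
  have F0: "F c (s, t) = 0" "F c (t, s) = 0" "F (s, t) c = 0" "F (t, s) c = 0" for c
    by (simp_all add: F_def i0 i1)
  have "gauss_invariant P e = (\<Sum>c\<in>P. sum (F c) P)" by (simp add: gauss_invariant_def F_def)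
  also have "\<dots> = (\<Sum>c\<in>Q. sum (F c) Q)" unfolding S by (simp add: F0)
  also have "\<dots> = gauss_invariant Q e" unfolding gauss_invariant_def F_def using idx pair by (intro sum.cong) auto
  finally show ?thesis unfolding P_def .
qed

text \<open>Meant for a point \<open>x\<close> on the strand of the end \<open>a\<close>: the far
  end \<open>b\<close> does not separate the two, so only the order of \<open>x\<close> and
  \<open>a\<close> along the strand counts.\<close>

lemma cyclic_sign_near:
  assumes "sgn (x - a) \<noteq> 0" "sgn (b - x) = sgn (b - a)" "sgn (b - a) \<noteq> 0"
  shows "cyclic_sign a b x = sgn (x - a)"
  using assms unfolding cyclic_sign_def by (auto simp: sgn_if split: if_splits)

text \<open>The same reduction for a point on the strand of the second end \<open>b\<close>.\<close>

lemma cyclic_sign_near2: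
  assumes "sgn (x - a) = sgn (b - a)" "sgn (b - a) \<noteq> 0"
  shows "cyclic_sign a b x = sgn (b - x)"
  using assms unfolding cyclic_sign_def by (auto simp: sgn_if split: if_splits)

lemma sgn_sub_swap: "sgn (a - b) = - sgn (b - a :: real)"
  by (simp add: sgn_if)

text \<open>No old end separates \<open>u1\<close> from \<open>u2\<close> or \<open>v1\<close> from
  \<open>v2\<close>. So the two new chords have the same function on the old ends, and their
  contributions to old chords cancel because their signs are opposite. They also have the same
  index, the same pairing with every old chord and pairing 0 with each other, so the summands in
  which they occur cancel as well.\<close>

lemma gauss_invariant_add_parallel:
  assumes alt: "alternating Q e" and ne: "u1 \<noteq> u2" "v1 \<noteq> v2"
    and e: "e (v1, u1) = - e (u1, v1)" "e (v2, u2) = - e (u2, v2)" "e (u2, v2) = - e (u1, v1)"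
    and out: "\<And>p q. (p, q) \<in> Q \<Longrightarrow> sgn (u1 - p) = sgn (u2 - p) \<and> sgn (v1 - p) = sgn (v2 - p) \<and> sgn (u1 - p) \<noteq> 0 \<and> sgn (v1 - p) \<noteq> 0"
    and uv: "sgn (u1 - v1) \<noteq> 0" "sgn (u1 - v2) = sgn (u1 - v1)" "sgn (u2 - v1) = sgn (u1 - v1)" "sgn (u2 - v2) = sgn (u1 - v1)"
  shows "gauss_invariant (Q \<union> {(u1, v1), (v1, u1), (u2, v2), (v2, u2)}) e = gauss_invariant Q e"
proof -
  let ?I = "{(u1, v1), (v1, u1), (u2, v2), (v2, u2)}"
  define P where "P = Q \<union> ?I"
  define E where "E = e (u1, v1)"
  have E: "e (u1, v1) = E" "e (v1, u1) = - E" "e (u2, v2) = - E" "e (v2, u2) = E"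
    using e by (auto simp: E_def)
  have fin: "finite Q" using alt by (simp add: alternating_def)
  have uvne: "u1 \<noteq> v1" "u1 \<noteq> v2" "u2 \<noteq> v1" "u2 \<noteq> v2" using uv by force+
  have dis: "Q \<inter> ?I = {}" using out by force
  have S: "sum f P = sum f Q + (f (u1, v1) + f (v1, u1) + f (u2, v2) + f (v2, u2))" for f :: "_ \<Rightarrow> real"
    unfolding P_def using fin dis uvne ne by (subst sum.union_disjoint) (auto simp: algebra_simps)
  have out2: "sgn (u1 - fst c) = sgn (u2 - fst c)" "sgn (v1 - fst c) = sgn (v2 - fst c)"
      "sgn (u1 - snd c) = sgn (u2 - snd c)" "sgn (v1 - snd c) = sgn (v2 - snd c)" if "c \<in> Q" for c
    using out[of "fst c" "snd c"] out[of "snd c" "fst c"] that alt by (auto simp: alternating_def)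
  have cy: "cyclic_sign (fst c) (snd c) u2 = cyclic_sign (fst c) (snd c) u1" "cyclic_sign (fst c) (snd c) v2 = cyclic_sign (fst c) (snd c) v1"
    if "c \<in> Q" for c
    using out2[OF that] by (auto simp: cyclic_sign_def sgn_sub_swap[of "snd c"])
  have alP: "alternating P e"
    using alt e fin by (auto simp: alternating_def P_def)
  have idx: "chord_index P e c = chord_index Q e c" if "c \<in> Q" for c
    unfolding chord_index_def S using cy[OF that] E by simp
  have pair: "chord_pairing P e c d = chord_pairing Q e c d" if "c \<in> Q" "d \<in> Q" for c d
    unfolding chord_pairing_def S using cy[OF that(1)] cy[OF that(2)] E by simp
  have o: "cyclic_sign u1 v1 p = cyclic_sign u2 v2 p" if "(p, q) \<in> Q" for p q
  proof -
    have "sgn (p - u1) = sgn (p - u2)" "sgn (v1 - p) = sgn (v2 - p)" "sgn (v1 - u1) = sgn (v2 - u2)"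
      using out[OF that] uv by (metis sgn_sub_swap)+
    then show ?thesis by (simp add: cyclic_sign_def)
  qed
  \<comment> \<open>The order of \<open>u1\<close>, \<open>u2\<close> and that of \<open>v1\<close>,
    \<open>v2\<close> are left open, that is, the strands may run in parallel or in opposite
    directions. Both indices receive the same combination of these two signs.\<close>
  have cc: "cyclic_sign u1 v1 u2 = sgn (u2 - u1)" "cyclic_sign u1 v1 v2 = sgn (v1 - v2)"
     "cyclic_sign u2 v2 u1 = sgn (u1 - u2)" "cyclic_sign u2 v2 v1 = sgn (v2 - v1)"
    using uv ne uvne by (auto simp: cyclic_sign_def sgn_if split: if_splits)
  have so: "(\<Sum>p\<in>Q. e p * cyclic_sign u1 v1 (fst p)) = (\<Sum>p\<in>Q. e p * cyclic_sign u2 v2 (fst p))"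
    using o by (intro sum.cong) auto
  have i12: "chord_index P e (u1, v1) = chord_index P e (u2, v2)"
    unfolding chord_index_def S using so by (simp add: E cc sgn_sub_swap[of u2] sgn_sub_swap[of v2])
  have isw: "chord_index P e (b, a) = - chord_index P e (a, b)" for a b
    unfolding chord_index_def by (simp add: cyclic_sign_swap[of b a] sum_negf)
  have p12: "chord_pairing P e (u1, v1) d = chord_pairing P e (u2, v2) d" if "d \<in> Q" for d
  proof -
    have so: "(\<Sum>p\<in>Q. e p * cyclic_sign u1 v1 (fst p) * cyclic_sign (fst d) (snd d) (snd p)) = (\<Sum>p\<in>Q. e p * cyclic_sign u2 v2 (fst p) * cyclic_sign (fst d) (snd d) (snd p))"
      using o by (intro sum.cong) auto
    show ?thesis unfolding chord_pairing_def S using so cy[OF that]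
      by (simp add: E cc sgn_sub_swap[of u2] sgn_sub_swap[of v2])
  qed
  \<comment> \<open>Over \<open>Q\<close> both chord functions coincide, which gives the value of a
    skew form on the diagonal. In each of the four remaining terms one factor is evaluated at an end
    of its own chord and vanishes.\<close>
  have p120: "chord_pairing P e (u1, v1) (u2, v2) = 0"
  proof -
    have "(\<Sum>p\<in>Q. e p * cyclic_sign u1 v1 (fst p) * cyclic_sign u2 v2 (snd p)) = (\<Sum>p\<in>Q. e p * cyclic_sign u1 v1 (fst p) * cyclic_sign u1 v1 (snd p))"
      using o alt by (intro sum.cong) (auto simp: alternating_def)
    also have "\<dots> = chord_pairing Q e (u1, v1) (u1, v1)" by (simp add: chord_pairing_def)
    also have "\<dots> = 0" by (rule chord_pairing_self[OF alt])
    finally show ?thesis unfolding chord_pairing_def S by simp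
  qed
  have p210: "chord_pairing P e (u2, v2) (u1, v1) = 0"
    using chord_pairing_skew[OF alP, of "(u2,v2)" "(u1,v1)"] p120 by simp
  note self = chord_pairing_self[OF alP]
  have sw2: "chord_pairing P e d (b, a) = - chord_pairing P e d (a, b)" for a b d
    using chord_pairing_skew[OF alP, of d "(b, a)"] chord_pairing_skew[OF alP, of d "(a, b)"] chord_pairing_swap[of P e b a d] by simp
  have p12': "chord_pairing P e d (u1, v1) = chord_pairing P e d (u2, v2)" if "d \<in> Q" for d
    using p12[OF that] chord_pairing_skew[OF alP, of d "(u1, v1)"] chord_pairing_skew[OF alP, of d "(u2, v2)"] by simp
  define F where "F c d = e c * e d * chord_index P e c * chord_index P e d * (chord_pairing P e c d)\<^sup>2" for c d
  have row: "sum (F c) P = sum (F c) Q" if "c \<in> P" for c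
  proof -
    have 1: "(chord_pairing P e c (u1, v1))\<^sup>2 = (chord_pairing P e c (u2, v2))\<^sup>2" if "c \<in> Q" for c
      using p12'[OF that] by simp
    have "(chord_pairing P e c (u1, v1))\<^sup>2 = (chord_pairing P e c (u2, v2))\<^sup>2"
    proof (cases "c \<in> Q")
      case False
      then have "c \<in> {(u1, v1), (v1, u1), (u2, v2), (v2, u2)}" using that by (simp add: P_def)
      then show ?thesis using self p120 p210 by (auto simp: chord_pairing_swap[of P e v1] chord_pairing_swap[of P e v2])
    qed (rule 1)
    then have "F c (u1, v1) + F c (v1, u1) + F c (u2, v2) + F c (v2, u2) = 0"
      unfolding F_def by (simp add: E isw[of v1] isw[of v2] i12 sw2[of c v1] sw2[of c v2])
    then show ?thesis by (simp add: S)
  qed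
  have col: "F (u1, v1) d + F (v1, u1) d + F (u2, v2) d + F (v2, u2) d = 0" if "d \<in> Q" for d
    using p12[OF that] unfolding F_def
    by (simp add: E isw[of v1] isw[of v2] i12 chord_pairing_swap[of P e v1] chord_pairing_swap[of P e v2])
  have "gauss_invariant P e = (\<Sum>c\<in>P. sum (F c) P)" by (simp add: gauss_invariant_def F_def)
  also have "\<dots> = (\<Sum>c\<in>P. sum (F c) Q)" by (rule sum.cong[OF refl row])
  also have "\<dots> = (\<Sum>c\<in>Q. sum (F c) Q) + (\<Sum>d\<in>Q. F (u1, v1) d + F (v1, u1) d + F (u2, v2) d + F (v2, u2) d)"
    by (simp add: S sum.distrib)
  also have "\<dots> = (\<Sum>c\<in>Q. sum (F c) Q)" using col by simp
  also have "\<dots> = gauss_invariant Q e" unfolding gauss_invariant_def F_def using idx pair by (intro sum.cong) auto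
  finally show ?thesis unfolding P_def .
qed


lemma sum_pairs3:
  assumes "{i, j, k} = {..<3::nat}" "i \<noteq> j" "j \<noteq> k" "i \<noteq> k"
  shows "(\<Sum>p | p \<in> {..<3} \<times> {..<3} \<and> fst p \<noteq> snd p. f p) =
    f (i, j) + f (j, i) + f (i, k) + f (k, i) + f (j, k) + (f (k, j) :: real)"
proof -
  have "{p \<in> {..<3} \<times> {..<3}. fst p \<noteq> snd p} = {(i, j), (j, i), (i, k), (k, i), (j, k), (k, j)}"
    unfolding assms(1)[symmetric] using assms(2-) by auto
  then show ?thesis using assms(2-) by (simp add: algebra_simps)
qed

text \<open>
  Assumption \<open>con\<close> holds for three strands of a disc because at the corners of the triangle which they
  form one turns into the same direction when running around it.
\<close>

lemma gauss_invariant_triangle: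
  fixes x y :: "nat \<Rightarrow> nat \<Rightarrow> real" and z :: "nat \<Rightarrow> real"
  defines "I \<equiv> {p \<in> {..<3} \<times> {..<3}. fst p \<noteq> snd p}"
  assumes alt: "alternating Q e" and fin: "finite Q"
    and ee: "\<And>c. c \<in> Q \<Longrightarrow> e' c = e c"
    and ex: "\<And>i j. i < 3 \<Longrightarrow> j < 3 \<Longrightarrow> i \<noteq> j \<Longrightarrow> e (x i j, x j i) = s i j \<and> e' (y i j, y j i) = s i j"
    and s: "\<And>i j. i < 3 \<Longrightarrow> j < 3 \<Longrightarrow> i \<noteq> j \<Longrightarrow> s j i = - s i j"
    and out: "\<And>p q i j. (p, q) \<in> Q \<Longrightarrow> i < 3 \<Longrightarrow> j < 3 \<Longrightarrow> i \<noteq> j \<Longrightarrow>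
       sgn (x i j - p) = sgn (z i - p) \<and> sgn (y i j - p) = sgn (z i - p) \<and> z i \<noteq> p"
    and xy: "\<And>i j i' j'. i < 3 \<Longrightarrow> j < 3 \<Longrightarrow> i \<noteq> j \<Longrightarrow> i' < 3 \<Longrightarrow> j' < 3 \<Longrightarrow> i' \<noteq> j' \<Longrightarrow> i \<noteq> i' \<Longrightarrow>
       sgn (x i j - x i' j') = sgn (z i - z i') \<and> sgn (y i j - y i' j') = sgn (z i - z i') \<and> z i \<noteq> z i'"
    and ord: "\<And>i j k. i < 3 \<Longrightarrow> j < 3 \<Longrightarrow> k < 3 \<Longrightarrow> i \<noteq> j \<Longrightarrow> j \<noteq> k \<Longrightarrow> i \<noteq> k \<Longrightarrow>
       sgn (y i j - y i k) = - sgn (x i j - x i k) \<and> x i j \<noteq> x i k"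
    and con: "\<And>i j k. i < 3 \<Longrightarrow> j < 3 \<Longrightarrow> k < 3 \<Longrightarrow> i \<noteq> j \<Longrightarrow> j \<noteq> k \<Longrightarrow> i \<noteq> k \<Longrightarrow>
       s i k * sgn (x i k - x i j) = s j k * sgn (x j k - x j i)"
  shows "gauss_invariant (Q \<union> (\<lambda>p. (y (fst p) (snd p), y (snd p) (fst p))) ` I) e' =
    gauss_invariant (Q \<union> (\<lambda>p. (x (fst p) (snd p), x (snd p) (fst p))) ` I) e"
proof -
  let ?x = "\<lambda>p. (x (fst p) (snd p), x (snd p) (fst p))"
  let ?y = "\<lambda>p. (y (fst p) (snd p), y (snd p) (fst p))"
  \<comment> \<open>Both chord sets are indexed by a disjoint sum: the left summand holds the chords
    outside of the disc, the right one the ordered pairs of strands, \<open>(i, j)\<close> standing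
    for the chord that starts on strand \<open>i\<close> and ends on strand
    \<open>j\<close>.\<close>
  define f where "f = case_sum (\<lambda>c. c) ?x"
  define g where "g = case_sum (\<lambda>c. c) ?y"
  have finI: "finite I" unfolding I_def by (rule finite_subset[of _ "{..<3} \<times> {..<3}"]) auto
  have P: "f ` (Q <+> I) = Q \<union> ?x ` I" "g ` (Q <+> I) = Q \<union> ?y ` I"
    unfolding f_def g_def Plus_def image_Un image_image by simp_all
  have xinj: "p = q" if "p \<in> I" "q \<in> I" "?x p = ?x q" for p q
  proof -
    obtain i j i' j' where pq: "p = (i, j)" "q = (i', j')" by (cases p, cases q)
    have ii: "i < 3" "j < 3" "i \<noteq> j" "i' < 3" "j' < 3" "i' \<noteq> j'" using that by (auto simp: I_def pq)
    have "i = i'" using xy[OF ii] that(3) by (auto simp: pq sgn_zero_iff)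
    moreover have "j = j'" using xy[of j i j' i'] ii that(3) by (auto simp: pq sgn_zero_iff)
    ultimately show ?thesis by (simp add: pq)
  qed
  have yinj: "p = q" if "p \<in> I" "q \<in> I" "?y p = ?y q" for p q
  proof -
    obtain i j i' j' where pq: "p = (i, j)" "q = (i', j')" by (cases p, cases q)
    have ii: "i < 3" "j < 3" "i \<noteq> j" "i' < 3" "j' < 3" "i' \<noteq> j'" using that by (auto simp: I_def pq)
    have "i = i'" using xy[OF ii] that(3) by (auto simp: pq sgn_zero_iff)
    moreover have "j = j'" using xy[of j i j' i'] ii that(3) by (auto simp: pq sgn_zero_iff)
    ultimately show ?thesis by (simp add: pq)
  qed
  have xQ: "?x p \<notin> Q" "?y p \<notin> Q" if "p \<in> I" for p
    using out[of _ _ "fst p" "snd p"] that by (auto simp: I_def sgn_zero_iff; metis sgn_zero_iff right_minus_eq)+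
  have inj: "inj_on f (Q <+> I)" "inj_on g (Q <+> I)"
    unfolding inj_on_def f_def g_def using xinj yinj xQ by (auto simp: Plus_def; metis)+
  have Sx: "sum h (Q \<union> ?x ` I) = sum h Q + (\<Sum>p\<in>I. h (?x p))"
   and Sy: "sum h (Q \<union> ?y ` I) = sum h Q + (\<Sum>p\<in>I. h (?y p))" for h :: "_ \<Rightarrow> real"
  proof -
    have "sum h (?x ` I) = (\<Sum>p\<in>I. h (?x p))" using xinj by (subst sum.reindex) (auto simp: inj_on_def)
    moreover have "Q \<inter> ?x ` I = {}" using xQ by blast
    ultimately show "sum h (Q \<union> ?x ` I) = sum h Q + (\<Sum>p\<in>I. h (?x p))"
      using fin finI by (subst sum.union_disjoint) auto
    have "sum h (?y ` I) = (\<Sum>p\<in>I. h (?y p))" using yinj by (subst sum.reindex) (auto simp: inj_on_def)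
    moreover have "Q \<inter> ?y ` I = {}" using xQ by blast
    ultimately show "sum h (Q \<union> ?y ` I) = sum h Q + (\<Sum>p\<in>I. h (?y p))"
      using fin finI by (subst sum.union_disjoint) auto
  qed
  define X where "X = Q \<union> ?x ` I"
  define Y where "Y = Q \<union> ?y ` I"
  have Isw: "(j, i) \<in> I \<and> i < 3 \<and> j < 3 \<and> i \<noteq> j" if "(i, j) \<in> I" for i j
    using that by (simp add: I_def)
  have altX: "alternating X e" unfolding alternating_def
  proof (intro conjI ballI)
    fix c assume "c \<in> X"
    then consider "c \<in> Q" | i j where "(i, j) \<in> I" "c = (x i j, x j i)" unfolding X_def by fastforce
    then show "case c of (p, q) \<Rightarrow> (q, p) \<in> X \<and> e (q, p) = - e (p, q)"
    proof cases
      case 1 then show ?thesis using alt by (auto simp: X_def alternating_def)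
    next
      case 2
      moreover have "(x j i, x i j) \<in> X" using Isw[OF 2(1)] unfolding X_def by force
      ultimately show ?thesis using ex[of i j] ex[of j i] s[of i j] Isw[OF 2(1)] by auto
    qed
  qed (use fin finI in \<open>simp add: X_def\<close>)
  have altY: "alternating Y e'" unfolding alternating_def
  proof (intro conjI ballI)
    fix c assume "c \<in> Y"
    then consider "c \<in> Q" | i j where "(i, j) \<in> I" "c = (y i j, y j i)" unfolding Y_def by fastforce
    then show "case c of (p, q) \<Rightarrow> (q, p) \<in> Y \<and> e' (q, p) = - e' (p, q)"
    proof cases
      case 1 then show ?thesis using alt ee by (auto simp: Y_def alternating_def)
    next
      case 2
      moreover have "(y j i, y i j) \<in> Y" using Isw[OF 2(1)] unfolding Y_def by force
      ultimately show ?thesis using ex[of i j] ex[of j i] s[of i j] Isw[OF 2(1)] by auto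
    qed
  qed (use fin finI in \<open>simp add: Y_def\<close>)
  \<comment> \<open>Seen from the ends of outer chords the whole strand \<open>i\<close> is a single
    point, so its crossings may be replaced by the representative \<open>z i\<close> before as well
    as after the move.\<close>
  have out2: "sgn (x i j - fst c) = sgn (z i - fst c)" "sgn (y i j - fst c) = sgn (z i - fst c)"
     "sgn (x i j - snd c) = sgn (z i - snd c)" "sgn (y i j - snd c) = sgn (z i - snd c)"
     if "c \<in> Q" "i < 3" "j < 3" "i \<noteq> j" for c i j
    using out[of "fst c" "snd c" i j] out[of "snd c" "fst c" i j] that alt by (auto simp: alternating_def)
  have co: "cyclic_sign (fst c) (snd c) (x i j) = cyclic_sign (fst c) (snd c) (z i)"
    "cyclic_sign (fst c) (snd c) (y i j) = cyclic_sign (fst c) (snd c) (z i)"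
    if "c \<in> Q" "i < 3" "j < 3" "i \<noteq> j" for c i j
    using out2[OF that] by (simp_all add: cyclic_sign_def sgn_sub_swap[of "snd c"])
  have ci: "cyclic_sign (x i j) (x j i) p = cyclic_sign (z i) (z j) p" "cyclic_sign (y i j) (y j i) p = cyclic_sign (z i) (z j) p"
    if "(p, q) \<in> Q" "i < 3" "j < 3" "i \<noteq> j" for i j p q
    using out[OF that] out[OF that(1,3,2)] xy[of j i i j] that(2-)
    unfolding cyclic_sign_def by (simp_all add: sgn_sub_swap[of p])
  have ck: "cyclic_sign (x i j) (x j i) (x k l) = cyclic_sign (z i) (z j) (z k)"
     "cyclic_sign (y i j) (y j i) (y k l) = cyclic_sign (z i) (z j) (z k)"
    if "i < 3" "j < 3" "k < 3" "l < 3" "i \<noteq> j" "j \<noteq> k" "i \<noteq> k" "l \<noteq> k" for i j k l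
    using xy[of k l i j] xy[of j i k l] xy[of j i i j] that unfolding cyclic_sign_def by simp_all
  \<comment> \<open>The chord functions change only here: on a strand that carries an end of the
    chord, the crossing with the third strand passes to the other side of that end.\<close>
  have cx1: "cyclic_sign (x i j) (x j i) (x i k) = sgn (x i k - x i j)"
    and cy1: "cyclic_sign (y i j) (y j i) (y i k) = - sgn (x i k - x i j)"
    and cx2: "cyclic_sign (x i j) (x j i) (x j k) = - sgn (x j k - x j i)"
    and cy2: "cyclic_sign (y i j) (y j i) (y j k) = sgn (x j k - x j i)"
    if "i < 3" "j < 3" "k < 3" "i \<noteq> j" "j \<noteq> k" "i \<noteq> k" for i j k
  proof -
    note sgn_zero_iff[simp]
    have a: "sgn (x j i - x i k) = sgn (x j i - x i j)" "x j i \<noteq> x i j"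
      "sgn (y j i - y i k) = sgn (y j i - y i j)" "y j i \<noteq> y i j"
      using xy[of j i i k] xy[of j i i j] that by auto
    have b: "sgn (x j k - x i j) = sgn (x j i - x i j)" "sgn (y j k - y i j) = sgn (y j i - y i j)"
      using xy[of j k i j] xy[of j i i j] that by auto
    have c: "sgn (y i k - y i j) = - sgn (x i k - x i j)" "x i k \<noteq> x i j"
       "sgn (y j i - y j k) = - sgn (x j i - x j k)"
      using ord[of i k j] ord[of j i k] that by auto
    have "y i k \<noteq> y i j" using c by (auto simp: sgn_zero_iff)
    show "cyclic_sign (x i j) (x j i) (x i k) = sgn (x i k - x i j)"
      using a c by (intro cyclic_sign_near) (auto simp: sgn_zero_iff)
    have "cyclic_sign (y i j) (y j i) (y i k) = sgn (y i k - y i j)"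
      using a \<open>y i k \<noteq> y i j\<close> by (intro cyclic_sign_near) (auto simp: sgn_zero_iff)
    then show "cyclic_sign (y i j) (y j i) (y i k) = - sgn (x i k - x i j)" using c by simp
    show "cyclic_sign (x i j) (x j i) (x j k) = - sgn (x j k - x j i)"
      using cyclic_sign_near2[of "x j k" "x i j" "x j i"] a b by (simp add: sgn_zero_iff sgn_sub_swap[of "x j i" "x j k"])
    show "cyclic_sign (y i j) (y j i) (y j k) = sgn (x j k - x j i)"
      using cyclic_sign_near2[of "y j k" "y i j" "y j i"] a b c by (simp add: sgn_zero_iff sgn_sub_swap[of "x j i" "x j k"])
  qed
  have third: "\<exists>k. {i, j, k} = {..<3} \<and> i \<noteq> j \<and> j \<noteq> k \<and> i \<noteq> k \<and> i < 3 \<and> j < 3 \<and> k < 3"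
    if "(i, j) \<in> I" for i j
  proof -
    have "i \<in> {0,1,2}" "j \<in> {0,1,2}" "i \<noteq> j" using that by (auto simp: I_def)
    then have "\<exists>k\<in>{0,1,2}. k \<noteq> i \<and> k \<noteq> j" by auto
    then obtain k where k: "k \<in> {0,1,2}" "k \<noteq> i" "k \<noteq> j" by blast
    show ?thesis using k \<open>i \<in> _\<close> \<open>j \<in> _\<close> \<open>i \<noteq> j\<close> by (intro exI[of _ k]) (auto; fail | force)+
  qed
  have idxQ: "chord_index Y e' c = chord_index X e c" if "c \<in> Q" for c
  proof -
    have "(\<Sum>p\<in>I. e' (?y p) * cyclic_sign (fst c) (snd c) (fst (?y p))) = (\<Sum>p\<in>I. e (?x p) * cyclic_sign (fst c) (snd c) (fst (?x p)))"
      using co[OF that] ex by (intro sum.cong) (auto simp: I_def)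
    then show ?thesis unfolding chord_index_def X_def Y_def Sx Sy using ee by simp
  qed
  have pairQ: "chord_pairing Y e' c d = chord_pairing X e c d" if "c \<in> Q" "d \<in> Q" for c d
  proof -
    have "(\<Sum>p\<in>I. e' (?y p) * cyclic_sign (fst c) (snd c) (fst (?y p)) * cyclic_sign (fst d) (snd d) (snd (?y p)))
        = (\<Sum>p\<in>I. e (?x p) * cyclic_sign (fst c) (snd c) (fst (?x p)) * cyclic_sign (fst d) (snd d) (snd (?x p)))"
      using co[OF that(1)] co[OF that(2)] ex by (intro sum.cong) (auto simp: I_def)
    then show ?thesis unfolding chord_pairing_def X_def Y_def Sx Sy using ee by simp
  qed
  have idxI: "chord_index Y e' (?y p) = chord_index X e (?x p)" if "p \<in> I" for p
  proof -
    obtain i j where p: "p = (i, j)" by (cases p)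
    obtain k where k: "{i, j, k} = {..<3}" "i \<noteq> j" "j \<noteq> k" "i \<noteq> k" "i < 3" "j < 3" "k < 3"
      using third \<open>p \<in> I\<close> p by blast
    have o: "(\<Sum>q\<in>Q. e' q * cyclic_sign (y i j) (y j i) (fst q)) = (\<Sum>q\<in>Q. e q * cyclic_sign (x i j) (x j i) (fst q))"
      using ci k ee by (intro sum.cong) auto
    \<comment> \<open>By \<open>con\<close> the terms of \<open>(i, k)\<close> and
      \<open>(j, k)\<close> cancel before and after the move. The terms of \<open>(k, i)\<close> and
      \<open>(k, j)\<close> are evaluated on strand \<open>k\<close>, where the function of the
      chord \<open>(i, j)\<close> does not change.\<close>
    show ?thesis unfolding chord_index_def X_def Y_def Sx Sy unfolding I_def sum_pairs3[OF k(1-4)]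
      using k ex o con[of i j k] cx1[of i j k] cy1[of i j k] cx2[of i j k] cy2[of i j k] ck[of i j k]
      by (simp add: p)
  qed
  have pairIQ: "chord_pairing Y e' (?y p) d = chord_pairing X e (?x p) d" if "p \<in> I" "d \<in> Q" for p d
  proof -
    obtain i j where p: "p = (i, j)" by (cases p)
    obtain k where k: "{i, j, k} = {..<3}" "i \<noteq> j" "j \<noteq> k" "i \<noteq> k" "i < 3" "j < 3" "k < 3"
      using third \<open>p \<in> I\<close> p by blast
    have o: "(\<Sum>q\<in>Q. e' q * cyclic_sign (y i j) (y j i) (fst q) * cyclic_sign (fst d) (snd d) (snd q)) =
        (\<Sum>q\<in>Q. e q * cyclic_sign (x i j) (x j i) (fst q) * cyclic_sign (fst d) (snd d) (snd q))"
      using ci k ee by (intro sum.cong) auto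
    have c1: "s i k * sgn (x i k - x i j) = s j k * sgn (x j k - x j i)"
      using con[of i j k] k by metis
    \<comment> \<open>The terms of \<open>(i, k)\<close> and \<open>(j, k)\<close> carry the same
      factor from \<open>d\<close>, namely its value on strand \<open>k\<close>, so they cancel as
      they do in the index.\<close>
    show ?thesis unfolding chord_pairing_def X_def Y_def Sx Sy unfolding I_def sum_pairs3[OF k(1-4)]
      using k ex o c1 cx1[of i j k] cy1[of i j k] cx2[of i j k] cy2[of i j k] ck[of i j k] co[OF that(2)]
      by (simp add: p)
  qed
  have pairII: "chord_pairing Y e' (?y (i, j)) (?y (i, k)) = chord_pairing X e (?x (i, j)) (?x (i, k))"
    if k: "{i, j, k} = {..<3}" "i \<noteq> j" "j \<noteq> k" "i \<noteq> k" "i < 3" "j < 3" "k < 3" for i j k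
  proof -
    have o: "(\<Sum>q\<in>Q. e' q * cyclic_sign (y i j) (y j i) (fst q) * cyclic_sign (y i k) (y k i) (snd q)) =
        (\<Sum>q\<in>Q. e q * cyclic_sign (x i j) (x j i) (fst q) * cyclic_sign (x i k) (x k i) (snd q))"
      using ci k ee alt by (intro sum.cong) (auto simp: alternating_def)
    \<comment> \<open>Only the crossing of strands \<open>j\<close> and \<open>k\<close>
      contributes. In the term of \<open>(j, k)\<close> both factors change sign under the move; in
      the term of \<open>(k, j)\<close> neither does.\<close>
    show ?thesis unfolding chord_pairing_def X_def Y_def Sx Sy unfolding I_def sum_pairs3[OF k(1-4)]
      using k ex o cx2[of i j k] cy2[of i j k] ck[of i j k] ck[of i k j] cx2[of i k j] cy2[of i k j]
      by simp
  qed
  have swX: "chord_pairing X e c (b, a) = - chord_pairing X e c (a, b)" for a b c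
    using chord_pairing_skew[OF altX, of c "(b, a)"] chord_pairing_skew[OF altX, of c "(a, b)"] chord_pairing_swap[of X e b a c] by simp
  have swY: "chord_pairing Y e' c (b, a) = - chord_pairing Y e' c (a, b)" for a b c
    using chord_pairing_skew[OF altY, of c "(b, a)"] chord_pairing_skew[OF altY, of c "(a, b)"] chord_pairing_swap[of Y e' b a c] by simp
  have pairI: "chord_pairing Y e' (?y p) (?y q) = chord_pairing X e (?x p) (?x q)" if pq: "p \<in> I" "q \<in> I" for p q
  proof -
    obtain i j where p: "p = (i, j)" by (cases p)
    obtain k where k: "{i, j, k} = {..<3}" "i \<noteq> j" "j \<noteq> k" "i \<noteq> k" "i < 3" "j < 3" "k < 3"
      using third \<open>p \<in> I\<close> p by blast
    consider "q = (i,j)" | "q = (j,i)" | "q = (i,k)" | "q = (k,i)" | "q = (j,k)" | "q = (k,j)"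
      using pq(2) unfolding I_def k(1)[symmetric] by auto
    moreover have ik: "chord_pairing Y e' (y i j, y j i) (y i k, y k i) = chord_pairing X e (x i j, x j i) (x i k, x k i)"
      using pairII[of i j k] k by simp
    moreover have jk: "chord_pairing Y e' (y i j, y j i) (y j k, y k j) = chord_pairing X e (x i j, x j i) (x j k, x k j)"
      using pairII[of j i k] k
      by (simp add: insert_commute chord_pairing_swap[of X e "x j i" "x i j"] chord_pairing_swap[of Y e' "y j i" "y i j"])
    ultimately show ?thesis
      by cases (simp_all add: p chord_pairing_self[OF altX] chord_pairing_self[OF altY] swX[of _ "x j i" "x i j"]
        swY[of _ "y j i" "y i j"] swX[of _ "x k i" "x i k"] swY[of _ "y k i" "y i k"]
        swX[of _ "x k j" "x j k"] swY[of _ "y k j" "y j k"])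
  qed
  have pairQI: "chord_pairing Y e' d (?y p) = chord_pairing X e d (?x p)" if "p \<in> I" "d \<in> Q" for p d
    using pairIQ[OF that] chord_pairing_skew[OF altX, of d "?x p"] chord_pairing_skew[OF altY, of d "?y p"] by simp
  have "gauss_invariant (g ` (Q <+> I)) e' = gauss_invariant (f ` (Q <+> I)) e"
  proof (rule gauss_invariant_reindex[OF inj])
    show "e' (g k) = e (f k)" if "k \<in> Q <+> I" for k
      using that ee ex by (auto simp: f_def g_def I_def Plus_def)
    show "chord_index (g ` (Q <+> I)) e' (g k) = chord_index (f ` (Q <+> I)) e (f k)" if "k \<in> Q <+> I" for k
      unfolding P X_def[symmetric] Y_def[symmetric] using that idxQ idxI by (auto simp: f_def g_def)
    show "chord_pairing (g ` (Q <+> I)) e' (g k) (g l) = chord_pairing (f ` (Q <+> I)) e (f k) (f l)"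
      if "k \<in> Q <+> I" "l \<in> Q <+> I" for k l
      unfolding P X_def[symmetric] Y_def[symmetric]
      using that pairQ pairI pairIQ pairQI by (auto simp: f_def g_def)
  qed
  then show ?thesis unfolding P .
qed

section \<open>Jumps of winding numbers\<close>

definition det2 :: "complex \<Rightarrow> complex \<Rightarrow> real" where
  "det2 v w = Im (cnj v * w)"

lemma det2_eq: "det2 v w = Re v * Im w - Im v * Re w"
  by (simp add: det2_def)

lemma det2_le: "\<bar>det2 v w\<bar> \<le> norm v * norm w"
  unfolding det2_def using abs_Im_le_cmod[of "cnj v * w"] by (simp add: norm_mult)

text \<open>Linear independence of \<open>v\<close> and \<open>w\<close> with a constant: the
  determinant of the combination with \<open>v\<close> isolates the coefficient \<open>k\<close>,
  that with \<open>w\<close> isolates \<open>h\<close>.\<close>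

lemma det2_bound:
  "\<bar>det2 v w\<bar> * (\<bar>h\<bar> + \<bar>k\<bar>) \<le> (norm v + norm w) * norm (of_real h * v + of_real k * w)"
proof -
  let ?z = "of_real h * v + of_real k * w"
  have "\<bar>k\<bar> * \<bar>det2 v w\<bar> = \<bar>det2 v ?z\<bar>"
    by (simp add: det2_eq algebra_simps flip: abs_mult)
  also have "\<dots> \<le> norm v * norm ?z" by (rule det2_le)
  finally have 1: "\<bar>k\<bar> * \<bar>det2 v w\<bar> \<le> norm v * norm ?z" .
  have "\<bar>h\<bar> * \<bar>det2 v w\<bar> = \<bar>det2 ?z w\<bar>"
    by (simp add: det2_eq algebra_simps flip: abs_mult)
  also have "\<dots> \<le> norm ?z * norm w" by (rule det2_le)
  finally have 2: "\<bar>h\<bar> * \<bar>det2 v w\<bar> \<le> norm ?z * norm w" .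
  show ?thesis using add_mono[OF 1 2] by (simp add: algebra_simps)
qed

text \<open>The number \<epsilon> serves as the error rate of linear approximations near a crossing.
  The factor 8 leaves room for the few error terms of size at most \<epsilon> (\<bar>h\<bar> +
  \<bar>k\<bar>) that are later compared with the lower bound.\<close>

lemma det2_margin:
  assumes det: "det2 v w \<noteq> 0"
  obtains \<epsilon> where "0 < \<epsilon>" "\<epsilon> * (norm v + norm w) = \<bar>det2 v w\<bar> / 8" "0 < norm v + norm w" "8 * \<epsilon> \<le> norm v + norm w"
    "\<And>h k. 8 * \<epsilon> * (\<bar>h\<bar> + \<bar>k\<bar>) \<le> norm (of_real h * v + of_real k * w)"
proof -
  define M where "M = norm v + norm w"
  define \<epsilon> where "\<epsilon> = \<bar>det2 v w\<bar> / (8 * M)"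
  have M: "0 < M" using det det2_le[of v w] unfolding M_def
    by (smt (verit) mult_eq_0_iff norm_ge_zero)
  have \<epsilon>: "0 < \<epsilon>" and \<epsilon>M: "\<epsilon> * M = \<bar>det2 v w\<bar> / 8" using det M by (simp_all add: \<epsilon>_def)
  have "\<bar>det2 v w\<bar> \<le> norm v * norm w" by (rule det2_le)
  also have "\<dots> \<le> M * M" using M by (intro mult_mono) (auto simp: M_def)
  finally have "8 * \<epsilon> * M \<le> M * M" using \<epsilon>M by simp
  then have \<epsilon>8: "8 * \<epsilon> \<le> M" using M by simp
  have low: "8 * \<epsilon> * (\<bar>h\<bar> + \<bar>k\<bar>) \<le> norm (of_real h * v + of_real k * w)" for h k
  proof -
    have "M * (8 * \<epsilon> * (\<bar>h\<bar> + \<bar>k\<bar>)) = \<bar>det2 v w\<bar> * (\<bar>h\<bar> + \<bar>k\<bar>)"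
      using M by (simp add: \<epsilon>_def)
    also have "\<dots> \<le> M * norm (of_real h * v + of_real k * w)" unfolding M_def by (rule det2_bound)
    finally show ?thesis using M by simp
  qed
  show ?thesis using that[of \<epsilon>] \<epsilon> \<epsilon>M M \<epsilon>8 low unfolding M_def by blast
qed

text \<open>Two logarithms of the same value differ by a multiple of 2 \<pi> \<i>. The difference of
  two continuous ones thus has a discrete range, and the crude separation 1 is enough for constancy
  on a connected set.\<close>

lemma log_diff_const:
  fixes f g :: "'a::topological_space \<Rightarrow> complex"
  assumes "connected S" "continuous_on S f" "continuous_on S g"
    and "\<And>t. t \<in> S \<Longrightarrow> exp (f t) = exp (g t)" and "a \<in> S" "b \<in> S"
  shows "f a - f b = g a - g b"
proof -
  have "(\<lambda>t. f t - g t) constant_on S"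
  proof (rule continuous_discrete_range_constant[OF assms(1)])
    show "continuous_on S (\<lambda>t. f t - g t)" using assms by (intro continuous_intros)
    fix x assume x: "x \<in> S"
    show "\<exists>e>0. \<forall>y. y \<in> S \<and> f y - g y \<noteq> f x - g x \<longrightarrow> e \<le> cmod (f y - g y - (f x - g x))"
    proof (intro exI[of _ 1] conjI allI impI)
      fix y assume y: "y \<in> S \<and> f y - g y \<noteq> f x - g x"
      show "1 \<le> cmod (f y - g y - (f x - g x))"
      proof (rule ccontr)
        assume "\<not> ?thesis"
        then have "\<bar>Im (f y - g y) - Im (f x - g x)\<bar> < 1"
          using abs_Im_le_cmod[of "f y - g y - (f x - g x)"] by simp
        then have "\<bar>Im (f y - g y) - Im (f x - g x)\<bar> < 2 * pi" using pi_gt3 by linarith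
        moreover have "exp (f y - g y) = exp (f x - g x)"
          using assms(4) x y by (simp add: exp_diff)
        ultimately show False using exp_complex_eqI y by blast
      qed
    qed simp
  qed
  then show ?thesis using assms(5,6) unfolding constant_on_def by (metis diff_eq_eq add_diff_eq add.commute diff_diff_eq2)
qed

text \<open>Far from the crossing the principal branch is a continuous logarithm of the quotient;
  near it, where only the positive reals are avoided, the branch cut along them is used. The total
  change is collected at \<open>u1\<close> and \<open>u2\<close>, where the two branches are
  compared.\<close>

lemma log_jump:
  fixes D :: "real \<Rightarrow> complex" and s :: real
  assumes cont: "continuous_on {0..1} D" and u: "0 \<le> u1" "u1 < u2" "u2 \<le> 1"
    and loop: "exp (D 0) = exp (D 1)"
    and far: "\<And>t. t \<in> {0..u1} \<union> {u2..1} \<Longrightarrow> exp (D t) \<notin> \<real>\<^sub>\<le>\<^sub>0"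
    and mid: "\<And>t. t \<in> {u1..u2} \<Longrightarrow> exp (D t) \<notin> \<real>\<^sub>\<ge>\<^sub>0"
    and s: "s = 1 \<or> s = -1" and s1: "0 < s * Im (exp (D u1))" and s2: "s * Im (exp (D u2)) < 0"
  shows "D 1 - D 0 = 2 * of_real pi * \<i> * of_real s"
proof -
  have *: "D a - D b = Ln (exp (D a)) - Ln (exp (D b))" if "{x..y} \<subseteq> {0..u1} \<union> {u2..1}" "a \<in> {x..y}" "b \<in> {x..y}" for x y a b
  proof (rule log_diff_const[of "{x..y}"])
    have "{x..y} \<subseteq> {0..1}" using that(1) u by force
    then have c: "continuous_on {x..y} D" using cont continuous_on_subset by blast
    then show "continuous_on {x..y} D" .
    show "continuous_on {x..y} (\<lambda>t. Ln (exp (D t)))"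
      using that(1) far by (intro continuous_intros c) auto
  qed (use that in auto)
  have 1: "D u1 - D 0 = Ln (exp (D u1)) - Ln (exp (D 0))"
    by (rule *[of 0 u1]) (use u in auto)
  have 2: "D 1 - D u2 = Ln (exp (D 1)) - Ln (exp (D u2))"
    by (rule *[of u2 1]) (use u in auto)
  have 3: "D u2 - D u1 = (Ln (- exp (D u2)) + \<i> * pi) - (Ln (- exp (D u1)) + \<i> * pi)"
  proof (rule log_diff_const[of "{u1..u2}"])
    have "{u1..u2} \<subseteq> {0..1}" using u by force
    then show c: "continuous_on {u1..u2} D" using cont continuous_on_subset by blast
    have "- exp (D t) \<notin> \<real>\<^sub>\<le>\<^sub>0" if "t \<in> {u1..u2}" for t
      using mid[OF that] by (simp add: complex_nonneg_Reals_iff complex_nonpos_Reals_iff)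
    then show "continuous_on {u1..u2} (\<lambda>t. Ln (- exp (D t)) + \<i> * pi)"
      by (intro continuous_intros c) auto
    show "exp (D t) = exp (Ln (- exp (D t)) + \<i> * pi)" for t
      by (simp add: exp_add)
  qed (use u in auto)
  have "D 1 - D 0 = (D 1 - D u2) + (D u2 - D u1) + (D u1 - D 0)" by simp
  \<comment> \<open>The terms at 0 and 1 have cancelled. What remains is Ln (-w) - Ln w at the two
    gluing points, which is \<i> \<pi> or -\<i> \<pi> according to the sign of Im w, and these signs
    are opposite.\<close>
  also have "\<dots> = (Ln (- exp (D u2)) - Ln (exp (D u2))) - (Ln (- exp (D u1)) - Ln (exp (D u1)))"
    unfolding 1 2 3 using loop by simp
  also have "\<dots> = 2 * of_real pi * \<i> * of_real s"
    using s s1 s2 by (auto simp: Ln_minus)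
  finally show ?thesis .
qed

lemma vector_derivative_approx:
  assumes "(f has_vector_derivative v) (at x)" "0 < e"
  obtains d where "0 < d" "\<And>h. \<bar>h\<bar> < d \<Longrightarrow> norm (f (x + h) - f x - of_real h * v) \<le> e * \<bar>h\<bar>"
proof -
  from assms obtain d where "0 < d" "\<And>y. norm (y - x) < d \<Longrightarrow> norm (f y - f x - (y - x) *\<^sub>R v) \<le> e * norm (y - x)"
    unfolding has_vector_derivative_def has_derivative_at_alt by blast
  then show ?thesis using that[of d] by (metis add_diff_cancel_left' real_norm_def scaleR_conv_of_real)
qed

lemma compact_away:
  fixes f :: "'a::topological_space \<Rightarrow> 'b::real_normed_vector"
  assumes "compact K" "continuous_on K f" "\<And>t. t \<in> K \<Longrightarrow> f t \<noteq> p"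
  obtains m where "0 < m" "\<And>t. t \<in> K \<Longrightarrow> m \<le> norm (f t - p)"
proof (cases "K = {}")
  case True then show ?thesis using that[of 1] by simp
next
  case False
  have "continuous_on K (\<lambda>t. norm (f t - p))" using assms(2) by (intro continuous_intros)
  then obtain t where "t \<in> K" "\<And>s. s \<in> K \<Longrightarrow> norm (f t - p) \<le> norm (f s - p)"
    using continuous_attains_inf[OF assms(1) False] by blast
  then show ?thesis using that[of "norm (f t - p)"] assms(3) by simp
qed

text \<open>
  For \<open>z\<close>, \<open>z'\<close> just beyond and just before the crossing, the loop \<open>(L - z) / (L - z')\<close> stays off the
  negative reals far from the crossing and off the positive reals near to it, hence winds once around \<open>0\<close>.
\<close>

lemma winding_number_jump:
  assumes L: "path L" "pathfinish L = pathstart L" and u0: "0 < u0" "u0 < 1"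
    and hit: "\<And>u. u \<in> {0..1} \<Longrightarrow> L u = \<alpha> x0 \<longleftrightarrow> u = u0"
    and dL: "(L has_vector_derivative v) (at u0)"
    and da: "(\<alpha> has_vector_derivative w) (at x0)"
    and det: "det2 v w \<noteq> 0"
  obtains \<delta>0 where "0 < \<delta>0"
    "\<And>\<delta>. 0 < \<delta> \<Longrightarrow> \<delta> < \<delta>0 \<Longrightarrow> winding_number L (\<alpha> (x0 + \<delta>)) - winding_number L (\<alpha> (x0 - \<delta>)) = of_real (sgn (det2 v w))"
proof -
  define P where "P = \<alpha> x0"
  have P: "L u0 = P" using hit[of u0] u0 by (simp add: P_def)
  define \<Delta> where "\<Delta> = \<bar>det2 v w\<bar>"
  define M where "M = norm v + norm w"
  obtain \<epsilon> where \<epsilon>: "0 < \<epsilon>" and \<epsilon>M: "\<epsilon> * M = \<Delta> / 8" and M: "0 < M" and \<epsilon>8: "8 * \<epsilon> \<le> M"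
    and low: "\<And>h k. 8 * \<epsilon> * (\<bar>h\<bar> + \<bar>k\<bar>) \<le> norm (of_real h * v + of_real k * w)"
    unfolding M_def \<Delta>_def using det2_margin[OF det] by blast
  have \<Delta>: "0 < \<Delta>" using det by (simp add: \<Delta>_def)
  have nv: "norm v \<le> M" "norm w \<le> M" by (simp_all add: M_def)
  obtain \<eta>1 where \<eta>1: "0 < \<eta>1" "\<And>h. \<bar>h\<bar> < \<eta>1 \<Longrightarrow> norm (L (u0 + h) - L u0 - of_real h * v) \<le> \<epsilon> * \<bar>h\<bar>"
    using vector_derivative_approx[OF dL \<epsilon>] by blast
  obtain \<delta>1 where \<delta>1: "0 < \<delta>1" "\<And>h. \<bar>h\<bar> < \<delta>1 \<Longrightarrow> norm (\<alpha> (x0 + h) - \<alpha> x0 - of_real h * w) \<le> \<epsilon> * \<bar>h\<bar>"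
    using vector_derivative_approx[OF da \<epsilon>] by blast
  define \<eta> where "\<eta> = min (\<eta>1 / 2) (min (u0 / 2) ((1 - u0) / 2))"
  have \<eta>: "0 < \<eta>" "\<eta> < \<eta>1" "\<eta> < u0" "\<eta> < 1 - u0" using \<eta>1 u0 by (auto simp: \<eta>_def min_def)
  define u1 where "u1 = u0 - \<eta>"
  define u2 where "u2 = u0 + \<eta>"
  have u12: "0 \<le> u1" "u1 < u2" "u2 \<le> 1" using \<eta> by (auto simp: u1_def u2_def)
  have contL: "continuous_on {0..1} L" using L(1) by (simp add: path_def)
  obtain m where m: "0 < m" "\<And>t. t \<in> {0..u1} \<union> {u2..1} \<Longrightarrow> m \<le> norm (L t - P)"
  proof (rule compact_away[of "{0..u1} \<union> {u2..1}" L P])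
    show "continuous_on ({0..u1} \<union> {u2..1}) L" using contL by (rule continuous_on_subset) (use u12 in auto)
    show "L t \<noteq> P" if "t \<in> {0..u1} \<union> {u2..1}" for t
      using hit[of t] that u12 \<eta> unfolding P_def u1_def u2_def by auto
  qed (auto simp: compact_Un)
  \<comment> \<open>The bound \<open>m / (2 * M)\<close> brings both points closer to the crossing
    than \<open>m\<close>, the distance that the loop keeps from it outside of
    \<open>{u1..u2}\<close>.\<close>
  define \<delta>0 where "\<delta>0 = min \<delta>1 (min \<eta> (m / (2 * M)))"
  have \<delta>0: "0 < \<delta>0" using \<delta>1 \<eta> m M by (simp add: \<delta>0_def)
  show ?thesis
  proof (rule that[OF \<delta>0])
    fix \<delta> assume \<delta>: "0 < \<delta>" "\<delta> < \<delta>0"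
    then have \<delta>': "\<delta> < \<delta>1" "\<delta> < \<eta>" "\<delta> < m / (2 * M)" by (auto simp: \<delta>0_def)
    then have \<delta>m: "2 * M * \<delta> < m" using M by (simp add: field_simps)
    define zp where "zp = \<alpha> (x0 + \<delta>)"
    define zm where "zm = \<alpha> (x0 - \<delta>)"
    define ep where "ep = zp - P - of_real \<delta> * w"
    define em where "em = zm - P + of_real \<delta> * w"
    have ep: "norm ep \<le> \<epsilon> * \<delta>" using \<delta>1(2)[of \<delta>] \<delta> \<delta>' by (simp add: ep_def zp_def P_def)
    have em: "norm em \<le> \<epsilon> * \<delta>" using \<delta>1(2)[of "-\<delta>"] \<delta> \<delta>' by (simp add: em_def zm_def P_def)
    have zp: "zp = P + of_real \<delta> * w + ep" and zm: "zm = P - of_real \<delta> * w + em"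
      by (simp_all add: ep_def em_def)
    have bd: "norm (of_real \<delta> * w) + \<epsilon> * \<delta> < m"
    proof -
      have "norm (of_real \<delta> * w) + \<epsilon> * \<delta> \<le> \<delta> * M + M * \<delta>"
        using \<delta> nv \<epsilon>8 \<epsilon> M by (intro add_mono mult_right_mono) (auto simp: norm_mult intro: mult_left_mono)
      then show ?thesis using \<delta>m by (simp add: algebra_simps)
    qed
    have zpm: "norm (zp - P) < m" "norm (zm - P) < m"
      using norm_triangle_ineq[of "of_real \<delta> * w" ep] norm_triangle_ineq[of "- (of_real \<delta> * w)" em] ep em bd
      unfolding zp zm by simp_all
    define e where "e u = L u - P - of_real (u - u0) * v" for u
    have Lu: "L u = P + of_real (u - u0) * v + e u" for u by (simp add: e_def)
    have e: "norm (e u) \<le> \<epsilon> * \<bar>u - u0\<bar>" if "u \<in> {u1..u2}" for u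
      using \<eta>1(2)[of "u - u0"] that \<eta> P by (auto simp: e_def u1_def u2_def)
    \<comment> \<open>The linear part of the difference is at least 8 \<epsilon> (\<bar>u - u0\<bar>
      + \<delta>), while the error terms together are at most an eighth of this.\<close>
    have near: "L u \<noteq> zp" "L u \<noteq> zm" if "u \<in> {u1..u2}" for u
    proof -
      have "\<epsilon> * (\<bar>u - u0\<bar> + \<delta>) < 8 * \<epsilon> * (\<bar>u - u0\<bar> + \<delta>)"
        using \<epsilon> \<delta> by (intro mult_strict_right_mono) auto
      moreover have "norm (e u - ep) \<le> \<epsilon> * (\<bar>u - u0\<bar> + \<delta>)" "norm (e u - em) \<le> \<epsilon> * (\<bar>u - u0\<bar> + \<delta>)"
        using e[OF that] ep em norm_triangle_ineq4[of "e u" ep] norm_triangle_ineq4[of "e u" em]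
        by (simp_all add: algebra_simps)
      moreover have "8 * \<epsilon> * (\<bar>u - u0\<bar> + \<delta>) \<le> norm (of_real (u - u0) * v + of_real (- \<delta>) * w)"
        "8 * \<epsilon> * (\<bar>u - u0\<bar> + \<delta>) \<le> norm (of_real (u - u0) * v + of_real \<delta> * w)"
        using low[of "u - u0" "-\<delta>"] low[of "u - u0" \<delta>] \<delta> by simp_all
      moreover have "of_real (u - u0) * v + of_real (- \<delta>) * w = - (e u - ep)" if "L u = zp"
        using that unfolding Lu zp by (simp add: algebra_simps add_eq_0_iff)
      moreover have "of_real (u - u0) * v + of_real \<delta> * w = - (e u - em)" if "L u = zm"
        using that unfolding Lu zm by (simp add: algebra_simps add_eq_0_iff)
      ultimately show "L u \<noteq> zp" "L u \<noteq> zm"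
        by (metis leD le_less_trans norm_minus_cancel)+
    qed
    have off: "L u \<noteq> zp \<and> L u \<noteq> zm" if "u \<in> {0..1}" for u
    proof (cases "u \<in> {u1..u2}")
      case True then show ?thesis using near by blast
    next
      case False
      then have "m \<le> norm (L u - P)" using that by (intro m(2)) auto
      then show ?thesis using zpm by auto
    qed
    then have offp: "zp \<notin> path_image L" "zm \<notin> path_image L" unfolding path_image_def by force+
    obtain qp where qp: "path qp" "pathfinish qp - pathstart qp = 2 * of_real pi * \<i> * winding_number L zp"
       "\<And>t. t \<in> {0..1} \<Longrightarrow> L t = zp + exp (qp t)"
      using winding_number_as_continuous_log[OF L(1) offp(1)] by blast
    obtain qm where qm: "path qm" "pathfinish qm - pathstart qm = 2 * of_real pi * \<i> * winding_number L zm"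
       "\<And>t. t \<in> {0..1} \<Longrightarrow> L t = zm + exp (qm t)"
      using winding_number_as_continuous_log[OF L(1) offp(2)] by blast
    define D where "D t = qp t - qm t" for t
    have R: "exp (D t) = (L t - zp) / (L t - zm)" if "t \<in> {0..1}" for t
    proof -
      have "exp (qp t) = L t - zp" "exp (qm t) = L t - zm"
        using qp(3)[OF that] qm(3)[OF that] by (metis add_diff_cancel_left')+
      then show ?thesis by (simp add: D_def exp_diff)
    qed
    \<comment> \<open>If the quotient takes a real value, then \<open>zp - zm\<close> is a real
      multiple of \<open>L t - zm\<close>. Both exclusions below, of nonpositive and of nonnegative
      values, start from this relation.\<close>
    have Rd: "zp - zm = of_real (1 - \<rho>) * (L t - zm)" if "exp (D t) = of_real \<rho>" "t \<in> {0..1}" for t \<rho>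
    proof -
      have "L t - zm \<noteq> 0" using off[OF that(2)] by simp
      then have "L t - zp = of_real \<rho> * (L t - zm)"
        using R[OF that(2)] that(1) by (metis nonzero_eq_divide_eq)
      then show ?thesis by (simp add: algebra_simps)
    qed
    define s where "s = sgn (det2 v w)"
    have s: "s = 1 \<or> s = -1" "s * det2 v w = \<Delta>" using det by (auto simp: s_def sgn_if \<Delta>_def)
    \<comment> \<open>Up to a positive factor the imaginary part of the quotient is minus the
      determinant of \<open>L u - zm\<close> and \<open>zp - zm\<close>, so it can be read off from
      the tangents.\<close>
    have ImR: "s * Im (exp (D u)) * (norm (L u - zm))\<^sup>2 = - s * det2 (L u - zm) (zp - zm)" if "u \<in> {0..1}" for u
    proof -
      have nz: "L u - zm \<noteq> 0" using off[OF that] by simp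
      have "exp (D u) = 1 - (zp - zm) / (L u - zm)" using nz unfolding R[OF that] by (simp add: field_simps)
      then have "Im (exp (D u)) = - (Im ((zp - zm) * cnj (L u - zm)) / (norm (L u - zm))\<^sup>2)"
        by (simp add: complex_div_cnj[of "zp - zm"] flip: of_real_power)
      then show ?thesis using nz by (simp add: det2_def mult.commute)
    qed
    \<comment> \<open>At the ends of the middle interval the bilinear main term has size 2 \<delta>
      \<eta> \<Delta>, while the errors add up to at most 10 \<delta> \<eta> \<epsilon> M = (5/4)
      \<delta> \<eta> \<Delta>. The sign is that of the main term.\<close>
    have sgnend: "\<bar>det2 (L u - zm) (zp - zm) - 2 * \<delta> * (u - u0) * det2 v w\<bar> < 2 * \<delta> * \<eta> * \<Delta>"
      if "\<bar>u - u0\<bar> = \<eta>" "u \<in> {u1..u2}" for u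
    proof -
      define h where "h = u - u0"
      have h: "\<bar>h\<bar> = \<eta>" using that by (simp add: h_def)
      let ?e1 = "e u - em" and ?e2 = "ep - em"
      have A: "L u - zm = of_real h * v + of_real \<delta> * w + ?e1" unfolding Lu zm h_def by (simp add: algebra_simps)
      have d: "zp - zm = of_real (2 * \<delta>) * w + ?e2" unfolding zp zm by (simp add: algebra_simps)
      have ex: "det2 (L u - zm) (zp - zm) - 2 * \<delta> * h * det2 v w =
         det2 (of_real h * v + of_real \<delta> * w) ?e2 + det2 ?e1 (of_real (2 * \<delta>) * w + ?e2)"
        unfolding A d by (simp add: det2_eq algebra_simps)
      have n1: "norm ?e1 \<le> \<epsilon> * (2 * \<eta>)"
      proof -
        have "norm ?e1 \<le> \<epsilon> * \<eta> + \<epsilon> * \<delta>" using e[OF that(2)] em norm_triangle_ineq4[of "e u" em] that(1) by simp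
        also have "\<dots> \<le> \<epsilon> * \<eta> + \<epsilon> * \<eta>" using \<delta>' \<epsilon> by simp
        finally show ?thesis by simp
      qed
      have n2: "norm ?e2 \<le> \<epsilon> * (2 * \<delta>)" using ep em norm_triangle_ineq4[of ep em] by simp
      have n3: "norm (of_real h * v + of_real \<delta> * w) \<le> \<eta> * M"
      proof -
        have "norm (of_real h * v + of_real \<delta> * w) \<le> \<eta> * norm v + \<delta> * norm w"
          using norm_triangle_ineq[of "of_real h * v" "of_real \<delta> * w"] h \<delta> by (simp add: norm_mult)
        also have "\<dots> \<le> \<eta> * norm v + \<eta> * norm w" using \<delta>' by (intro add_mono mult_right_mono) auto
        finally show ?thesis by (simp add: M_def algebra_simps)
      qed
      have n4: "norm (of_real (2 * \<delta>) * w + ?e2) \<le> 2 * \<delta> * (M + M)"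
      proof -
        have "norm (of_real (2 * \<delta>) * w + ?e2) \<le> 2 * \<delta> * norm w + \<epsilon> * (2 * \<delta>)"
          using norm_triangle_ineq[of "of_real (2 * \<delta>) * w" ?e2] n2 \<delta> by (simp add: norm_mult)
        also have "\<dots> \<le> 2 * \<delta> * M + M * (2 * \<delta>)"
          using nv \<epsilon>8 \<epsilon> \<delta> by (intro add_mono mult_left_mono mult_right_mono) auto
        finally show ?thesis by (simp add: algebra_simps)
      qed
      have "\<bar>det2 (of_real h * v + of_real \<delta> * w) ?e2 + det2 ?e1 (of_real (2 * \<delta>) * w + ?e2)\<bar>
        \<le> norm (of_real h * v + of_real \<delta> * w) * norm ?e2 + norm ?e1 * norm (of_real (2 * \<delta>) * w + ?e2)"
        by (rule order_trans[OF abs_triangle_ineq add_mono[OF det2_le det2_le]])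
      also have "\<dots> \<le> \<eta> * M * (\<epsilon> * (2 * \<delta>)) + \<epsilon> * (2 * \<eta>) * (2 * \<delta> * (M + M))"
        using n1 n2 n3 n4 \<eta> M \<epsilon> by (intro add_mono mult_mono) auto
      also have "\<dots> = 10 * \<delta> * \<eta> * (\<epsilon> * M)" by (simp add: algebra_simps)
      also have "\<dots> < 2 * \<delta> * \<eta> * \<Delta>" unfolding \<epsilon>M using \<Delta> \<delta> \<eta> by simp
      finally show ?thesis using ex by (simp add: h_def)
    qed
    have "D 1 - D 0 = 2 * of_real pi * \<i> * of_real s"
    proof (rule log_jump[OF _ u12 _ _ _ s(1)])
      show "continuous_on {0..1} D" using qp(1) qm(1) unfolding D_def path_def by (intro continuous_intros)
      show "exp (D 0) = exp (D 1)" using R[of 0] R[of 1] L(2) by (simp add: pathstart_def pathfinish_def)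
    next
      fix t assume t: "t \<in> {0..u1} \<union> {u2..1}"
      then have t01: "t \<in> {0..1}" using u12 by auto
      show "exp (D t) \<notin> \<real>\<^sub>\<le>\<^sub>0"
      proof
        assume "exp (D t) \<in> \<real>\<^sub>\<le>\<^sub>0"
        then obtain \<rho> where \<rho>: "exp (D t) = of_real \<rho>" "\<rho> \<le> 0" by (auto elim: nonpos_Reals_cases)
        \<comment> \<open>A nonpositive quotient \<rho> means that \<open>L t\<close> lies on the
          segment from \<open>zm\<close> to \<open>zp\<close>, at the weight \<mu>. That segment is
          within distance less than \<open>m\<close> of the crossing.\<close>
        define \<mu> where "\<mu> = 1 / (1 - \<rho>)"
        have \<mu>: "0 \<le> \<mu>" "\<mu> \<le> 1" using \<rho>(2) by (auto simp: \<mu>_def)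
        have "of_real \<mu> * (zp - zm) = of_real (\<mu> * (1 - \<rho>)) * (L t - zm)"
          unfolding Rd[OF \<rho>(1) t01] by simp
        also have "\<mu> * (1 - \<rho>) = 1" using \<rho>(2) by (simp add: \<mu>_def)
        finally have "L t - P = of_real (1 - \<mu>) * (zm - P) + of_real \<mu> * (zp - P)"
          by (simp add: algebra_simps)
        then have "norm (L t - P) \<le> (1 - \<mu>) * norm (zm - P) + \<mu> * norm (zp - P)"
          using norm_triangle_ineq[of "of_real (1 - \<mu>) * (zm - P)" "of_real \<mu> * (zp - P)"] \<mu> by (simp add: norm_mult del: of_real_diff)
        also have "\<dots> < m" using zpm \<mu> by (intro convex_bound_lt) auto
        finally show False using m(2)[OF t] by simp
      qed
    next
      fix t assume t: "t \<in> {u1..u2}"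
      then have t01: "t \<in> {0..1}" using u12 by auto
      show "exp (D t) \<notin> \<real>\<^sub>\<ge>\<^sub>0"
      proof
        assume "exp (D t) \<in> \<real>\<^sub>\<ge>\<^sub>0"
        then obtain \<rho> where \<rho>: "exp (D t) = of_real \<rho>" "\<rho> \<ge> 0" by (auto elim: nonneg_Reals_cases)
        \<comment> \<open>A nonnegative quotient gives \<open>zp - zm\<close> as \<open>l\<close>
          times \<open>L t - zm\<close> with \<open>l\<close> at most 1. After sorting by tangents
          the coefficient of \<open>w\<close> is (2 - l) \<delta> \<ge> \<delta>. With the margin 8
          this outweighs the errors, of which the \<open>w\<close>-part is at most three times as
          large as this coefficient times \<epsilon>.\<close>
        define l where "l = 1 - \<rho>"
        define h where "h = t - u0"
        have l: "l \<le> 1" using \<rho> by (simp add: l_def)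
        have "of_real ((2 - l) * \<delta>) * w + of_real (- (l * h)) * v = of_real l * (e t - em) - (ep - em)"
          using Rd[OF \<rho>(1) t01] unfolding Lu zp zm l_def[symmetric] h_def[symmetric]
          by (simp add: algebra_simps)
        then have "8 * \<epsilon> * (\<bar>- (l * h)\<bar> + \<bar>(2 - l) * \<delta>\<bar>) \<le> norm (of_real l * (e t - em) - (ep - em))"
          using low[of "- (l * h)" "(2 - l) * \<delta>"] by (simp add: add.commute)
        also have "\<dots> \<le> \<bar>l\<bar> * (\<epsilon> * (\<bar>h\<bar> + \<delta>)) + \<epsilon> * (2 * \<delta>)"
        proof -
          have "norm (e t - em) \<le> \<epsilon> * (\<bar>h\<bar> + \<delta>)"
            using e[OF t] em norm_triangle_ineq4[of "e t" em] by (simp add: h_def algebra_simps)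
          then have "norm (of_real l * (e t - em)) \<le> \<bar>l\<bar> * (\<epsilon> * (\<bar>h\<bar> + \<delta>))"
            by (simp add: norm_mult mult_left_mono)
          then show ?thesis using ep em norm_triangle_ineq4[of ep em] norm_triangle_ineq4[of "of_real l * (e t - em)" "ep - em"]
            by simp
        qed
        also have "\<dots> = \<epsilon> * (\<bar>l\<bar> * \<bar>h\<bar> + \<bar>l\<bar> * \<delta> + 2 * \<delta>)" by (simp add: algebra_simps)
        also have "\<dots> \<le> \<epsilon> * (\<bar>l\<bar> * \<bar>h\<bar> + (2 - l) * \<delta> + 2 * ((2 - l) * \<delta>))"
        proof -
          have "\<bar>l\<bar> * \<delta> \<le> (2 - l) * \<delta>" using l \<delta> by (intro mult_right_mono) auto
          moreover have "1 * \<delta> \<le> (2 - l) * \<delta>" using l \<delta> by (intro mult_right_mono) auto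
          ultimately have "\<bar>l\<bar> * \<bar>h\<bar> + \<bar>l\<bar> * \<delta> + 2 * \<delta> \<le> \<bar>l\<bar> * \<bar>h\<bar> + (2 - l) * \<delta> + 2 * ((2 - l) * \<delta>)"
            by linarith
          then show ?thesis using \<epsilon> by (intro mult_left_mono) auto
        qed
        finally have "\<epsilon> * (8 * (\<bar>l\<bar> * \<bar>h\<bar>) + 8 * ((2 - l) * \<delta>)) \<le> \<epsilon> * (\<bar>l\<bar> * \<bar>h\<bar> + (2 - l) * \<delta> + 2 * ((2 - l) * \<delta>))"
          using l \<delta> by (simp add: abs_mult algebra_simps)
        then have "8 * (\<bar>l\<bar> * \<bar>h\<bar>) + 8 * ((2 - l) * \<delta>) \<le> \<bar>l\<bar> * \<bar>h\<bar> + (2 - l) * \<delta> + 2 * ((2 - l) * \<delta>)"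
          using \<epsilon> by simp
        moreover have "0 \<le> \<bar>l\<bar> * \<bar>h\<bar>" by simp
        moreover have "0 < (2 - l) * \<delta>" using l \<delta> by simp
        ultimately show False by linarith
      qed
    next
      have mem: "u1 \<in> {u1..u2}" "u1 \<in> {0..1}" "\<bar>u1 - u0\<bar> = \<eta>" using u12 \<eta> by (auto simp: u1_def)
      have "s * det2 (L u1 - zm) (zp - zm) - s * (2 * \<delta> * (u1 - u0) * det2 v w) < 2 * \<delta> * \<eta> * \<Delta>"
        using sgnend[OF mem(3,1)] s(1) by (auto simp: abs_less_iff)
      moreover have "s * (2 * \<delta> * (u1 - u0) * det2 v w) = - (2 * \<delta> * \<eta> * \<Delta>)"
        unfolding s(2)[symmetric] by (simp add: u1_def algebra_simps)
      ultimately have "0 < s * Im (exp (D u1)) * (norm (L u1 - zm))\<^sup>2" unfolding ImR[OF mem(2)] by simp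
      then show "0 < s * Im (exp (D u1))" by (simp add: zero_less_mult_iff)
    next
      have mem: "u2 \<in> {u1..u2}" "u2 \<in> {0..1}" "\<bar>u2 - u0\<bar> = \<eta>" using u12 \<eta> by (auto simp: u2_def)
      have "- (s * det2 (L u2 - zm) (zp - zm) - s * (2 * \<delta> * (u2 - u0) * det2 v w)) < 2 * \<delta> * \<eta> * \<Delta>"
        using sgnend[OF mem(3,1)] s(1) by (auto simp: abs_less_iff)
      moreover have "s * (2 * \<delta> * (u2 - u0) * det2 v w) = 2 * \<delta> * \<eta> * \<Delta>"
        unfolding s(2)[symmetric] by (simp add: u2_def algebra_simps)
      ultimately have "s * Im (exp (D u2)) * (norm (L u2 - zm))\<^sup>2 < 0" unfolding ImR[OF mem(2)] by simp
      then show "s * Im (exp (D u2)) < 0" by (simp add: mult_less_0_iff)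
    qed
    moreover have "D 1 - D 0 = 2 * of_real pi * \<i> * (winding_number L zp - winding_number L zm)"
      using qp(2) qm(2) by (simp add: D_def pathstart_def pathfinish_def algebra_simps)
    ultimately show "winding_number L (\<alpha> (x0 + \<delta>)) - winding_number L (\<alpha> (x0 - \<delta>)) = of_real (sgn (det2 v w))"
      unfolding zp_def zm_def s_def by simp
  qed
qed

lemma sum_of_jumps:
  fixes W :: "real \<Rightarrow> 'a::ab_group_add"
  assumes "finite X" and "a < b" "X \<subseteq> {a<..<b}"
    and const: "\<And>y z. a \<le> y \<Longrightarrow> y \<le> z \<Longrightarrow> z \<le> b \<Longrightarrow> {y..z} \<inter> X = {} \<Longrightarrow> W y = W z"
    and jump: "\<And>x. x \<in> X \<Longrightarrow> \<exists>\<delta>0>0. \<forall>\<delta>. 0 < \<delta> \<and> \<delta> < \<delta>0 \<longrightarrow> W (x + \<delta>) - W (x - \<delta>) = j x"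
  shows "W b - W a = sum j X"
  using assms
proof (induction X arbitrary: b rule: finite_linorder_max_induct)
  case empty
  have "W a = W b" by (rule empty.prems(3)) (use empty.prems in auto)
  then show ?case by simp
next
  case (insert x X)
  obtain \<delta>0 where \<delta>0: "0 < \<delta>0" "\<And>\<delta>. 0 < \<delta> \<Longrightarrow> \<delta> < \<delta>0 \<Longrightarrow> W (x + \<delta>) - W (x - \<delta>) = j x"
    using insert.prems(4)[of x] by auto
  have x: "a < x" "x < b" using insert.prems(2) by auto
  \<comment> \<open>Inserting \<open>a\<close> covers the case that no jump points remain to the
    left of \<open>x\<close>.\<close>
  define c where "c = Max (insert a X)"
  have c: "a \<le> c" "\<And>y. y \<in> X \<Longrightarrow> y \<le> c" "c < x"
    using insert.hyps x unfolding c_def by auto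
  define \<delta> where "\<delta> = min (\<delta>0 / 2) (min ((x - c) / 2) ((b - x) / 2))"
  have \<delta>: "0 < \<delta>" "\<delta> < \<delta>0" "c < x - \<delta>" "x + \<delta> < b"
    using \<delta>0(1) c x unfolding \<delta>_def min_def by (auto simp: field_simps)
  have "W (x - \<delta>) - W a = sum j X"
  proof (rule insert.IH)
    show "X \<subseteq> {a<..<x - \<delta>}" using insert.prems(2) c \<delta> by force
    show "W y = W z" if "a \<le> y" "y \<le> z" "z \<le> x - \<delta>" "{y..z} \<inter> X = {}" for y z
      using that \<delta> x by (intro insert.prems(3)) auto
  qed (use c \<delta> insert.prems(4) in auto)
  moreover have "W (x + \<delta>) = W b"
  proof (rule insert.prems(3))
    show "{x + \<delta>..b} \<inter> insert x X = {}" using insert.hyps(2) \<delta> by force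
  qed (use x \<delta> in auto)
  moreover have "W (x + \<delta>) - W (x - \<delta>) = j x" using \<delta> by (intro \<delta>0)
  ultimately show ?case using insert.hyps by (auto simp: algebra_simps)
qed

text \<open>Between two crossings the arc stays in one component of the complement of the loop; at a
  crossing the local jump applies. The prescribed value \<open>j x\<close> lets the caller compute
  the sign with tangents of another parametrization.\<close>

lemma winding_number_crossings:
  assumes L: "path L" "pathfinish L = pathstart L" and \<alpha>: "continuous_on {a..b} \<alpha>" and ab: "a < b"
    and fin: "finite {x \<in> {a..b}. \<alpha> x \<in> path_image L}"
    and ends: "\<alpha> a \<notin> path_image L" "\<alpha> b \<notin> path_image L"
    and cross: "\<And>x. x \<in> {a..b} \<Longrightarrow> \<alpha> x \<in> path_image L \<Longrightarrow>
      \<exists>u v w. 0 < u \<and> u < 1 \<and> (\<forall>u'\<in>{0..1}. L u' = \<alpha> x \<longleftrightarrow> u' = u) \<and>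
        (L has_vector_derivative v) (at u) \<and> (\<alpha> has_vector_derivative w) (at x) \<and>
        det2 v w \<noteq> 0 \<and> sgn (det2 v w) = j x"
  shows "winding_number L (\<alpha> b) - winding_number L (\<alpha> a) =
    of_real (\<Sum>x | x \<in> {a..b} \<and> \<alpha> x \<in> path_image L. j x)"
proof -
  define X where "X = {x \<in> {a..b}. \<alpha> x \<in> path_image L}"
  have "winding_number L (\<alpha> b) - winding_number L (\<alpha> a) = (\<Sum>x\<in>X. of_real (j x))"
  proof (rule sum_of_jumps[where W = "\<lambda>x. winding_number L (\<alpha> x)"])
    show "finite X" using fin by (simp add: X_def)
    show "X \<subseteq> {a<..<b}" using ends by (auto simp: X_def less_eq_real_def)
    show "winding_number L (\<alpha> y) = winding_number L (\<alpha> z)"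
      if "a \<le> y" "y \<le> z" "z \<le> b" "{y..z} \<inter> X = {}" for y z
    proof (rule winding_number_eq[OF L, where S = "\<alpha> ` {y..z}"])
      have "continuous_on {y..z} \<alpha>" using \<alpha> by (rule continuous_on_subset) (use that in auto)
      then show "connected (\<alpha> ` {y..z})" by (intro connected_continuous_image) auto
      show "\<alpha> ` {y..z} \<inter> path_image L = {}" using that unfolding X_def by fastforce
    qed (use that in auto)
    show "\<exists>\<delta>0>0. \<forall>\<delta>. 0 < \<delta> \<and> \<delta> < \<delta>0 \<longrightarrow> winding_number L (\<alpha> (x + \<delta>)) - winding_number L (\<alpha> (x - \<delta>)) = of_real (j x)"
      if xX: "x \<in> X" for x
    proof -
      obtain u v w where uvw: "0 < u" "u < 1" "\<forall>u'\<in>{0..1}. L u' = \<alpha> x \<longleftrightarrow> u' = u"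
        "(L has_vector_derivative v) (at u)" "(\<alpha> has_vector_derivative w) (at x)"
        "det2 v w \<noteq> 0" "sgn (det2 v w) = j x"
        using cross[of x] xX unfolding X_def mem_Collect_eq by blast
      obtain \<delta>0 where "0 < \<delta>0" "\<And>\<delta>. 0 < \<delta> \<Longrightarrow> \<delta> < \<delta>0 \<Longrightarrow>
          winding_number L (\<alpha> (x + \<delta>)) - winding_number L (\<alpha> (x - \<delta>)) = of_real (sgn (det2 v w))"
        using winding_number_jump[OF L uvw(1,2) uvw(3)[rule_format] uvw(4-6)] by blast
      then show ?thesis unfolding uvw(7) by blast
    qed
  qed (use ab in auto)
  then show ?thesis by (simp add: X_def)
qed

text \<open>The loop leaves its corner in direction \<open>v\<close> and returns to it from
  direction \<open>-w\<close>. The continuations beyond the corner run in directions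
  \<open>w\<close> and \<open>-v\<close>, and the sector spanned by these two contains neither
  branch of the loop. So the segment joining the continuations misses the loop near the
  corner.\<close>

lemma winding_number_corner:
  fixes \<gamma> :: "real \<Rightarrow> complex"
  assumes st: "s < t" and cont: "continuous_on {s..t} \<gamma>" and loop: "\<gamma> s = \<gamma> t"
    and hit: "\<And>u. u \<in> {s..t} \<Longrightarrow> \<gamma> u = \<gamma> t \<Longrightarrow> u = s \<or> u = t"
    and dv: "(\<gamma> has_vector_derivative v) (at s)" and dw: "(\<gamma> has_vector_derivative w) (at t)"
    and det: "det2 v w \<noteq> 0"
  obtains \<delta>0 where "0 < \<delta>0"
    "\<And>\<delta>. 0 < \<delta> \<Longrightarrow> \<delta> < \<delta>0 \<Longrightarrow> \<gamma> (t + \<delta>) \<notin> \<gamma> ` {s..t} \<and> \<gamma> (s - \<delta>) \<notin> \<gamma> ` {s..t} \<and>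
       winding_number (subpath s t \<gamma>) (\<gamma> (t + \<delta>)) = winding_number (subpath s t \<gamma>) (\<gamma> (s - \<delta>))"
proof -
  define P where "P = \<gamma> t"
  have Ps: "\<gamma> s = P" "\<gamma> t = P" using loop by (simp_all add: P_def)
  define M where "M = norm v + norm w"
  obtain \<epsilon> where \<epsilon>: "0 < \<epsilon>" and "\<epsilon> * M = \<bar>det2 v w\<bar> / 8" and M: "0 < M" and "8 * \<epsilon> \<le> M"
    and low: "\<And>h k. 8 * \<epsilon> * (\<bar>h\<bar> + \<bar>k\<bar>) \<le> norm (of_real h * v + of_real k * w)"
    unfolding M_def using det2_margin[OF det] by blast
  obtain \<eta>1 where \<eta>1: "0 < \<eta>1" "\<And>h. \<bar>h\<bar> < \<eta>1 \<Longrightarrow> norm (\<gamma> (s + h) - \<gamma> s - of_real h * v) \<le> \<epsilon> * \<bar>h\<bar>"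
    using vector_derivative_approx[OF dv \<epsilon>] by blast
  obtain \<eta>2 where \<eta>2: "0 < \<eta>2" "\<And>h. \<bar>h\<bar> < \<eta>2 \<Longrightarrow> norm (\<gamma> (t + h) - \<gamma> t - of_real h * w) \<le> \<epsilon> * \<bar>h\<bar>"
    using vector_derivative_approx[OF dw \<epsilon>] by blast
  define \<eta> where "\<eta> = min (min \<eta>1 \<eta>2) ((t - s) / 2) / 2"
  have \<eta>: "0 < \<eta>" "\<eta> < \<eta>1" "\<eta> < \<eta>2" "s + \<eta> < t - \<eta>" using \<eta>1 \<eta>2 st by (auto simp: \<eta>_def min_def field_simps)
  obtain m where m: "0 < m" "\<And>u. u \<in> {s + \<eta>..t - \<eta>} \<Longrightarrow> m \<le> norm (\<gamma> u - P)"
  proof (rule compact_away[of "{s + \<eta>..t - \<eta>}" \<gamma> P])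
    show "continuous_on {s + \<eta>..t - \<eta>} \<gamma>" using cont by (rule continuous_on_subset) (use \<eta> in auto)
    show "\<gamma> u \<noteq> P" if "u \<in> {s + \<eta>..t - \<eta>}" for u
      using hit[of u] that \<eta> unfolding P_def by auto
  qed auto
  \<comment> \<open>The second bound keeps the segment within distance less than \<open>m\<close> of
    the corner, hence away from the part of the loop that is not close to the corner.\<close>
  define \<delta>0 where "\<delta>0 = min \<eta> (m / (2 * (M + \<epsilon>)))"
  have \<delta>0: "0 < \<delta>0" using \<eta> m M \<epsilon> by (simp add: \<delta>0_def)
  have pL: "path (subpath s t \<gamma>)" "pathfinish (subpath s t \<gamma>) = pathstart (subpath s t \<gamma>)"
  proof -
    have "(t - s) * u + s \<in> {s..t}" if "u \<in> {0..1}" for u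
    proof -
      have "0 \<le> (t - s) * u" "(t - s) * u \<le> (t - s) * 1" using that st by (simp_all add: mult_left_le)
      then show ?thesis by simp
    qed
    then have "continuous_on {0..1} (\<lambda>u. \<gamma> ((t - s) * u + s))"
      by (intro continuous_on_compose2[OF cont] continuous_intros) auto
    then show "path (subpath s t \<gamma>)" by (simp add: path_def subpath_def)
    show "pathfinish (subpath s t \<gamma>) = pathstart (subpath s t \<gamma>)" using loop by simp
  qed
  have im: "path_image (subpath s t \<gamma>) = \<gamma> ` {s..t}" using st by (simp add: path_image_subpath)
  show ?thesis
  proof (rule that[OF \<delta>0])
    fix \<delta> assume \<delta>: "0 < \<delta>" "\<delta> < \<delta>0"
    then have \<delta>': "\<delta> < \<eta>" "\<delta> < m / (2 * (M + \<epsilon>))" by (auto simp: \<delta>0_def)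
    then have \<delta>m: "2 * (M + \<epsilon>) * \<delta> < m" using M \<epsilon> by (simp add: field_simps)
    define zp where "zp = \<gamma> (t + \<delta>)"
    define zm where "zm = \<gamma> (s - \<delta>)"
    define ep where "ep = zp - P - of_real \<delta> * w"
    define em where "em = zm - P + of_real \<delta> * v"
    have ep: "norm ep \<le> \<epsilon> * \<delta>" using \<eta>2(2)[of \<delta>] \<delta> \<delta>' \<eta> by (simp add: ep_def zp_def P_def)
    have em: "norm em \<le> \<epsilon> * \<delta>" using \<eta>1(2)[of "-\<delta>"] \<delta> \<delta>' \<eta> Ps by (simp add: em_def zm_def)
    have seg: "closed_segment zp zm \<inter> \<gamma> ` {s..t} = {}"
    proof (intro equals0I)
      fix z assume "z \<in> closed_segment zp zm \<inter> \<gamma> ` {s..t}"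
      then obtain l u where l: "0 \<le> l" "l \<le> 1" "z = (1 - l) *\<^sub>R zp + l *\<^sub>R zm" and u: "u \<in> {s..t}" "z = \<gamma> u"
        by (auto simp: closed_segment_def)
      define e where "e = of_real (1 - l) * ep + of_real l * em"
      have z: "z = P + of_real ((1 - l) * \<delta>) * w - of_real (l * \<delta>) * v + e"
        unfolding l(3) e_def ep_def em_def by (simp add: scaleR_conv_of_real algebra_simps)
      have e: "norm e \<le> \<epsilon> * \<delta>"
      proof -
        have "norm e \<le> (1 - l) * norm ep + l * norm em"
          unfolding e_def using norm_triangle_ineq[of "of_real (1 - l) * ep" "of_real l * em"] l by (simp add: norm_mult del: of_real_diff)
        also have "\<dots> \<le> \<epsilon> * \<delta>" using ep em l by (intro convex_bound_le) auto
        finally show ?thesis .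
      qed
      consider "u < s + \<eta>" | "u > t - \<eta>" | "u \<in> {s + \<eta>..t - \<eta>}" by force
      then show False
      proof cases
        case 1
        define h where "h = u - s"
        define e' where "e' = \<gamma> u - P - of_real h * v"
        have h: "0 \<le> h" "h < \<eta>1" using 1 u \<eta> by (auto simp: h_def)
        have e': "norm e' \<le> \<epsilon> * h" using \<eta>1(2)[of h] h Ps by (simp add: e'_def h_def)
        \<comment> \<open>Within each coefficient the contributions of the segment and of the loop
          have the same sign. The absolute values of the coefficients therefore add up to exactly h
          + \<delta>, too much for errors of rate \<epsilon>.\<close>
        have "of_real (- (l * \<delta> + h)) * v + of_real ((1 - l) * \<delta>) * w = e' - e"
          using u(2) unfolding z e'_def by (simp add: algebra_simps)
        then have "8 * \<epsilon> * (\<bar>- (l * \<delta> + h)\<bar> + \<bar>(1 - l) * \<delta>\<bar>) \<le> norm (e' - e)"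
          using low[of "- (l * \<delta> + h)" "(1 - l) * \<delta>"] by simp
        also have "\<dots> \<le> \<epsilon> * (h + \<delta>)" using e e' norm_triangle_ineq4[of e' e] by (simp add: algebra_simps)
        also have "\<bar>- (l * \<delta> + h)\<bar> + \<bar>(1 - l) * \<delta>\<bar> = h + \<delta>"
        proof -
          have "0 \<le> l * \<delta> + h" "0 \<le> (1 - l) * \<delta>" using l \<delta> h by auto
          then show ?thesis by (simp add: algebra_simps)
        qed
        finally show False using \<epsilon> h \<delta> by simp
      next
        case 2
        define h where "h = t - u"
        define e' where "e' = \<gamma> u - P + of_real h * w"
        have h: "0 \<le> h" "h < \<eta>2" using 2 u \<eta> by (auto simp: h_def)
        have e': "norm e' \<le> \<epsilon> * h" using \<eta>2(2)[of "-h"] h Ps by (simp add: e'_def h_def algebra_simps)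
        have "of_real (- (l * \<delta>)) * v + of_real ((1 - l) * \<delta> + h) * w = e' - e"
          using u(2) unfolding z e'_def by (simp add: algebra_simps)
        then have "8 * \<epsilon> * (\<bar>- (l * \<delta>)\<bar> + \<bar>(1 - l) * \<delta> + h\<bar>) \<le> norm (e' - e)"
          using low[of "- (l * \<delta>)" "(1 - l) * \<delta> + h"] by simp
        also have "\<dots> \<le> \<epsilon> * (h + \<delta>)" using e e' norm_triangle_ineq4[of e' e] by (simp add: algebra_simps)
        also have "\<bar>- (l * \<delta>)\<bar> + \<bar>(1 - l) * \<delta> + h\<bar> = h + \<delta>"
        proof -
          have "0 \<le> l * \<delta>" "0 \<le> (1 - l) * \<delta> + h" using l \<delta> h by auto
          then show ?thesis by (simp add: algebra_simps)
        qed
        finally show False using \<epsilon> h \<delta> by simp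
      next
        case 3
        have "norm (z - P) \<le> norm (of_real ((1 - l) * \<delta>) * w) + norm (of_real (l * \<delta>) * v) + norm e"
          unfolding z using norm_triangle_ineq[of "of_real ((1 - l) * \<delta>) * w - of_real (l * \<delta>) * v" e]
            norm_triangle_ineq4[of "of_real ((1 - l) * \<delta>) * w" "of_real (l * \<delta>) * v"] by (simp add: algebra_simps)
        also have "\<dots> = (1 - l) * \<delta> * norm w + l * \<delta> * norm v + norm e"
          using l \<delta> by (simp add: norm_mult del: of_real_diff of_real_mult)
        also have "\<dots> \<le> \<delta> * norm w + \<delta> * norm v + \<epsilon> * \<delta>"
          using l \<delta> e by (intro add_mono mult_right_mono) (auto simp: mult_left_le_one_le)
        also have "\<dots> = (M + \<epsilon>) * \<delta>" by (simp add: M_def algebra_simps)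
        also have "\<dots> < m" using \<delta>m m(1) by (simp only: mult.assoc)
        finally show False using m(2)[OF 3] u by simp
      qed
    qed
    have "winding_number (subpath s t \<gamma>) zp = winding_number (subpath s t \<gamma>) zm"
      by (rule winding_number_eq[OF pL, of _ "closed_segment zp zm"]) (use seg im in auto)
    moreover have "zp \<notin> \<gamma> ` {s..t}" "zm \<notin> \<gamma> ` {s..t}" using seg by auto
    ultimately show "\<gamma> (t + \<delta>) \<notin> \<gamma> ` {s..t} \<and> \<gamma> (s - \<delta>) \<notin> \<gamma> ` {s..t} \<and>
       winding_number (subpath s t \<gamma>) (\<gamma> (t + \<delta>)) = winding_number (subpath s t \<gamma>) (\<gamma> (s - \<delta>))"
      by (simp add: zp_def zm_def)
  qed
qed

section \<open>The invariant of a diagram and planar isotopy\<close>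

definition chords :: "diagram \<Rightarrow> (real \<times> real) set" where
  "chords D = {(s, t). s \<in> {0..<1} \<and> t \<in> {0..<1} \<and> classical_at D s t}"

definition velocity :: "(real \<Rightarrow> complex) \<Rightarrow> real \<Rightarrow> complex" where
  "velocity \<gamma> t = vector_derivative \<gamma> (at t)"

definition crossing_sign :: "(real \<Rightarrow> complex) \<Rightarrow> real \<times> real \<Rightarrow> real" where
  "crossing_sign \<gamma> p = sgn (det2 (velocity \<gamma> (fst p)) (velocity \<gamma> (snd p)))"

definition diagram_invariant :: "diagram \<Rightarrow> real" where
  "diagram_invariant D = gauss_invariant (chords D) (crossing_sign (curve D))"

lemma crossing_sign_swap: "crossing_sign \<gamma> (t, s) = - crossing_sign \<gamma> (s, t)"
proof -
  have "det2 (velocity \<gamma> t) (velocity \<gamma> s) = - det2 (velocity \<gamma> s) (velocity \<gamma> t)"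
    by (simp add: det2_eq)
  then show ?thesis by (simp add: crossing_sign_def sgn_minus)
qed

lemma double_pt_sym: "double_pt \<gamma> s t \<longleftrightarrow> double_pt \<gamma> t s"
  unfolding double_pt_def by (metis Ints_minus minus_diff_eq)

lemma classical_at_sym: "classical_at D s t \<longleftrightarrow> classical_at D t s"
  unfolding classical_at_def using double_pt_sym by blast

context
  fixes D assumes D: "virtual_diagram D"
begin

lemma curve_immersion: "generic_immersion (curve D)"
  using D by (simp add: virtual_diagram_def)

lemma curve_deriv: "(curve D has_vector_derivative velocity (curve D) t) (at t)"
  using curve_immersion unfolding generic_immersion_def velocity_def C1_differentiable_on_def
  by (metis UNIV_I vector_derivative_at)

lemma curve_continuous: "continuous_on S (curve D)"
  using curve_deriv has_vector_derivative_continuous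
  by (metis continuous_at_imp_continuous_on)

lemma curve_period: "curve D (t + of_int n) = curve D t"
proof -
  have P: "curve D (t + 1) = curve D t" for t
    using curve_immersion by (simp add: generic_immersion_def)
  have *: "curve D (t + real m) = curve D t" for m t
  proof (induction m)
    case (Suc m)
    then show ?case using P[of "t + real m"] by (simp add: algebra_simps)
  qed simp
  show ?thesis
  proof (cases "0 \<le> n")
    case True then show ?thesis using *[of t "nat n"] by simp
  next
    case False then show ?thesis using *[of "t + of_int n" "nat (- n)"] by simp
  qed
qed

lemma velocity_period: "velocity (curve D) (t + of_int n) = velocity (curve D) t"
proof -
  have "((curve D \<circ> (\<lambda>t. t + of_int n)) has_vector_derivative 1 *\<^sub>R velocity (curve D) (t + of_int n)) (at t)"
    by (rule vector_diff_chain_at[OF _ curve_deriv]) (auto intro!: derivative_eq_intros)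
  moreover have "curve D \<circ> (\<lambda>t. t + of_int n) = curve D" using curve_period by (simp add: fun_eq_iff)
  ultimately show ?thesis unfolding velocity_def using vector_derivative_at by fastforce
qed

lemma over_period: "over D (s + of_int m) (t + of_int n) = over D s t"
proof -
  have P: "over D (s + 1) t = over D s t" "over D s (t + 1) = over D s t" for s t
    using D by (simp_all add: virtual_diagram_def)
  have *: "over D (s + real m) t = over D s t" "over D s (t + real m) = over D s t" for m s t
  proof (induction m)
    case (Suc m)
    case 1 show ?case using Suc(1) P(1)[of "s + real m"] by (simp add: algebra_simps)
    case 2 show ?case using Suc(2) P(2)[of s "t + real m"] by (simp add: algebra_simps)
  qed simp_all
  have 1: "over D (s + of_int m) t = over D s t" for s t
  proof (cases "0 \<le> m")
    case True then show ?thesis using *(1)[of s "nat m"] by simp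
  next
    case False then show ?thesis using *(1)[of "s + of_int m" "nat (- m)"] by simp
  qed
  have 2: "over D s (t + of_int n) = over D s t" for s t
  proof (cases "0 \<le> n")
    case True then show ?thesis using *(2)[of s t "nat n"] by simp
  next
    case False then show ?thesis using *(2)[of s "t + of_int n" "nat (- n)"] by simp
  qed
  show ?thesis using 1 2 by simp
qed

lemma double_pt_period: "double_pt (curve D) (s + of_int m) (t + of_int n) \<longleftrightarrow> double_pt (curve D) s t"
proof -
  have "s + of_int m - (t + of_int n) = s - t + of_int (m - n)" by simp
  moreover have "s - t + of_int (m - n) \<in> \<int> \<longleftrightarrow> s - t \<in> \<int>" by (metis Ints_add Ints_diff Ints_of_int add_diff_cancel_right')
  ultimately show ?thesis unfolding double_pt_def curve_period by metis
qed

lemma classical_at_period: "classical_at D (s + of_int m) (t + of_int n) \<longleftrightarrow> classical_at D s t"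
  unfolding classical_at_def double_pt_period over_period by simp

lemma classical_at_frac: "classical_at D (frac s) (frac t) \<longleftrightarrow> classical_at D s t"
  using classical_at_period[of s "- \<lfloor>s\<rfloor>" t "- \<lfloor>t\<rfloor>"] by (simp add: frac_def)

lemma velocity_frac: "velocity (curve D) (frac t) = velocity (curve D) t"
  using velocity_period[of t "- \<lfloor>t\<rfloor>"] by (simp add: frac_def)

lemma double_det: "double_pt (curve D) s t \<Longrightarrow> det2 (velocity (curve D) s) (velocity (curve D) t) \<noteq> 0"
  using curve_immersion unfolding generic_immersion_def velocity_def det2_def by blast

lemma no_triple: "double_pt (curve D) s t \<Longrightarrow> double_pt (curve D) t u \<Longrightarrow> s - u \<in> \<int>"
  using curve_immersion unfolding generic_immersion_def by blast

lemma finite_double: "finite {(s, t). s \<in> {0..<1} \<and> t \<in> {0..<1} \<and> double_pt (curve D) s t}"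
  using curve_immersion unfolding generic_immersion_def by blast

lemma finite_chords: "finite (chords D)"
  by (rule finite_subset[OF _ finite_double]) (auto simp: chords_def classical_at_def)

lemma alternating_chords: "alternating (chords D) (crossing_sign (curve D))"
  unfolding alternating_def
proof (intro conjI ballI)
  fix c assume "c \<in> chords D"
  then show "case c of (p, q) \<Rightarrow> (q, p) \<in> chords D \<and> crossing_sign (curve D) (q, p) = - crossing_sign (curve D) (p, q)"
    using crossing_sign_swap[of "curve D" "snd c" "fst c"] classical_at_sym[of D "fst c" "snd c"]
    by (simp add: chords_def split_beta)
qed (rule finite_chords)

end

section \<open>Signs and cyclic order under planar isotopy\<close>

lemma det2_scale: "det2 (a *\<^sub>R v) (b *\<^sub>R w) = a * b * det2 v w"
  by (simp add: det2_eq algebra_simps)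

lemma det2_linear:
  assumes "bounded_linear f"
  shows "det2 (f v) (f w) = det2 (f 1) (f \<i>) * det2 v w"
proof -
  have *: "f z = Re z *\<^sub>R f 1 + Im z *\<^sub>R f \<i>" for z
  proof -
    interpret bounded_linear f by fact
    have "z = Re z *\<^sub>R 1 + Im z *\<^sub>R \<i>" by (simp add: complex_eq_iff)
    then have "f z = f (Re z *\<^sub>R 1 + Im z *\<^sub>R \<i>)" by simp
    then show ?thesis by (simp add: add scaleR)
  qed
  show ?thesis unfolding *[of v] *[of w] by (simp add: det2_eq algebra_simps)
qed

text \<open>The Jacobian determinant at a fixed point depends continuously on the time, never
  vanishes and is 1 at time 0. This is what the path from the identity contributes: its final map
  preserves orientation.\<close>

lemma isotopy_det_pos:
  fixes h :: "real \<Rightarrow> complex \<Rightarrow> complex" and h' :: "real \<Rightarrow> complex \<Rightarrow> complex \<Rightarrow>\<^sub>L complex"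
  assumes h0: "h 0 = id"
    and h': "\<And>\<tau> z. \<tau> \<in> {0..1} \<Longrightarrow> (h \<tau> has_derivative blinfun_apply (h' \<tau> z)) (at z) \<and> bij (blinfun_apply (h' \<tau> z))"
    and cont: "continuous_on ({0..1} \<times> UNIV) (\<lambda>(\<tau>, z). h' \<tau> z)"
  shows "0 < det2 (blinfun_apply (h' 1 z) 1) (blinfun_apply (h' 1 z) \<i>)"
proof -
  define d where "d \<tau> = det2 (blinfun_apply (h' \<tau> z) 1) (blinfun_apply (h' \<tau> z) \<i>)" for \<tau>
  have ne: "d \<tau> \<noteq> 0" if \<tau>: "\<tau> \<in> {0..1}" for \<tau>
  proof
    assume "d \<tau> = 0"
    moreover obtain v w where "blinfun_apply (h' \<tau> z) v = 1" "blinfun_apply (h' \<tau> z) w = \<i>"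
      using h'[OF \<tau>, of z] bij_is_surj surjD by metis
    moreover have "det2 1 \<i> = 1" by (simp add: det2_eq)
    ultimately show False
      using det2_linear[OF blinfun.bounded_linear_right, of "h' \<tau> z" v w] by (simp add: d_def)
  qed
  have "continuous_on {0..1} (\<lambda>\<tau>. h' \<tau> z)"
  proof -
    have "continuous_on {0..1::real} (\<lambda>\<tau>. (\<tau>, z))" by (intro continuous_intros)
    then show ?thesis using continuous_on_compose2[OF cont, of "{0..1}" "\<lambda>\<tau>. (\<tau>, z)"] by auto
  qed
  then have cd: "continuous_on {0..1} d"
    unfolding d_def det2_eq by (intro continuous_intros)
  have "(id has_derivative blinfun_apply (h' 0 z)) (at z)" using h'[of 0 z] h0 by simp
  then have "blinfun_apply (h' 0 z) = id"
    using has_derivative_unique has_derivative_id by blast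
  then have "d 0 = 1" by (simp add: d_def det2_eq)
  then have "0 < d 0" by simp
  show ?thesis
  proof (rule ccontr)
    assume "\<not> ?thesis"
    then have "d 1 \<le> 0" by (simp add: d_def)
    then obtain \<tau> where "0 \<le> \<tau>" "\<tau> \<le> 1" "d \<tau> = 0"
      using IVT2'[of d 1 0 0] cd \<open>0 < d 0\<close> by auto
    then show False using ne by simp
  qed
qed

text \<open>Reducing modulo 1 cuts the period interval at one integer and exchanges the two pieces.
  A comparison of two points is reversed iff they lie in different pieces; in the product of three
  comparisons every point occurs twice, so the reversals cancel.\<close>

lemma cyclic_sign_shift:
  assumes "x \<in> {\<theta>..<\<theta>+1}" "a \<in> {\<theta>..<\<theta>+1}" "b \<in> {\<theta>..<\<theta>+1}"
  shows "cyclic_sign (frac a) (frac b) (frac x) = cyclic_sign a b x"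
proof -
  have fr: "frac y = y - of_int \<lfloor>\<theta>\<rfloor> \<and> frac \<theta> \<le> frac y \<or> frac y = y - of_int \<lfloor>\<theta>\<rfloor> - 1 \<and> frac y < frac \<theta>"
    if "y \<in> {\<theta>..<\<theta>+1}" for y
  proof (cases "y < of_int \<lfloor>\<theta>\<rfloor> + 1")
    case True
    then have "\<lfloor>y\<rfloor> = \<lfloor>\<theta>\<rfloor>" using that by (intro floor_unique) (auto intro: order_trans[OF of_int_floor_le])
    then show ?thesis using that by (simp add: frac_def)
  next
    case False
    then have "\<lfloor>y\<rfloor> = \<lfloor>\<theta>\<rfloor> + 1" using that by (intro floor_unique) (simp_all, linarith)
    then show ?thesis using that by (simp add: frac_def)
  qed
  define \<sigma> :: "real \<Rightarrow> real" where "\<sigma> y = (if frac \<theta> \<le> frac y then 1 else -1)" for y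
  have *: "sgn (frac p - frac q) = \<sigma> p * \<sigma> q * sgn (p - q)" if "p \<in> {\<theta>..<\<theta>+1}" "q \<in> {\<theta>..<\<theta>+1}" for p q
    using fr[OF that(1)] fr[OF that(2)] frac_lt_1[of p] frac_lt_1[of q] frac_ge_0[of p] frac_ge_0[of q]
    unfolding \<sigma>_def by (elim disjE conjE) (simp_all add: sgn_if)
  have "\<sigma> x * \<sigma> a * (\<sigma> b * \<sigma> x) * (\<sigma> b * \<sigma> a) = 1" by (simp add: \<sigma>_def)
  moreover have "cyclic_sign (frac a) (frac b) (frac x) = (\<sigma> x * \<sigma> a * (\<sigma> b * \<sigma> x) * (\<sigma> b * \<sigma> a)) * cyclic_sign a b x"
    unfolding cyclic_sign_def *[OF assms(1,2)] *[OF assms(3,1)] *[OF assms(3,2)] by (simp only: mult_ac)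
  ultimately show ?thesis by simp
qed

lemma cyclic_sign_mono:
  assumes "strict_mono \<rho>"
  shows "cyclic_sign (\<rho> a) (\<rho> b) (\<rho> x) = cyclic_sign a b x"
proof -
  have "sgn (\<rho> p - \<rho> q) = sgn (p - q)" for p q :: real
    using strict_mono_less[OF assms, of p q] strict_mono_less[OF assms, of q p] by (auto simp: sgn_if)
  then show ?thesis by (simp add: cyclic_sign_def)
qed

text \<open>The map \<psi> is the reparametrization reduced to the fundamental interval; it matches
  the chords and keeps their cyclic order. Signs are kept since the chain rule multiplies
  determinants of tangents by positive factors only.\<close>

lemma diagram_invariant_isotopic:
  assumes D: "virtual_diagram D" and E: "virtual_diagram E" and iso: "planar_isotopic D E"
  shows "diagram_invariant E = diagram_invariant D"
proof -
  from iso obtain h \<rho> where h: "ambient_isotopy h" and \<rho>: "circle_reparam \<rho>"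
    and c: "\<And>t. curve E t = h 1 (curve D (\<rho> t))" and o: "\<And>s t. over E s t = over D (\<rho> s) (\<rho> t)"
    unfolding planar_isotopic_def by blast
  have h01: "h 0 = id" "bij (h 1)" using h by (simp_all add: ambient_isotopy_def)
  from h obtain h' where
    "\<forall>\<tau>\<in>{0..1}. \<forall>z. (h \<tau> has_derivative blinfun_apply (h' \<tau> z)) (at z) \<and> bij (blinfun_apply (h' \<tau> z))"
    "continuous_on ({0..1} \<times> UNIV) (\<lambda>(\<tau>, z). h' \<tau> z)"
    unfolding ambient_isotopy_def by blast
  then have h': "h 0 = id" "bij (h 1)"
    "\<And>\<tau> z. \<tau> \<in> {0..1} \<Longrightarrow> (h \<tau> has_derivative blinfun_apply (h' \<tau> z)) (at z) \<and> bij (blinfun_apply (h' \<tau> z))"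
    "continuous_on ({0..1} \<times> UNIV) (\<lambda>(\<tau>, z). h' \<tau> z)"
    using h01 by blast+
  obtain \<rho>' where \<rho>': "\<And>t. (\<rho> has_vector_derivative \<rho>' t) (at t)" "\<And>t. 0 < \<rho>' t" and \<rho>1: "\<And>t. \<rho> (t + 1) = \<rho> t + 1"
    using \<rho> unfolding circle_reparam_def C1_differentiable_on_def by (metis UNIV_I vector_derivative_at)
  have mono: "strict_mono \<rho>"
  proof (rule strict_monoI)
    fix x y :: real assume "x < y"
    then show "\<rho> x < \<rho> y" using \<rho>' by (intro DERIV_pos_imp_increasing[of x y \<rho>])
      (auto simp: has_real_derivative_iff_has_vector_derivative)
  qed
  have cont\<rho>: "continuous_on S \<rho>" for S
    using \<rho>'(1) has_vector_derivative_continuous by (metis continuous_at_imp_continuous_on)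
  have \<rho>n: "\<rho> (t + real n) = \<rho> t + real n" for t n
  proof (induction n)
    case (Suc n)
    then show ?case using \<rho>1[of "t + real n"] by (simp add: algebra_simps)
  qed simp
  have \<rho>i: "\<rho> (t + of_int n) = \<rho> t + of_int n" for t n
  proof (cases "0 \<le> n")
    case True then show ?thesis using \<rho>n[of t "nat n"] by simp
  next
    case False then show ?thesis using \<rho>n[of "t + of_int n" "nat (- n)"] by simp
  qed
  define \<psi> where "\<psi> t = frac (\<rho> t)" for t
  have range: "\<rho> t \<in> {\<rho> 0..<\<rho> 0 + 1}" if "t \<in> {0..<1}" for t
    using that \<rho>1[of 0] strict_mono_less_eq[OF mono, of 0 t] strict_mono_less[OF mono, of t 1] by simp
  have surj: "\<exists>s\<in>{0..<1}. \<psi> s = a" if "a \<in> {0..<1}" for a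
  proof -
    \<comment> \<open>A lift of \<open>a\<close> that certainly lies between \<rho> 0 and \<rho> 3 =
      \<rho> 0 + 3: rounding up costs less than 1, the added 1 is a margin, and \<open>a\<close> is
      below 1.\<close>
    define y where "y = a + of_int (\<lceil>\<rho> 0\<rceil> + 1)"
    have "\<rho> 0 \<le> of_int \<lceil>\<rho> 0\<rceil>" "of_int \<lceil>\<rho> 0\<rceil> < \<rho> 0 + 1" by linarith+
    then have "\<rho> 0 \<le> y" "y \<le> \<rho> (0 + of_int 3)" unfolding \<rho>i y_def using that by (simp_all; linarith)+
    then obtain t where t: "\<rho> t = y" using IVT'[of \<rho> 0 y "0 + of_int 3"] cont\<rho> by auto
    have "\<rho> (frac t) = y - of_int \<lfloor>t\<rfloor>" using \<rho>i[of t "- \<lfloor>t\<rfloor>"] t by (simp add: frac_def)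
    then have "\<rho> (frac t) = a + of_int (\<lceil>\<rho> 0\<rceil> + 1 - \<lfloor>t\<rfloor>)" by (simp add: y_def)
    then have "\<psi> (frac t) = frac (a + of_int (\<lceil>\<rho> 0\<rceil> + 1 - \<lfloor>t\<rfloor>))" by (simp only: \<psi>_def)
    also have "\<dots> = a" using that by (simp only: frac_add_of_int_right frac_eq_id)
    finally show ?thesis by (intro bexI[of _ "frac t"]) (auto simp: frac_lt_1)
  qed
  have inj: "inj_on \<psi> {0..<1}"
  proof (rule inj_onI)
    fix s t assume st: "s \<in> {0..<1}" "t \<in> {0..<1}" "\<psi> s = \<psi> t"
    define n where "n = \<lfloor>\<rho> s\<rfloor> - \<lfloor>\<rho> t\<rfloor>"
    have n: "\<rho> s - \<rho> t = of_int n" using st(3) unfolding \<psi>_def frac_def n_def by simp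
    moreover have "\<bar>\<rho> s - \<rho> t\<bar> < 1" using range[OF st(1)] range[OF st(2)] by auto
    ultimately have "n = 0" by linarith
    then show "s = t" using n strict_mono_eq[OF mono] by simp
  qed
  have intd: "\<rho> s - \<rho> t \<in> \<int> \<longleftrightarrow> s - t \<in> \<int>" for s t
  proof
    assume "s - t \<in> \<int>"
    then obtain n where "s - t = of_int n" by (rule Ints_cases)
    then have "s = t + of_int n" by simp
    then show "\<rho> s - \<rho> t \<in> \<int>" using \<rho>i by simp
  next
    assume "\<rho> s - \<rho> t \<in> \<int>"
    then obtain n where "\<rho> s - \<rho> t = of_int n" by (rule Ints_cases)
    then have "\<rho> s = \<rho> t + of_int n" by simp
    then have "\<rho> s = \<rho> (t + of_int n)" using \<rho>i by simp
    then show "s - t \<in> \<int>" using strict_mono_eq[OF mono] by simp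
  qed
  have dbl: "double_pt (curve E) s t \<longleftrightarrow> double_pt (curve D) (\<rho> s) (\<rho> t)" for s t
    unfolding double_pt_def c intd using h'(2) by (simp add: bij_is_inj inj_eq)
  have cl: "classical_at E s t \<longleftrightarrow> classical_at D (\<psi> s) (\<psi> t)" for s t
    unfolding \<psi>_def classical_at_frac[OF D] unfolding classical_at_def dbl o ..
  have P: "chords D = map_prod \<psi> \<psi> ` chords E"
  proof (intro equalityI subsetI)
    fix p assume p: "p \<in> chords D"
    then obtain a b where ab: "p = (a, b)" "a \<in> {0..<1}" "b \<in> {0..<1}" "classical_at D a b"
      by (auto simp: chords_def)
    obtain s t where "s \<in> {0..<1}" "\<psi> s = a" "t \<in> {0..<1}" "\<psi> t = b" using surj ab by metis
    then show "p \<in> map_prod \<psi> \<psi> ` chords E" using ab cl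
      by (auto simp: chords_def intro!: image_eqI[of _ _ "(s, t)"])
  next
    fix p assume "p \<in> map_prod \<psi> \<psi> ` chords E"
    then show "p \<in> chords D" using cl by (auto simp: chords_def \<psi>_def frac_lt_1)
  qed
  have vel: "velocity (curve E) t = blinfun_apply (h' 1 (curve D (\<rho> t))) (\<rho>' t *\<^sub>R velocity (curve D) (\<rho> t))" for t
  proof -
    have "((curve D \<circ> \<rho>) has_vector_derivative \<rho>' t *\<^sub>R velocity (curve D) (\<rho> t)) (at t)"
      by (rule vector_diff_chain_at[OF \<rho>'(1) curve_deriv[OF D]])
    moreover have "(h 1 has_derivative blinfun_apply (h' 1 (curve D (\<rho> t)))) (at ((curve D \<circ> \<rho>) t) within (curve D \<circ> \<rho>) ` UNIV)"
      using h'(3)[of 1] by (auto intro: has_derivative_at_withinI)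
    ultimately have "((h 1 \<circ> (curve D \<circ> \<rho>)) has_vector_derivative blinfun_apply (h' 1 (curve D (\<rho> t))) (\<rho>' t *\<^sub>R velocity (curve D) (\<rho> t))) (at t)"
      using vector_derivative_diff_chain_within by blast
    moreover have "h 1 \<circ> (curve D \<circ> \<rho>) = curve E" using c by (simp add: fun_eq_iff)
    ultimately show ?thesis unfolding velocity_def using vector_derivative_at by fastforce
  qed
  have sg: "crossing_sign (curve D) (map_prod \<psi> \<psi> p) = crossing_sign (curve E) p" if "p \<in> chords E" for p
  proof -
    obtain s t where p: "p = (s, t)" by (cases p)
    have "double_pt (curve D) (\<rho> s) (\<rho> t)" using that dbl by (simp add: p chords_def classical_at_def)
    \<comment> \<open>Both tangents are based at the same point of the plane, so one and the same
      Jacobian acts on them.\<close>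
    then have e: "curve D (\<rho> s) = curve D (\<rho> t)" by (simp add: double_pt_def)
    have "det2 (velocity (curve E) s) (velocity (curve E) t) =
       det2 (blinfun_apply (h' 1 (curve D (\<rho> t))) 1) (blinfun_apply (h' 1 (curve D (\<rho> t))) \<i>) *
       (\<rho>' s * \<rho>' t * det2 (velocity (curve D) (\<rho> s)) (velocity (curve D) (\<rho> t)))"
      unfolding vel e det2_linear[OF blinfun.bounded_linear_right, of _ "_ *\<^sub>R _"] det2_scale ..
    then show ?thesis
      using isotopy_det_pos[of h h' "curve D (\<rho> t)", OF h'(1,3,4)] \<rho>'(2)
      by (simp add: crossing_sign_def p \<psi>_def velocity_frac[OF D] sgn_mult)
  qed
  show ?thesis unfolding diagram_invariant_def P
  proof (rule gauss_invariant_map[symmetric, OF inj])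
    show "chords E \<subseteq> {0..<1} \<times> {0..<1}" by (auto simp: chords_def)
    show "cyclic_sign (\<psi> a) (\<psi> b) (\<psi> x) = cyclic_sign a b x" if "a \<in> {0..<1}" "b \<in> {0..<1}" "x \<in> {0..<1}" for a b x
      unfolding \<psi>_def using cyclic_sign_shift[OF range[OF that(3)] range[OF that(1)] range[OF that(2)]] cyclic_sign_mono[OF mono] by simp
  qed (rule sg)
qed

section \<open>Strands in a disc\<close>

lemma sphere_angles:
  fixes p q c :: complex
  assumes "p \<in> sphere c r" "q \<in> sphere c r" "p \<noteq> q"
  obtains \<phi> \<psi> where "- pi < \<phi>" "\<phi> \<le> pi" "\<phi> < \<psi>" "\<psi> < \<phi> + 2 * pi" "p = c + of_real r * cis \<phi>" "q = c + of_real r * cis \<psi>"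
proof -
  have *: "z = c + of_real r * cis (Arg (z - c))" if "z \<in> sphere c r" for z
    using rcis_cmod_Arg[of "z - c"] that by (simp add: rcis_def dist_norm norm_minus_commute)
  note p = *[OF assms(1)] note q = *[OF assms(2)]
  have ne: "Arg (p - c) \<noteq> Arg (q - c)" using p q assms(3) by metis
  show ?thesis
  proof (cases "Arg (p - c) < Arg (q - c)")
    case True
    then show ?thesis using that[OF _ _ _ _ p q] Arg_bounded[of "p - c"] Arg_bounded[of "q - c"] by linarith
  next
    case False
    have "q = c + of_real r * cis (Arg (q - c) + 2 * pi)" using q by (simp flip: cis_mult)
    then show ?thesis using that[OF _ _ _ _ p, of "Arg (q - c) + 2 * pi"] ne False
        Arg_bounded[of "p - c"] Arg_bounded[of "q - c"] by linarith
  qed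
qed

lemma cis_inj_near: "cis \<phi> = cis \<psi> \<Longrightarrow> \<bar>\<phi> - \<psi>\<bar> < 2 * pi \<Longrightarrow> \<phi> = \<psi>"
  using exp_complex_eqI[of "\<i> * of_real \<phi>" "\<i> * of_real \<psi>"] by (simp add: cis_conv_exp)

lemma sphere_minus_two_points:
  fixes p q c :: complex
  assumes r: "0 < r" and pq: "p \<in> sphere c r" "q \<in> sphere c r" "p \<noteq> q"
  obtains A B where "connected A" "connected B" "A \<union> B = sphere c r - {p, q}"
proof -
  obtain \<phi> \<psi> where \<phi>: "- pi < \<phi>" "\<phi> \<le> pi" "\<phi> < \<psi>" "\<psi> < \<phi> + 2 * pi"
    and p: "p = c + of_real r * cis \<phi>" and q: "q = c + of_real r * cis \<psi>"
    using sphere_angles[OF pq] by metis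
  define f where "f \<theta> = c + of_real r * cis \<theta>" for \<theta>
  have cont: "continuous_on S f" for S unfolding f_def by (intro continuous_intros)
  have inj: "f \<theta> = f \<theta>' \<Longrightarrow> \<bar>\<theta> - \<theta>'\<bar> < 2 * pi \<Longrightarrow> \<theta> = \<theta>'" for \<theta> \<theta>'
    using r cis_inj_near by (simp add: f_def)
  have sph: "f \<theta> \<in> sphere c r" for \<theta> using r by (simp add: f_def dist_norm norm_mult)
  show ?thesis
  proof
    show "connected (f ` {\<phi><..<\<psi>})" "connected (f ` {\<psi><..<\<phi> + 2 * pi})"
      by (intro connected_continuous_image cont connected_Ioo)+
    show "f ` {\<phi><..<\<psi>} \<union> f ` {\<psi><..<\<phi> + 2 * pi} = sphere c r - {p, q}"
    proof (intro equalityI subsetI)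
      fix z assume "z \<in> f ` {\<phi><..<\<psi>} \<union> f ` {\<psi><..<\<phi> + 2 * pi}"
      then obtain \<theta> where \<theta>: "z = f \<theta>" "\<phi> < \<theta>" "\<theta> < \<phi> + 2 * pi" "\<theta> \<noteq> \<psi>" using \<phi> by auto
      then have "\<bar>\<theta> - \<phi>\<bar> < 2 * pi" "\<bar>\<theta> - \<psi>\<bar> < 2 * pi" using \<phi> by linarith+
      then have "f \<theta> \<noteq> f \<phi>" "f \<theta> \<noteq> f \<psi>" using inj[of \<theta> \<phi>] inj[of \<theta> \<psi>] \<theta> by auto
      then show "z \<in> sphere c r - {p, q}" using sph[of \<theta>] \<theta>(1) p q by (simp add: f_def)
    next
      fix z assume z: "z \<in> sphere c r - {p, q}"
      have "z = f (Arg (z - c))"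
        using rcis_cmod_Arg[of "z - c"] z by (simp add: rcis_def dist_norm norm_minus_commute f_def)
      moreover have "f (x + 2 * pi) = f x" for x by (simp add: f_def flip: cis_mult)
      ultimately obtain \<theta> where \<theta>: "z = f \<theta>" "\<phi> \<le> \<theta>" "\<theta> < \<phi> + 2 * pi"
        using Arg_bounded[of "z - c"] \<phi> that by (cases "\<phi> \<le> Arg (z - c)") (smt (verit))+
      moreover have "\<theta> \<noteq> \<phi>" "\<theta> \<noteq> \<psi>" using \<theta>(1) z p q by (auto simp: f_def)
      ultimately show "z \<in> f ` {\<phi><..<\<psi>} \<union> f ` {\<psi><..<\<phi> + 2 * pi}" by force
    qed
  qed
qed

lemma outer_path:
  fixes p q c :: complex
  assumes r: "0 < r" and pq: "p \<in> sphere c r" "q \<in> sphere c r" "p \<noteq> q"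
  obtains \<kappa> where "path \<kappa>" "pathstart \<kappa> = q" "pathfinish \<kappa> = p" "\<And>t. 0 < t \<Longrightarrow> t < 1 \<Longrightarrow> r < norm (\<kappa> t - c)"
proof -
  obtain \<phi> \<psi> where p: "p = c + of_real r * cis \<phi>" and q: "q = c + of_real r * cis \<psi>"
    using sphere_angles[OF pq] by metis
  \<comment> \<open>The angle is interpolated linearly, and the radial bulge
    \<open>t * (1 - t)\<close> keeps the arc strictly outside of the disc except at its
    ends.\<close>
  define \<kappa> where "\<kappa> t = c + of_real (r + t * (1 - t)) * cis (\<psi> + (\<phi> - \<psi>) * t)" for t
  show ?thesis
  proof
    show "path \<kappa>" unfolding path_def \<kappa>_def by (intro continuous_intros)
    show "pathstart \<kappa> = q" "pathfinish \<kappa> = p" by (simp_all add: pathstart_def pathfinish_def \<kappa>_def p q)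
    fix t :: real assume t: "0 < t" "t < 1"
    then have "0 < t * (1 - t)" by simp
    then show "r < norm (\<kappa> t - c)" using r by (simp add: \<kappa>_def norm_mult del: of_real_add of_real_mult of_real_diff)
  qed
qed

text \<open>The loops below close up a strand of a disc along an arc \<open>\<kappa>\<close> outside of the disc.\<close>

lemma strand_loop:
  fixes \<beta> \<kappa> :: "real \<Rightarrow> complex"
  assumes "path \<beta>" "path \<kappa>" "pathfinish \<beta> = pathstart \<kappa>" "pathfinish \<kappa> = pathstart \<beta>"
    and \<kappa>: "\<And>t. 0 < t \<Longrightarrow> t < 1 \<Longrightarrow> r < norm (\<kappa> t - c)"
  shows "path (\<beta> +++ \<kappa>)" "pathfinish (\<beta> +++ \<kappa>) = pathstart (\<beta> +++ \<kappa>)"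
    and "norm (z - c) \<le> r \<Longrightarrow> z \<in> path_image (\<beta> +++ \<kappa>) \<longleftrightarrow> z \<in> path_image \<beta>"
proof -
  show "path (\<beta> +++ \<kappa>)" "pathfinish (\<beta> +++ \<kappa>) = pathstart (\<beta> +++ \<kappa>)" using assms by auto
  assume z: "norm (z - c) \<le> r"
  have "z \<in> path_image \<beta>" if zk: "z \<in> path_image \<kappa>"
  proof -
    obtain t where t: "0 \<le> t" "t \<le> 1" "z = \<kappa> t" using zk by (auto simp: path_image_def)
    then have "t = 0 \<or> t = 1" using \<kappa>[of t] z by (cases "0 < t \<and> t < 1") auto
    then have "z = pathstart \<kappa> \<or> z = pathfinish \<kappa>" using t by (auto simp: pathstart_def pathfinish_def)
    then show ?thesis using assms(3,4) pathstart_in_path_image pathfinish_in_path_image by metis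
  qed
  then show "z \<in> path_image (\<beta> +++ \<kappa>) \<longleftrightarrow> z \<in> path_image \<beta>" using assms(3) by (auto simp: path_image_join)
qed

text \<open>Inside, the strand touches the circle only at its ends, and the closing arc runs
  outside. Each of the two open arcs of the circle is thus a connected set off the loop, on which
  the winding number is constant.\<close>

lemma strand_loop_two_valued:
  fixes \<beta> \<kappa> :: "real \<Rightarrow> complex"
  assumes r: "0 < r" and \<beta>: "path \<beta>" "\<And>t. 0 < t \<Longrightarrow> t < 1 \<Longrightarrow> norm (\<beta> t - c) < r"
    "pathstart \<beta> \<in> sphere c r" "pathfinish \<beta> \<in> sphere c r" "pathstart \<beta> \<noteq> pathfinish \<beta>"
    and \<kappa>: "path \<kappa>" "pathfinish \<beta> = pathstart \<kappa>" "pathfinish \<kappa> = pathstart \<beta>"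
      "\<And>t. 0 < t \<Longrightarrow> t < 1 \<Longrightarrow> r < norm (\<kappa> t - c)"
  obtains m n where "\<And>z. z \<in> sphere c r \<Longrightarrow> z \<notin> path_image \<beta> \<Longrightarrow>
      winding_number (\<beta> +++ \<kappa>) z = m \<or> winding_number (\<beta> +++ \<kappa>) z = n"
proof -
  note L = strand_loop[OF \<beta>(1) \<kappa>]
  obtain A B where AB: "connected A" "connected B" "A \<union> B = sphere c r - {pathstart \<beta>, pathfinish \<beta>}"
    using sphere_minus_two_points[OF r \<beta>(3-5)] by metis
  have off: "z \<notin> path_image (\<beta> +++ \<kappa>)" if "z \<in> A \<union> B" for z
  proof -
    have z: "norm (z - c) = r" "z \<noteq> pathstart \<beta>" "z \<noteq> pathfinish \<beta>"
      using that AB(3) by (auto simp: dist_norm norm_minus_commute)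
    have "z \<notin> path_image \<beta>"
    proof
      assume "z \<in> path_image \<beta>"
      then obtain t where t: "0 \<le> t" "t \<le> 1" "z = \<beta> t" by (auto simp: path_image_def)
      then have "t = 0 \<or> t = 1" using \<beta>(2)[of t] z by (cases "0 < t \<and> t < 1") auto
      then show False using t z by (auto simp: pathstart_def pathfinish_def)
    qed
    then show ?thesis using L(3)[of z] z by simp
  qed
  obtain m where "\<And>z. z \<in> A \<Longrightarrow> winding_number (\<beta> +++ \<kappa>) z = m"
    using winding_number_constant[OF L(1,2) AB(1)] off unfolding constant_on_def by blast
  moreover obtain n where "\<And>z. z \<in> B \<Longrightarrow> winding_number (\<beta> +++ \<kappa>) z = n"
    using winding_number_constant[OF L(1,2) AB(2)] off unfolding constant_on_def by blast
  moreover have "z \<in> A \<union> B" if "z \<in> sphere c r" "z \<notin> path_image \<beta>" for z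
    using that unfolding AB(3) by auto
  ultimately show ?thesis using that[of m n] by blast
qed

text \<open>The straight-line homotopy between two strands with common ends stays in the open disc
  by convexity, hence away from points of the circle.\<close>

lemma strand_loop_homotopic:
  fixes \<beta> \<beta>' \<kappa> :: "real \<Rightarrow> complex"
  assumes \<beta>: "path \<beta>" "path \<beta>'" "pathstart \<beta>' = pathstart \<beta>" "pathfinish \<beta>' = pathfinish \<beta>"
      "\<And>t. 0 < t \<Longrightarrow> t < 1 \<Longrightarrow> norm (\<beta> t - c) < r \<and> norm (\<beta>' t - c) < r"
    and \<kappa>: "path \<kappa>" "pathfinish \<beta> = pathstart \<kappa>" "pathfinish \<kappa> = pathstart \<beta>"
      "\<And>t. 0 < t \<Longrightarrow> t < 1 \<Longrightarrow> r < norm (\<kappa> t - c)"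
    and z: "z \<in> sphere c r" "z \<noteq> pathstart \<beta>" "z \<noteq> pathfinish \<beta>"
  shows "winding_number (\<beta> +++ \<kappa>) z = winding_number (\<beta>' +++ \<kappa>) z"
proof (rule winding_number_homotopic_paths[OF homotopic_paths_join])
  show "homotopic_paths (- {z}) \<beta> \<beta>'"
  proof (rule homotopic_paths_linear[OF \<beta>(1-4)])
    fix t :: real assume t: "t \<in> {0..1}"
    show "closed_segment (\<beta> t) (\<beta>' t) \<subseteq> - {z}"
    proof (cases "0 < t \<and> t < 1")
      case True
      then have "\<beta> t \<in> ball c r" "\<beta>' t \<in> ball c r" using \<beta>(5)[of t] by (simp_all add: dist_norm norm_minus_commute)
      then have "closed_segment (\<beta> t) (\<beta>' t) \<subseteq> ball c r" by (simp add: closed_segment_subset)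
      then show ?thesis using z by auto
    next
      case False
      then have "t = 0 \<or> t = 1" using t by auto
      then have "\<beta>' t = \<beta> t" "\<beta> t \<noteq> z" using \<beta>(3,4) z by (auto simp: pathstart_def pathfinish_def)
      then show ?thesis by simp
    qed
  qed
  have "z \<noteq> \<kappa> t" if "0 \<le> t" "t \<le> 1" for t
  proof (cases "0 < t \<and> t < 1")
    case True then show ?thesis using \<kappa>(4)[of t] z(1) by (auto simp: dist_norm norm_minus_commute)
  next
    case False
    then have "t = 0 \<or> t = 1" using that by auto
    then show ?thesis using \<kappa>(2,3) z by (auto simp: pathstart_def pathfinish_def)
  qed
  then show "homotopic_paths (- {z}) \<kappa> \<kappa>" using \<kappa>(1) by (simp add: path_image_def) force
qed (use \<kappa> in simp)

lemma path_subpath_cont: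
  fixes \<gamma> :: "real \<Rightarrow> complex"
  assumes "\<And>S. continuous_on S \<gamma>" "p < q"
  shows "path (subpath p q \<gamma>)"
  unfolding path_def subpath_def
  by (rule continuous_on_compose2[OF assms(1)[of UNIV]]) (auto intro!: continuous_intros)

text \<open>The interval from \<open>x\<close> to \<open>y\<close> stays in the disc, so the closing
  arc produces no further meetings. The crossings with the loop are those with the strand.\<close>

lemma strand_crossings_sum:
  fixes \<gamma> \<gamma>' :: "real \<Rightarrow> complex"
  assumes der: "\<And>t. (\<gamma> has_vector_derivative \<gamma>' t) (at t)" and pq: "p < q" and inj: "inj_on \<gamma> {p..q}"
    and \<kappa>: "path \<kappa>" "\<gamma> q = pathstart \<kappa>" "pathfinish \<kappa> = \<gamma> p"
      "\<And>t. 0 < t \<Longrightarrow> t < 1 \<Longrightarrow> r < norm (\<kappa> t - c)"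
    and xy: "x < y" "\<And>u. u \<in> {x..y} \<Longrightarrow> norm (\<gamma> u - c) \<le> r"
    and X: "finite X" "X = {u \<in> {x..y}. \<gamma> u \<in> \<gamma> ` {p..q}}"
    and ends: "\<gamma> x \<notin> \<gamma> ` {p..q}" "\<gamma> y \<notin> \<gamma> ` {p..q}"
    and cross: "\<And>u. u \<in> X \<Longrightarrow> \<exists>v\<in>{p<..<q}. \<gamma> v = \<gamma> u \<and> det2 (\<gamma>' v) (\<gamma>' u) \<noteq> 0 \<and> sgn (det2 (\<gamma>' v) (\<gamma>' u)) = j u"
  shows "winding_number (subpath p q \<gamma> +++ \<kappa>) (\<gamma> y) - winding_number (subpath p q \<gamma> +++ \<kappa>) (\<gamma> x) =
    of_real (sum j X)"
proof -
  have cont: "continuous_on S \<gamma>" for S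
    using der has_vector_derivative_continuous by (metis continuous_at_imp_continuous_on)
  define L where "L = subpath p q \<gamma> +++ \<kappa>"
  have sub: "path (subpath p q \<gamma>)" "path_image (subpath p q \<gamma>) = \<gamma> ` {p..q}"
    "pathfinish (subpath p q \<gamma>) = pathstart \<kappa>" "pathfinish \<kappa> = pathstart (subpath p q \<gamma>)"
    using path_subpath_cont[OF cont pq] pq \<kappa> by (simp_all add: path_image_subpath)
  note L = strand_loop[OF sub(1) \<kappa>(1) sub(3,4) \<kappa>(4), folded L_def, unfolded sub(2)]
  have mem: "\<gamma> u \<in> path_image L \<longleftrightarrow> \<gamma> u \<in> \<gamma> ` {p..q}" if "u \<in> {x..y}" for u
    using L(3) xy(2)[OF that] by simp
  have X': "{u \<in> {x..y}. \<gamma> u \<in> path_image L} = X" using mem X(2) by blast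
  have "winding_number L (\<gamma> y) - winding_number L (\<gamma> x) = of_real (\<Sum>u | u \<in> {x..y} \<and> \<gamma> u \<in> path_image L. j u)"
  proof (rule winding_number_crossings[OF L(1,2) cont xy(1)])
    show "finite {u \<in> {x..y}. \<gamma> u \<in> path_image L}" unfolding X' by (rule X(1))
    show "\<gamma> x \<notin> path_image L" "\<gamma> y \<notin> path_image L" using mem ends xy(1) by auto
    fix u assume u: "u \<in> {x..y}" "\<gamma> u \<in> path_image L"
    then have "u \<in> X" using X' by blast
    then obtain v where v: "v \<in> {p<..<q}" "\<gamma> v = \<gamma> u" "det2 (\<gamma>' v) (\<gamma>' u) \<noteq> 0" "sgn (det2 (\<gamma>' v) (\<gamma>' u)) = j u"
      using cross by blast
    \<comment> \<open>The strand is traversed in the first half of the joined loop. This rescales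
      its tangent by the positive factor 2 (q - p), which leaves the sign unchanged.\<close>
    define w where "w = (v - p) / (q - p) / 2"
    have w: "0 < w" "w < 1 / 2" "p + (q - p) * (2 * w) = v"
      using v(1) pq by (auto simp: w_def field_simps)
    have sp: "subpath p q \<gamma> t = \<gamma> (p + (q - p) * t)" for t by (simp add: subpath_def algebra_simps)
    have uniq: "L t = \<gamma> u \<longleftrightarrow> t = w" if t: "t \<in> {0..1}" for t
    proof (cases "t \<le> 1 / 2")
      case True
      have "0 \<le> (q - p) * (2 * t)" "(q - p) * (2 * t) \<le> (q - p) * 1" using True t pq by (auto intro: mult_left_mono)
      then have *: "p + (q - p) * (2 * t) \<in> {p..q}" by auto
      have "L t = \<gamma> (p + (q - p) * (2 * t))" using True by (simp add: L_def joinpaths_def sp)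
      then have "L t = \<gamma> u \<longleftrightarrow> p + (q - p) * (2 * t) = v" using inj_on_eq_iff[OF inj *, of v] v by auto
      also have "\<dots> \<longleftrightarrow> t = w" using w(3) pq by auto
      finally show ?thesis .
    next
      case False
      have "\<gamma> v \<noteq> \<gamma> p" "\<gamma> v \<noteq> \<gamma> q" using inj_on_eq_iff[OF inj, of v] v(1) pq by auto
      moreover have "L t = \<kappa> (2 * t - 1)" using False by (simp add: L_def joinpaths_def)
      moreover have "r < norm (\<kappa> (2 * t - 1) - c)" if "t < 1" using \<kappa>(4)[of "2 * t - 1"] False that by simp
      moreover have "\<kappa> 1 = \<gamma> p" using \<kappa>(3) by (simp add: pathfinish_def)
      ultimately have "L t \<noteq> \<gamma> u" using v(2) xy(2)[OF u(1)] t by (cases "t < 1") auto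
      then show ?thesis using False w by auto
    qed
    have "((\<gamma> \<circ> (\<lambda>t. p + (q - p) * (2 * t))) has_vector_derivative (2 * (q - p)) *\<^sub>R \<gamma>' (p + (q - p) * (2 * w))) (at w)"
      by (rule vector_diff_chain_at[OF _ der]) (auto intro!: derivative_eq_intros)
    then have dL: "(L has_vector_derivative (2 * (q - p)) *\<^sub>R \<gamma>' v) (at w)"
      unfolding w(3)
      by (rule has_vector_derivative_transform_within_open[where S = "{0<..<1/2}"])
         (use w in \<open>auto simp: L_def joinpaths_def sp\<close>)
    have d: "det2 ((2 * (q - p)) *\<^sub>R \<gamma>' v) (\<gamma>' u) = 2 * (q - p) * det2 (\<gamma>' v) (\<gamma>' u)"
      by (simp add: det2_eq algebra_simps)
    show "\<exists>w v' d. 0 < w \<and> w < 1 \<and> (\<forall>u'\<in>{0..1}. L u' = \<gamma> u \<longleftrightarrow> u' = w) \<and>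
        (L has_vector_derivative v') (at w) \<and> (\<gamma> has_vector_derivative d) (at u) \<and>
        det2 v' d \<noteq> 0 \<and> sgn (det2 v' d) = j u"
      by (rule exI[of _ w], rule exI[of _ "(2 * (q - p)) *\<^sub>R \<gamma>' v"], rule exI[of _ "\<gamma>' u"])
         (use w uniq dL der d v pq in \<open>simp add: sgn_mult\<close>)
  qed
  then show ?thesis unfolding X' unfolding L_def .
qed

section \<open>Chords inside and outside of the disc of a move\<close>

definition strand_params :: "nat \<Rightarrow> (nat \<Rightarrow> real) \<Rightarrow> (nat \<Rightarrow> real) \<Rightarrow> real set" where
  "strand_params k a b = (\<Union>i<k. {a i..b i})"

definition inner_chords :: "diagram \<Rightarrow> nat \<Rightarrow> (nat \<Rightarrow> real) \<Rightarrow> (nat \<Rightarrow> real) \<Rightarrow> (real \<times> real) set" where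
  "inner_chords D k a b = {(s, t) \<in> chords D. s \<in> strand_params k a b \<and> t \<in> strand_params k a b}"

definition outer_chords :: "diagram \<Rightarrow> nat \<Rightarrow> (nat \<Rightarrow> real) \<Rightarrow> (nat \<Rightarrow> real) \<Rightarrow> (real \<times> real) set" where
  "outer_chords D k a b = {(s, t) \<in> chords D. s \<notin> strand_params k a b \<and> t \<notin> strand_params k a b}"

locale strands =
  fixes D :: diagram and c :: complex and r :: real and k :: nat and a b :: "nat \<Rightarrow> real"
  assumes D: "virtual_diagram D" and r: "0 < r" and strands: "strands_in_disc (curve D) c r k a b"
begin

abbreviation U where "U \<equiv> strand_params k a b"

lemma ab: "i < k \<Longrightarrow> 0 < a i \<and> a i < b i \<and> b i < 1"
  using strands unfolding strands_in_disc_def by blast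

lemma disj: "i < k \<Longrightarrow> j < k \<Longrightarrow> i \<noteq> j \<Longrightarrow> {a i..b i} \<inter> {a j..b j} = {}"
  using strands unfolding strands_in_disc_def disjoint_family_on_def by blast

lemma in_disc: "t \<in> {0..1} \<Longrightarrow> curve D t \<in> cball c r \<longleftrightarrow> t \<in> U"
  using strands unfolding strands_in_disc_def strand_params_def by blast

lemma interior: "i < k \<Longrightarrow> a i < t \<Longrightarrow> t < b i \<Longrightarrow> norm (curve D t - c) < r"
  using strands unfolding strands_in_disc_def by (force simp: dist_norm norm_minus_commute)

lemma in_U: "i < k \<Longrightarrow> t \<in> {a i..b i} \<Longrightarrow> t \<in> U"
  unfolding strand_params_def by blast

lemma U_01: "t \<in> U \<Longrightarrow> 0 < t \<and> t < 1"
  unfolding strand_params_def using ab by fastforce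

lemma U_le: "t \<in> U \<Longrightarrow> norm (curve D t - c) \<le> r"
  using in_disc[of t] U_01[of t] by (auto simp: dist_norm norm_minus_commute)

lemma closed_U: "closed U"
  unfolding strand_params_def by (intro closed_UN) auto

text \<open>The other strands are closed and do not contain an end of strand \<open>i\<close>, so
  that end is a limit of parameters outside all strands. Closed conditions that hold outside, such
  as agreement of two curves, extend to it.\<close>

lemma ends_approached:
  assumes i: "i < k" and cl: "closed {t. P t}" and P: "\<And>t. t \<in> {0..1} - U \<Longrightarrow> P t"
  shows "P (a i)" "P (b i)"
proof -
  define K where "K = (\<Union>j\<in>{..<k} - {i}. {a j..b j})"
  have K: "open (- K)" unfolding K_def by (intro open_Compl closed_UN) auto
  have UK: "U = {a i..b i} \<union> K" using i unfolding strand_params_def K_def by blast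
  have aK: "a i \<in> - K" "b i \<in> - K"
    using disj[of i] i ab[OF i] unfolding K_def by fastforce+
  \<comment> \<open>The number \<open>s\<close> is -1 or 1 and selects the side from which
    \<open>x\<close> is approached: from below for the first end of a strand, from above for the
    last.\<close>
  have *: "P x" if x: "x \<in> - K" "0 < x" "x < 1" and s: "\<And>h. 0 < h \<Longrightarrow> x + s * h \<notin> {a i..b i}" and s1: "\<bar>s\<bar> = 1" for x s :: real
  proof (rule ccontr)
    assume "\<not> P x"
    then have "x \<in> - K \<inter> - {t. P t} \<inter> {0<..<1}" using x by simp
    moreover have "open (- K \<inter> - {t. P t} \<inter> {0<..<1})" by (intro open_Int K open_Compl cl) auto
    ultimately obtain e where e: "0 < e" "ball x e \<subseteq> - K \<inter> - {t. P t} \<inter> {0<..<1}"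
      using open_contains_ball by metis
    have "x + s * (e / 2) \<in> ball x e" using e(1) s1 by (simp add: dist_norm abs_mult)
    then have "x + s * (e / 2) \<in> {0..1} - U" "\<not> P (x + s * (e / 2))"
      using e s[of "e / 2"] unfolding UK by auto
    then show False using P by blast
  qed
  show "P (a i)" by (rule *[of _ "-1"]) (use aK ab[OF i] in auto)
  show "P (b i)" by (rule *[of _ 1]) (use aK ab[OF i] in auto)
qed

lemma ends_sphere:
  assumes "i < k" shows "norm (curve D (a i) - c) = r" "norm (curve D (b i) - c) = r"
proof -
  have "closed {t. r \<le> norm (curve D t - c)}"
    by (intro closed_Collect_le continuous_intros curve_continuous[OF D])
  moreover have "r \<le> norm (curve D t - c)" if "t \<in> {0..1} - U" for t
    using in_disc[of t] that by (auto simp: dist_norm norm_minus_commute)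
  ultimately have "r \<le> norm (curve D (a i) - c)" "r \<le> norm (curve D (b i) - c)"
    using ends_approached[OF assms, of "\<lambda>t. r \<le> norm (curve D t - c)"] by blast+
  moreover have "a i \<in> U" "b i \<in> U" using in_U[OF assms] ab[OF assms] by auto
  ultimately show "norm (curve D (a i) - c) = r" "norm (curve D (b i) - c) = r"
    using U_le by force+
qed

lemma sphere_ends:
  assumes "i < k" "t \<in> {a i..b i}" "norm (curve D t - c) = r" shows "t = a i \<or> t = b i"
  using interior[OF assms(1), of t] assms(2,3) by force

lemma double_inner:
  assumes "i < k" "j < k" "s \<in> {a i..b i}" "t \<in> {a j..b j}" "s \<noteq> t"
  shows "double_pt (curve D) s t \<longleftrightarrow> curve D s = curve D t"
proof -
  have "0 < s" "s < 1" "0 < t" "t < 1" using U_01 in_U assms by blast+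
  have "s - t \<notin> \<int>"
  proof
    assume "s - t \<in> \<int>"
    then obtain z where z: "s - t = of_int z" by (rule Ints_cases)
    then have "\<bar>real_of_int z\<bar> < 1" using \<open>0 < s\<close> \<open>s < 1\<close> \<open>0 < t\<close> \<open>t < 1\<close> by linarith
    then have "z = 0" by linarith
    then show False using z assms(5) by simp
  qed
  then show ?thesis by (simp add: double_pt_def)
qed

text \<open>A double point is one point of the plane, in the disc or not. Hence no chord joins a
  parameter in a strand to one outside of the strands.\<close>

lemma chords_split: "chords D = outer_chords D k a b \<union> inner_chords D k a b"
proof -
  have "s \<in> U \<longleftrightarrow> t \<in> U" if "(s, t) \<in> chords D" for s t
    using that in_disc[of s] in_disc[of t] by (auto simp: chords_def classical_at_def double_pt_def)
  then show ?thesis unfolding outer_chords_def inner_chords_def by blast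
qed

lemma inner_chord_iff:
  "(s, t) \<in> inner_chords D k a b \<longleftrightarrow> (\<exists>i<k. \<exists>j<k. (s, t) \<in> strand_crossings (curve D) a b i j) \<and> classical_at D s t"
proof
  assume "(s, t) \<in> inner_chords D k a b"
  then show "(\<exists>i<k. \<exists>j<k. (s, t) \<in> strand_crossings (curve D) a b i j) \<and> classical_at D s t"
    unfolding inner_chords_def strand_crossings_def strand_params_def chords_def
    by (auto simp: classical_at_def double_pt_def)
next
  assume "(\<exists>i<k. \<exists>j<k. (s, t) \<in> strand_crossings (curve D) a b i j) \<and> classical_at D s t"
  then obtain i j where ij: "i < k" "j < k" "s \<in> {a i..b i}" "t \<in> {a j..b j}" "classical_at D s t"
    by (auto simp: strand_crossings_def)
  then have "s \<in> U" "t \<in> U" using in_U by blast+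
  then show "(s, t) \<in> inner_chords D k a b" using U_01 ij(5)
    by (fastforce simp: inner_chords_def chords_def)
qed

lemma alternating_outer: "alternating (outer_chords D k a b) (crossing_sign (curve D))"
  by (rule alternating_mono[OF alternating_chords[OF D]])
    (use alternating_chords[OF D] in \<open>auto simp: outer_chords_def alternating_def\<close>)

text \<open>
  \<open>crosses j F\<close>: along the strands other than \<open>j\<close>, the function \<open>F\<close> (a winding number below) jumps
  by the sign of the crossing at each crossing with strand \<open>j\<close> and is constant in between.
\<close>

definition crosses :: "nat \<Rightarrow> (complex \<Rightarrow> complex) \<Rightarrow> bool" where
  "crosses j F \<longleftrightarrow> (\<forall>x y X g. x < y \<longrightarrow> {x..y} \<subseteq> U - {a j..b j} \<longrightarrow> finite X \<longrightarrow>
     X = {u \<in> {x..y}. curve D u \<in> curve D ` {a j..b j}} \<longrightarrow> x \<notin> X \<longrightarrow> y \<notin> X \<longrightarrow>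
     (\<forall>u\<in>X. \<exists>v\<in>{a j<..<b j}. curve D v = curve D u \<and> g u = crossing_sign (curve D) (v, u)) \<longrightarrow>
     F (curve D y) - F (curve D x) = of_real (sum g X))"

lemma crosses_loop:
  assumes j: "j < k" and inj: "inj_on (curve D) {a j..b j}"
    and \<kappa>: "path \<kappa>" "curve D (b j) = pathstart \<kappa>" "pathfinish \<kappa> = curve D (a j)"
      "\<And>t. 0 < t \<Longrightarrow> t < 1 \<Longrightarrow> r < norm (\<kappa> t - c)"
  shows "crosses j (winding_number (subpath (a j) (b j) (curve D) +++ \<kappa>))"
  unfolding crosses_def
proof (intro allI impI)
  fix x y X g
  assume xy: "x < y" "{x..y} \<subseteq> U - {a j..b j}" and X: "finite X" "X = {u \<in> {x..y}. curve D u \<in> curve D ` {a j..b j}}"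
    "x \<notin> X" "y \<notin> X" and g: "\<forall>u\<in>X. \<exists>v\<in>{a j<..<b j}. curve D v = curve D u \<and> g u = crossing_sign (curve D) (v, u)"
  show "winding_number (subpath (a j) (b j) (curve D) +++ \<kappa>) (curve D y) -
    winding_number (subpath (a j) (b j) (curve D) +++ \<kappa>) (curve D x) = of_real (sum g X)"
  proof (rule strand_crossings_sum[OF curve_deriv[OF D] _ inj \<kappa> xy(1) _ X(1,2)])
    show "a j < b j" using ab[OF j] by blast
    show "norm (curve D u - c) \<le> r" if "u \<in> {x..y}" for u using that xy(2) U_le by blast
    show "curve D x \<notin> curve D ` {a j..b j}" "curve D y \<notin> curve D ` {a j..b j}" using X(2-4) xy(1) by auto
    fix u assume u: "u \<in> X"
    then obtain v where v: "v \<in> {a j<..<b j}" "curve D v = curve D u" "g u = crossing_sign (curve D) (v, u)"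
      using g by blast
    have "u \<in> U - {a j..b j}" using u X(2) xy(2) by blast
    then have "\<exists>i<k. u \<in> {a i..b i}" "u \<noteq> v" using v(1) unfolding strand_params_def by auto
    then have "double_pt (curve D) v u" using double_inner[OF j, of _ v u] v by auto
    then have "det2 (velocity (curve D) v) (velocity (curve D) u) \<noteq> 0" by (rule double_det[OF D])
    then show "\<exists>v\<in>{a j<..<b j}. curve D v = curve D u \<and> det2 (velocity (curve D) v) (velocity (curve D) u) \<noteq> 0 \<and>
        sgn (det2 (velocity (curve D) v) (velocity (curve D) u)) = g u"
      using v by (auto simp: crossing_sign_def)
  qed
qed

end

locale local_move = D: strands D c r k a b + E: strands E c r k a b
  for D E :: diagram and c :: complex and r :: real and k :: nat and a b :: "nat \<Rightarrow> real" +
  assumes curve_eq: "t \<in> {0..1} \<Longrightarrow> t \<notin> strand_params k a b \<Longrightarrow> curve D t = curve E t"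
    and over_eq: "s \<in> {0..1} \<Longrightarrow> s \<notin> strand_params k a b \<Longrightarrow> t \<in> {0..1} \<Longrightarrow> t \<notin> strand_params k a b \<Longrightarrow>
      over D s t = over E s t"
begin

abbreviation U where "U \<equiv> strand_params k a b"

lemma ends_eq: assumes "i < k" shows "curve D (a i) = curve E (a i)" "curve D (b i) = curve E (b i)"
proof -
  have "closed {t. curve D t = curve E t}"
    by (intro closed_Collect_eq curve_continuous[OF D.D] curve_continuous[OF E.D])
  then show "curve D (a i) = curve E (a i)" "curve D (b i) = curve E (b i)"
    using D.ends_approached[OF assms, of "\<lambda>t. curve D t = curve E t"] curve_eq by blast+
qed

text \<open>Off the closed strand set the two curves agree near \<open>t\<close>, so the derivatives
  do. At the base point agreement on the unit interval is only one-sided; periodicity supplies the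
  other side.\<close>

lemma velocity_eq:
  assumes t: "t \<in> {0..<1}" "t \<notin> U"
  shows "velocity (curve D) t = velocity (curve E) t"
proof -
  have V: "\<exists>V. open V \<and> t \<in> V \<and> (\<forall>s\<in>V. curve D s = curve E s)"
  proof (cases "t = 0")
    case False
    have "open ({0<..<1} - U)" using D.closed_U by auto
    then show ?thesis using False t curve_eq by (intro exI[of _ "{0<..<1} - U"]) auto
  next
    case True
    define V where "V = - U \<inter> {-1<..<1} \<inter> (\<lambda>s. s + 1) -` (- U)"
    have "open ((\<lambda>s::real. s + 1) -` (- U))"
      using D.closed_U by (intro open_vimage continuous_intros) auto
    then have "open V" unfolding V_def by (intro open_Int open_Compl D.closed_U) auto
    moreover have "t \<in> V" using True t D.U_01[of 1] by (auto simp: V_def)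
    moreover have "curve D s = curve E s" if s: "s \<in> V" for s
    proof (cases "0 \<le> s")
      case True then show ?thesis using s curve_eq by (auto simp: V_def)
    next
      case False
      then have "curve D (s + 1) = curve E (s + 1)" using s curve_eq[of "s + 1"] by (auto simp: V_def)
      then show ?thesis using curve_period[OF D.D, of s 1] curve_period[OF E.D, of s 1] by simp
    qed
    ultimately show ?thesis by blast
  qed
  then obtain V where V: "open V" "t \<in> V" "\<And>s. s \<in> V \<Longrightarrow> curve D s = curve E s" by blast
  then have "(curve E has_vector_derivative velocity (curve D) t) (at t)"
    using has_vector_derivative_transform_within_open[OF curve_deriv[OF D.D] V(1,2)] by blast
  then show ?thesis unfolding velocity_def using vector_derivative_at by metis
qed

lemma outer_eq: "outer_chords E k a b = outer_chords D k a b"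
proof -
  have "classical_at E s t \<longleftrightarrow> classical_at D s t" if "s \<in> {0..<1}" "t \<in> {0..<1}" "s \<notin> U" "t \<notin> U" for s t
    using that curve_eq[of s] curve_eq[of t] over_eq[of s t] over_eq[of t s]
    unfolding classical_at_def double_pt_def by auto
  then show ?thesis unfolding outer_chords_def chords_def by blast
qed

lemma outer_sign: "p \<in> outer_chords D k a b \<Longrightarrow> crossing_sign (curve E) p = crossing_sign (curve D) p"
  unfolding crossing_sign_def using velocity_eq[of "fst p"] velocity_eq[of "snd p"]
  by (auto simp: outer_chords_def chords_def)

lemma diagram_invariant_D: "diagram_invariant D = gauss_invariant (outer_chords D k a b \<union> inner_chords D k a b) (crossing_sign (curve D))"
  unfolding diagram_invariant_def D.chords_split[symmetric] ..

lemma diagram_invariant_E: "diagram_invariant E = gauss_invariant (outer_chords D k a b \<union> inner_chords E k a b) (crossing_sign (curve E))"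
  unfolding diagram_invariant_def E.chords_split[unfolded outer_eq, symmetric] ..

lemma outer_gauss_invariant: "gauss_invariant (outer_chords D k a b) (crossing_sign (curve E)) = gauss_invariant (outer_chords D k a b) (crossing_sign (curve D))"
  by (rule gauss_invariant_cong) (rule outer_sign)

lemma outer_points:
  assumes "(p, q) \<in> outer_chords D k a b" shows "p \<notin> U" "q \<notin> U" "p \<in> {0..<1}" "q \<in> {0..<1}"
  using assms by (auto simp: outer_chords_def chords_def)

lemma sgn_outer: "p \<notin> U \<Longrightarrow> i < k \<Longrightarrow> x \<in> {a i..b i} \<Longrightarrow> sgn (x - p) = sgn (a i - p) \<and> a i \<noteq> p"
proof -
  assume *: "p \<notin> U" "i < k" "x \<in> {a i..b i}"
  then have "p < a i \<or> b i < p" using D.in_U[of i p] by (meson atLeastAtMost_iff not_le)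
  then show ?thesis using * D.ab[of i] by (auto simp: sgn_if)
qed

lemma sgn_inner: "i < k \<Longrightarrow> j < k \<Longrightarrow> i \<noteq> j \<Longrightarrow> x \<in> {a i..b i} \<Longrightarrow> y \<in> {a j..b j} \<Longrightarrow>
    sgn (x - y) = sgn (a i - a j) \<and> a i \<noteq> a j"
  using D.disj[of i j] D.ab[of i] D.ab[of j] by (auto simp: sgn_if disjoint_iff)

text \<open>One closing arc serves the strand of \<open>D\<close> and that of \<open>E\<close>. The
  homotopy of strands gives \<open>F = G\<close> on the circle, and the two arcs of the circle
  account for the values \<open>m\<close> and \<open>n\<close>.\<close>

lemma strand_index:
  assumes j: "j < k" and inj: "inj_on (curve D) {a j..b j}" "inj_on (curve E) {a j..b j}"
  obtains F G m n where "D.crosses j F" "E.crosses j G"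
    "\<And>z. norm (z - c) = r \<Longrightarrow> z \<notin> curve D ` {a j..b j} \<Longrightarrow> F z = G z \<and> (F z = m \<or> F z = n)"
proof -
  define p where "p = curve D (a j)"
  define q where "q = curve D (b j)"
  have ab: "a j < b j" using D.ab[OF j] by blast
  have pq: "p \<in> sphere c r" "q \<in> sphere c r"
    using D.ends_sphere[OF j] by (auto simp: p_def q_def dist_norm norm_minus_commute)
  have ne: "p \<noteq> q" using inj_on_eq_iff[OF inj(1), of "a j" "b j"] ab by (simp add: p_def q_def)
  obtain \<kappa> where \<kappa>: "path \<kappa>" "pathstart \<kappa> = q" "pathfinish \<kappa> = p" "\<And>t. 0 < t \<Longrightarrow> t < 1 \<Longrightarrow> r < norm (\<kappa> t - c)"
    using outer_path[OF D.r pq ne] by blast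
  let ?\<beta> = "subpath (a j) (b j) (curve D)" and ?\<beta>' = "subpath (a j) (b j) (curve E)"
  have \<beta>: "path ?\<beta>" "path ?\<beta>'" by (intro path_subpath_cont curve_continuous D.D E.D ab)+
  have ends: "pathstart ?\<beta> = p" "pathfinish ?\<beta> = q" "pathstart ?\<beta>' = p" "pathfinish ?\<beta>' = q"
    using ends_eq[OF j] by (simp_all add: p_def q_def)
  have img: "path_image ?\<beta> = curve D ` {a j..b j}" using ab by (simp add: path_image_subpath)
  have int: "norm (?\<beta> t - c) < r" "norm (?\<beta>' t - c) < r" if "0 < t" "t < 1" for t
  proof -
    have "(b j - a j) * t < b j - a j" "0 < (b j - a j) * t" using that ab by auto
    then have "a j < (b j - a j) * t + a j" "(b j - a j) * t + a j < b j" by auto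
    then show "norm (?\<beta> t - c) < r" "norm (?\<beta>' t - c) < r"
      unfolding subpath_def using D.interior[OF j] E.interior[OF j] by blast+
  qed
  obtain m n where mn: "\<And>z. z \<in> sphere c r \<Longrightarrow> z \<notin> path_image ?\<beta> \<Longrightarrow>
      winding_number (?\<beta> +++ \<kappa>) z = m \<or> winding_number (?\<beta> +++ \<kappa>) z = n"
    by (rule strand_loop_two_valued[OF D.r \<beta>(1) int(1), of \<kappa>]) (use \<kappa> pq ne ends in auto)
  show ?thesis
  proof
    show "D.crosses j (winding_number (?\<beta> +++ \<kappa>))"
      by (rule D.crosses_loop[OF j inj(1) \<kappa>(1)]) (use \<kappa> in \<open>auto simp: p_def q_def\<close>)
    show "E.crosses j (winding_number (?\<beta>' +++ \<kappa>))"
      by (rule E.crosses_loop[OF j inj(2) \<kappa>(1)]) (use \<kappa> ends_eq[OF j] in \<open>auto simp: p_def q_def\<close>)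
    fix z assume z: "norm (z - c) = r" "z \<notin> curve D ` {a j..b j}"
    then have zs: "z \<in> sphere c r" by (simp add: dist_norm norm_minus_commute)
    have zpq: "z \<noteq> p" "z \<noteq> q" using z(2) ab by (auto simp: p_def q_def)
    have "winding_number (?\<beta> +++ \<kappa>) z = winding_number (?\<beta>' +++ \<kappa>) z"
      by (rule strand_loop_homotopic[OF \<beta>, of c r]) (use int \<kappa> ends zs zpq in auto)
    then show "winding_number (?\<beta> +++ \<kappa>) z = winding_number (?\<beta>' +++ \<kappa>) z \<and>
      (winding_number (?\<beta> +++ \<kappa>) z = m \<or> winding_number (?\<beta> +++ \<kappa>) z = n)"
      using mn[OF zs] z(2) img by auto
  qed
qed

end

lemma same_outside_disc_local_move:
  assumes "virtual_diagram D" "virtual_diagram E" "same_outside_disc D E k a b"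
  obtains c r where "local_move D E c r k a b"
proof -
  from assms(3) obtain c r where "r > 0" "strands_in_disc (curve D) c r k a b" "strands_in_disc (curve E) c r k a b"
    unfolding same_outside_disc_def by blast
  then have "local_move D E c r k a b"
    using assms unfolding same_outside_disc_def by unfold_locales (auto simp: strand_params_def)
  then show ?thesis using that by blast
qed

section \<open>Invariance under the local moves\<close>

text \<open>A virtual kink creates no chord. A classical one creates an isolated chord, because
  everything between its two parameters belongs to the one strand in the disc.\<close>

lemma diagram_invariant_move1:
  assumes DE: "virtual_diagram D" "virtual_diagram E"
    and m: "move1 T D E" and T: "T = classical_at \<or> T = virtual_at"
  shows "diagram_invariant E = diagram_invariant D"
proof -
  from m obtain a b s t where so: "same_outside_disc D E 1 a b" and inj: "inj_on (curve D) {a 0..b 0}"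
    and X: "{(u, v) \<in> strand_crossings (curve E) a b 0 0. u < v} = {(s, t)}" and Tst: "T E s t"
    unfolding move1_def by blast
  obtain c r where "local_move D E c r 1 a b" using same_outside_disc_local_move[OF DE so] by blast
  then interpret local_move D E c r 1 a b .
  have D0: "inner_chords D 1 a b = {}"
  proof -
    have False if "(u, v) \<in> inner_chords D 1 a b" for u v
      using that inj_onD[OF inj, of u v] unfolding D.inner_chord_iff
      by (auto simp: strand_crossings_def classical_at_def double_pt_def)
    then show ?thesis by auto
  qed
  have st: "s \<in> {a 0..b 0}" "t \<in> {a 0..b 0}" "s < t" "curve E s = curve E t"
    using X by (auto simp: strand_crossings_def)
  have E0: "(u, v) \<in> inner_chords E 1 a b \<longleftrightarrow> (u, v) \<in> {(s, t), (t, s)} \<and> classical_at E s t" for u v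
  proof
    assume "(u, v) \<in> inner_chords E 1 a b"
    then have uv: "(u, v) \<in> strand_crossings (curve E) a b 0 0" "classical_at E u v"
      unfolding E.inner_chord_iff by auto
    then have "u \<noteq> v" by (auto simp: classical_at_def double_pt_def)
    then consider "u < v" | "v < u" by linarith
    then show "(u, v) \<in> {(s, t), (t, s)} \<and> classical_at E s t"
    proof cases
      case 1
      then have "(u, v) \<in> {(u, v) \<in> strand_crossings (curve E) a b 0 0. u < v}" using uv by simp
      then show ?thesis using uv(2) unfolding X by simp
    next
      case 2
      then have "(v, u) \<in> {(u, v) \<in> strand_crossings (curve E) a b 0 0. u < v}" using uv
        by (auto simp: strand_crossings_def)
      then show ?thesis using uv(2) classical_at_sym[of E s t] unfolding X by auto
    qed
  next
    assume "(u, v) \<in> {(s, t), (t, s)} \<and> classical_at E s t"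
    then show "(u, v) \<in> inner_chords E 1 a b" unfolding E.inner_chord_iff
      using st classical_at_sym[of E s t] by (auto simp: strand_crossings_def)
  qed
  have alt: "alternating (outer_chords D 1 a b) (crossing_sign (curve E))"
    using E.alternating_outer unfolding outer_eq .
  show ?thesis
  proof (cases "classical_at E s t")
    case True
    then have "inner_chords E 1 a b = {(s, t), (t, s)}" using E0 by auto
    moreover have "gauss_invariant (outer_chords D 1 a b \<union> {(s, t), (t, s)}) (crossing_sign (curve E)) = gauss_invariant (outer_chords D 1 a b) (crossing_sign (curve E))"
    proof (rule gauss_invariant_add_isolated[OF alt st(3) crossing_sign_swap])
      show "p \<notin> {s..t}" if "(p, q) \<in> outer_chords D 1 a b" for p q
        using outer_points(1)[OF that] D.in_U[of 0 p] st by auto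
    qed
    ultimately show ?thesis unfolding diagram_invariant_D diagram_invariant_E D0 using outer_gauss_invariant by simp
  next
    case False
    then have "inner_chords E 1 a b = {}" using E0 by auto
    then show ?thesis unfolding diagram_invariant_D diagram_invariant_E D0 using outer_gauss_invariant by simp
  qed
qed

text \<open>For the classical move the signs must be shown to be opposite. The winding number about
  the closed-up strand 1 has the same values at the ends of strand 0 in both diagrams. In
  \<open>D\<close> it does not change along strand 0, so in \<open>E\<close> its two jumps add up to
  0.\<close>

lemma diagram_invariant_move2:
  assumes DE: "virtual_diagram D" "virtual_diagram E"
    and m: "move2 T D E" and T: "T = over \<or> T = virtual_at"
  shows "diagram_invariant E = diagram_invariant D"
proof -
  from m obtain a b where so: "same_outside_disc D E 2 a b"
    and inj: "\<And>i. i < 2 \<Longrightarrow> inj_on (curve D) {a i..b i}" "\<And>i. i < 2 \<Longrightarrow> inj_on (curve E) {a i..b i}"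
    and XD: "strand_crossings (curve D) a b 0 1 = {}" and XE: "card (strand_crossings (curve E) a b 0 1) = 2"
    and TE: "\<And>u v. (u, v) \<in> strand_crossings (curve E) a b 0 1 \<Longrightarrow> T E u v"
    unfolding move2_def by blast
  obtain c r where "local_move D E c r 2 a b" using same_outside_disc_local_move[OF DE so] by blast
  then interpret local_move D E c r 2 a b .
  have lt2: "i = 0 \<or> i = 1" if "i < 2" for i :: nat using that by auto
  obtain u1 v1 u2 v2 where uv: "strand_crossings (curve E) a b 0 1 = {(u1, v1), (u2, v2)}" "(u1, v1) \<noteq> (u2, v2)"
    using XE unfolding card_2_iff by (metis surj_pair)
  have mem: "u1 \<in> {a 0..b 0}" "u2 \<in> {a 0..b 0}" "v1 \<in> {a 1..b 1}" "v2 \<in> {a 1..b 1}"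
    "curve E u1 = curve E v1" "curve E u2 = curve E v2"
    using uv(1) unfolding strand_crossings_def by (auto simp: set_eq_iff)
  have uniq: "(u, v) = (u1, v1) \<or> (u, v) = (u2, v2)" if "u \<in> {a 0..b 0}" "v \<in> {a 1..b 1}" "curve E u = curve E v" for u v
    using uv(1) that unfolding strand_crossings_def by blast
  have noD: "curve D u \<noteq> curve D v" if "u \<in> {a 0..b 0}" "v \<in> {a 1..b 1}" for u v
    using XD that unfolding strand_crossings_def by blast
  have une: "u1 \<noteq> u2" "v1 \<noteq> v2"
    using uv(2) mem inj_onD[OF inj(2)[of 0], of u1 u2] inj_onD[OF inj(2)[of 1], of v1 v2] by auto
  have D0: "inner_chords D 2 a b = {}"
  proof -
    have False if uv: "(u, v) \<in> inner_chords D 2 a b" for u v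
    proof -
      obtain i j where ij: "i < 2" "j < 2" "u \<in> {a i..b i}" "v \<in> {a j..b j}" "curve D u = curve D v" "u \<noteq> v"
      proof -
        obtain i j where "i < 2" "j < 2" "(u, v) \<in> strand_crossings (curve D) a b i j" and cl: "classical_at D u v"
          using uv unfolding D.inner_chord_iff by blast
        moreover have "u \<noteq> v" using cl by (auto simp: classical_at_def double_pt_def)
        ultimately show ?thesis using that by (simp add: strand_crossings_def)
      qed
      then consider "i = j" | "i = 0" "j = 1" | "i = 1" "j = 0" using lt2[of i] lt2[of j] by blast
      then show False using ij noD[of u v] noD[of v u] inj_onD[OF inj(1), of i u v] by cases auto
    qed
    then show ?thesis by auto
  qed
  have E0: "(u, v) \<in> inner_chords E 2 a b \<longleftrightarrow>
      (u, v) \<in> {(u1, v1), (v1, u1), (u2, v2), (v2, u2)} \<and> classical_at E u v" for u v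
  proof
    assume uvE: "(u, v) \<in> inner_chords E 2 a b"
    then obtain i j where ij: "i < 2" "j < 2" "u \<in> {a i..b i}" "v \<in> {a j..b j}" "curve E u = curve E v" "u \<noteq> v"
    proof -
      obtain i j where "i < 2" "j < 2" "(u, v) \<in> strand_crossings (curve E) a b i j" and cl: "classical_at E u v"
        using uvE unfolding E.inner_chord_iff by blast
      moreover have "u \<noteq> v" using cl by (auto simp: classical_at_def double_pt_def)
      ultimately show ?thesis using that by (simp add: strand_crossings_def)
    qed
    then consider "i = j" | "i = 0" "j = 1" | "i = 1" "j = 0" using lt2[of i] lt2[of j] by blast
    then have "(u, v) \<in> {(u1, v1), (v1, u1), (u2, v2), (v2, u2)}"
      using ij uniq[of u v] uniq[of v u] inj_onD[OF inj(2), of i u v] by cases auto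
    then show "(u, v) \<in> {(u1, v1), (v1, u1), (u2, v2), (v2, u2)} \<and> classical_at E u v"
      using uvE unfolding E.inner_chord_iff by blast
  next
    have cr: "(u1, v1) \<in> strand_crossings (curve E) a b 0 1" "(u2, v2) \<in> strand_crossings (curve E) a b 0 1"
      using uv by auto
    then have cr': "(v1, u1) \<in> strand_crossings (curve E) a b 1 0" "(v2, u2) \<in> strand_crossings (curve E) a b 1 0"
      by (auto simp: strand_crossings_def)
    assume "(u, v) \<in> {(u1, v1), (v1, u1), (u2, v2), (v2, u2)} \<and> classical_at E u v"
    moreover have "(0::nat) < 2" "(1::nat) < 2" by simp_all
    ultimately show "(u, v) \<in> inner_chords E 2 a b" unfolding E.inner_chord_iff using cr cr' by blast
  qed
  have alt: "alternating (outer_chords D 2 a b) (crossing_sign (curve E))"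
    using E.alternating_outer unfolding outer_eq .
  show ?thesis
  proof (cases "T = over")
    case False
    then have "T = virtual_at" using T by simp
    then have "\<not> classical_at E u1 v1" "\<not> classical_at E u2 v2"
      using TE uv(1) by (auto simp: virtual_at_def classical_at_def)
    then have "inner_chords E 2 a b = {}"
      using E0 classical_at_sym[of E u1 v1] classical_at_sym[of E u2 v2] by auto
    then show ?thesis unfolding diagram_invariant_D diagram_invariant_E D0 by (simp add: outer_gauss_invariant)
  next
    case True
    have ov: "over E u1 v1" "over E u2 v2" using TE uv(1) True by auto
    then have cl: "classical_at E u1 v1" "classical_at E u2 v2"
      using DE(2) unfolding classical_at_def virtual_diagram_def by blast+
    have cl': "classical_at E v1 u1" "classical_at E v2 u2"
      using cl classical_at_sym[of E u1 v1] classical_at_sym[of E u2 v2] by blast+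
    have I: "inner_chords E 2 a b = {(u1, v1), (v1, u1), (u2, v2), (v2, u2)}"
    proof (intro set_eqI)
      fix p show "p \<in> inner_chords E 2 a b \<longleftrightarrow> p \<in> {(u1, v1), (v1, u1), (u2, v2), (v2, u2)}"
        using E0[of "fst p" "snd p"] cl cl' unfolding prod.collapse by (metis empty_iff insert_iff fst_conv snd_conv)
    qed
    have ab: "a 0 < b 0" "a 1 < b 1" using D.ab[of 0] D.ab[of 1] by auto
    have sub: "{a 0..b 0} \<subseteq> U - {a 1..b 1}" using D.in_U[of 0] D.disj[of 0 1] by auto
    \<comment> \<open>Ends of strands lie on the circle, and a point of strand 1 on the circle is
      one of its ends. Since the ends are common to both diagrams, a meeting there would already be
      a meeting in \<open>D\<close>.\<close>
    have endE: "curve E t \<notin> curve E ` {a 1..b 1}" if t: "t = a 0 \<or> t = b 0" for t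
    proof
      assume "curve E t \<in> curve E ` {a 1..b 1}"
      then obtain v where v: "v \<in> {a 1..b 1}" "curve E t = curve E v" by blast
      have "norm (curve E t - c) = r" "curve D t = curve E t"
        using t E.ends_sphere[of 0] ends_eq[of 0] by auto
      moreover from this v have "v = a 1 \<or> v = b 1" using E.sphere_ends[of 1 v] by simp
      then have "curve D v = curve E v" using ends_eq[of 1] by auto
      ultimately have "curve D t = curve D v" using v by simp
      moreover have "t \<in> {a 0..b 0}" using t ab by auto
      ultimately show False using noD v(1) by blast
    qed
    have intv: "v \<in> {a 1<..<b 1}" if "u \<in> {a 0..b 0}" "v \<in> {a 1..b 1}" "curve E u = curve E v" for u v
    proof -
      have "u \<noteq> a 0" "u \<noteq> b 0" using endE that by (metis imageI)+
      then have "norm (curve E v - c) < r" using E.interior[of 0 u] that by auto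
      then show ?thesis using E.ends_sphere[of 1] that(2) by (auto simp: less_eq_real_def)
    qed
    obtain F G m n where F: "D.crosses 1 F" and G: "E.crosses 1 G"
      and FG: "\<And>z. norm (z - c) = r \<Longrightarrow> z \<notin> curve D ` {a 1..b 1} \<Longrightarrow> F z = G z \<and> (F z = m \<or> F z = n)"
      by (rule strand_index[of 1]) (use inj in auto)
    have "F (curve D (b 0)) - F (curve D (a 0)) = of_real (sum (\<lambda>_. 0) {})"
      using F[unfolded D.crosses_def, rule_format, of "a 0" "b 0" "{}" "\<lambda>_. 0"] ab sub noD by fastforce
    moreover define g where "g u = crossing_sign (curve E) (if u = u1 then v1 else v2, u)" for u
    have "G (curve E (b 0)) - G (curve E (a 0)) = of_real (sum g {u1, u2})"
    proof (rule G[unfolded E.crosses_def, rule_format, OF ab(1) sub])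
      show X: "{u1, u2} = {u \<in> {a 0..b 0}. curve E u \<in> curve E ` {a 1..b 1}}"
      proof (intro equalityI subsetI)
        fix u assume "u \<in> {u1, u2}"
        then show "u \<in> {u \<in> {a 0..b 0}. curve E u \<in> curve E ` {a 1..b 1}}"
          using mem(1,2) imageI[OF mem(3), of "curve E"] imageI[OF mem(4), of "curve E"] mem(5,6) by auto
      next
        fix u assume "u \<in> {u \<in> {a 0..b 0}. curve E u \<in> curve E ` {a 1..b 1}}"
        then obtain v where "u \<in> {a 0..b 0}" "v \<in> {a 1..b 1}" "curve E u = curve E v" by blast
        then show "u \<in> {u1, u2}" using uniq[of u v] by blast
      qed
      show "a 0 \<notin> {u1, u2}" "b 0 \<notin> {u1, u2}" using endE unfolding X by auto
      show "\<exists>v\<in>{a 1<..<b 1}. curve E v = curve E u \<and> g u = crossing_sign (curve E) (v, u)" if "u \<in> {u1, u2}" for u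
      proof (cases "u = u1")
        case True
        then show ?thesis using mem(5) intv[OF mem(1,3,5)] by (intro bexI[of _ v1]) (simp_all add: g_def)
      next
        case False
        then have "u = u2" using that by simp
        then show ?thesis using mem(6) une intv[OF mem(2,4,6)] by (intro bexI[of _ v2]) (simp_all add: g_def)
      qed
    qed simp
    moreover have "F (curve D (a 0)) = G (curve D (a 0)) \<and> F (curve D (b 0)) = G (curve D (b 0))"
    proof -
      have "F (curve D t) = G (curve D t)" if "t = a 0 \<or> t = b 0" for t
      proof -
        have "t \<in> {a 0..b 0}" using that ab by auto
        then have "curve D t \<notin> curve D ` {a 1..b 1}" using noD[of t] by blast
        then show ?thesis using FG[of "curve D t"] D.ends_sphere[of 0] that by auto
      qed
      then show ?thesis by blast
    qed
    ultimately have "of_real (sum g {u1, u2}) = (0 :: complex)" using ends_eq[of 0]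
      by (simp del: of_real_sum) (metis of_real_eq_0_iff diff_self)
    then have "g u1 + g u2 = 0" using une unfolding of_real_eq_0_iff by simp
    then have "crossing_sign (curve E) (v1, u1) + crossing_sign (curve E) (v2, u2) = 0" using une by (simp add: g_def)
    then have s12: "crossing_sign (curve E) (u2, v2) = - crossing_sign (curve E) (u1, v1)"
      using crossing_sign_swap[of "curve E" v1 u1] crossing_sign_swap[of "curve E" v2 u2] by simp
    have "gauss_invariant (outer_chords D 2 a b \<union> {(u1, v1), (v1, u1), (u2, v2), (v2, u2)}) (crossing_sign (curve E)) = gauss_invariant (outer_chords D 2 a b) (crossing_sign (curve E))"
    proof (rule gauss_invariant_add_parallel[OF alt une crossing_sign_swap crossing_sign_swap s12])
      show "sgn (u1 - p) = sgn (u2 - p) \<and> sgn (v1 - p) = sgn (v2 - p) \<and> sgn (u1 - p) \<noteq> 0 \<and> sgn (v1 - p) \<noteq> 0"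
        if "(p, q) \<in> outer_chords D 2 a b" for p q
      proof -
        note o = sgn_outer[OF outer_points(1)[OF that]]
        have "sgn (u1 - p) = sgn (a 0 - p) \<and> a 0 \<noteq> p" "sgn (u2 - p) = sgn (a 0 - p)"
          "sgn (v1 - p) = sgn (a 1 - p) \<and> a 1 \<noteq> p" "sgn (v2 - p) = sgn (a 1 - p)"
          using o[of 0 u1] o[of 0 u2] o[of 1 v1] o[of 1 v2] mem by auto
        then show ?thesis by (simp add: sgn_zero_iff)
      qed
      show "sgn (u1 - v1) \<noteq> 0" "sgn (u1 - v2) = sgn (u1 - v1)" "sgn (u2 - v1) = sgn (u1 - v1)" "sgn (u2 - v2) = sgn (u1 - v1)"
        using sgn_inner[of 0 1 u1 v1] sgn_inner[of 0 1 u1 v2] sgn_inner[of 0 1 u2 v1] sgn_inner[of 0 1 u2 v2] mem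
        by (auto simp: sgn_zero_iff)
    qed
    then show ?thesis unfolding diagram_invariant_D diagram_invariant_E D0 I by (simp add: outer_gauss_invariant)
  qed
qed

section \<open>Three strands in a disc and third moves\<close>

locale triple = strands D c r 3 a b for D c r a b +
  fixes x :: "nat \<Rightarrow> nat \<Rightarrow> real"
  assumes inj: "i < 3 \<Longrightarrow> inj_on (curve D) {a i..b i}"
    and cross: "i < 3 \<Longrightarrow> j < 3 \<Longrightarrow> i \<noteq> j \<Longrightarrow> strand_crossings (curve D) a b i j = {(x i j, x j i)}"
begin

lemma x_mem: "i < 3 \<Longrightarrow> j < 3 \<Longrightarrow> i \<noteq> j \<Longrightarrow> x i j \<in> {a i..b i}"
  using cross[of i j] unfolding strand_crossings_def by blast

lemma x_meet: "i < 3 \<Longrightarrow> j < 3 \<Longrightarrow> i \<noteq> j \<Longrightarrow> curve D (x i j) = curve D (x j i)"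
  using cross[of i j] unfolding strand_crossings_def by blast

lemma x_uniq: "i < 3 \<Longrightarrow> j < 3 \<Longrightarrow> i \<noteq> j \<Longrightarrow> u \<in> {a i..b i} \<Longrightarrow> v \<in> {a j..b j} \<Longrightarrow> curve D u = curve D v \<Longrightarrow>
    u = x i j \<and> v = x j i"
  using cross[of i j] unfolding strand_crossings_def by blast

lemma x_double: "i < 3 \<Longrightarrow> j < 3 \<Longrightarrow> i \<noteq> j \<Longrightarrow> double_pt (curve D) (x i j) (x j i)"
  using double_inner[of i j "x i j" "x j i"] x_mem[of i j] x_mem[of j i] x_meet[of i j] disj[of i j]
  by (metis disjoint_iff)

text \<open>If strand \<open>i\<close> met both other strands at one parameter, that point would be
  a triple point of the curve.\<close>

lemma x_ne:
  assumes "i < 3" "j < 3" "k < 3" "i \<noteq> j" "j \<noteq> k" "i \<noteq> k"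
  shows "x i j \<noteq> x i k"
proof
  assume e: "x i j = x i k"
  then have "x j i - x k i \<in> \<int>"
    using no_triple[OF D, of "x j i" "x i j" "x k i"] x_double[of j i] x_double[of i k] assms by simp
  moreover have "curve D (x j i) = curve D (x k i)"
    using e x_meet[of j i] x_meet[of i k] assms by simp
  moreover have "x j i \<noteq> x k i" using disj[of j k] x_mem[of j i] x_mem[of k i] assms by (metis disjoint_iff)
  ultimately show False
    using double_inner[of j k "x j i" "x k i"] x_mem[of j i] x_mem[of k i] assms by (simp add: double_pt_def)
qed

lemma chord_mem:
  assumes P: "\<And>i j. i < 3 \<Longrightarrow> j < 3 \<Longrightarrow> i \<noteq> j \<Longrightarrow> over D (x i j) (x j i) = P i j"
  shows "inner_chords D 3 a b = {(x i j, x j i) |i j. i < 3 \<and> j < 3 \<and> i \<noteq> j \<and> (P i j \<or> P j i)}"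
proof (intro equalityI subsetI)
  fix p assume p: "p \<in> inner_chords D 3 a b"
  then obtain i j where ij: "i < 3" "j < 3" "p \<in> strand_crossings (curve D) a b i j" "classical_at D (fst p) (snd p)"
    by (cases p) (auto simp: inner_chord_iff)
  have "i \<noteq> j"
    using ij inj_onD[OF inj[of i], of "fst p" "snd p"] by (auto simp: strand_crossings_def classical_at_def double_pt_def)
  then have pp: "p = (x i j, x j i)" using ij cross by auto
  then have "P i j \<or> P j i" using ij(4) P[of i j] P[of j i] ij(1,2) \<open>i \<noteq> j\<close> by (auto simp: classical_at_def)
  then show "p \<in> {(x i j, x j i) |i j. i < 3 \<and> j < 3 \<and> i \<noteq> j \<and> (P i j \<or> P j i)}"
    using ij pp \<open>i \<noteq> j\<close> by blast
next
  fix p assume "p \<in> {(x i j, x j i) |i j. i < 3 \<and> j < 3 \<and> i \<noteq> j \<and> (P i j \<or> P j i)}"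
  then obtain i j where ij: "p = (x i j, x j i)" "i < 3" "j < 3" "i \<noteq> j" "P i j \<or> P j i" by blast
  then have "classical_at D (x i j) (x j i)"
    using x_double[of i j] P[of i j] P[of j i] unfolding classical_at_def by auto
  then show "p \<in> inner_chords D 3 a b" unfolding ij(1) inner_chord_iff using cross[of i j] ij(2-4) by blast
qed

end

text \<open>Crossings at strand ends are set apart since a winding number about a point of the loop
  carries no information. For third moves the condition is derived from the reversal of the crossing
  orders.\<close>

locale triple_interior = triple +
  assumes x_int: "i < 3 \<Longrightarrow> j < 3 \<Longrightarrow> i \<noteq> j \<Longrightarrow> x i j \<in> {a i<..<b i}"
begin

lemma end_off: "i < 3 \<Longrightarrow> j < 3 \<Longrightarrow> i \<noteq> j \<Longrightarrow> t = a i \<or> t = b i \<Longrightarrow> curve D t \<notin> curve D ` {a j..b j}"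
  using x_uniq[of i j t] x_int[of i j] ab[of i] by fastforce

lemma cross_part:
  assumes F: "crosses j F" and ij: "i < 3" "j < 3" "i \<noteq> j" and uv: "u < v" "{u..v} \<subseteq> {a i..b i}" "u \<noteq> x i j" "v \<noteq> x i j"
  shows "F (curve D v) - F (curve D u) = of_real (if x i j \<in> {u..v} then crossing_sign (curve D) (x j i, x i j) else 0)"
proof -
  define X where "X = (if x i j \<in> {u..v} then {x i j} else {})"
  have "F (curve D v) - F (curve D u) = of_real (sum (\<lambda>_. crossing_sign (curve D) (x j i, x i j)) X)"
  proof (rule F[unfolded crosses_def, rule_format, OF uv(1)])
    show "{u..v} \<subseteq> U - {a j..b j}" using uv(2) in_U[OF ij(1)] disj[OF ij] by blast
    show "X = {t \<in> {u..v}. curve D t \<in> curve D ` {a j..b j}}"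
    proof (intro equalityI subsetI)
      fix t assume "t \<in> X"
      then have "t = x i j" "t \<in> {u..v}" by (auto simp: X_def split: if_splits)
      then show "t \<in> {t \<in> {u..v}. curve D t \<in> curve D ` {a j..b j}}"
        using x_meet[OF ij] x_mem[of j i] ij by auto
    next
      fix t assume t: "t \<in> {t \<in> {u..v}. curve D t \<in> curve D ` {a j..b j}}"
      then have "t = x i j" using x_uniq[OF ij, of t] uv(2) by blast
      then show "t \<in> X" using t by (auto simp: X_def)
    qed
    show "finite X" "u \<notin> X" "v \<notin> X" using uv by (auto simp: X_def)
    show "\<exists>w\<in>{a j<..<b j}. curve D w = curve D t \<and> crossing_sign (curve D) (x j i, x i j) = crossing_sign (curve D) (w, t)"
      if "t \<in> X" for t
      using that x_int[of j i] x_meet[OF ij] ij by (intro bexI[of _ "x j i"]) (auto simp: X_def split: if_splits)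
  qed
  then show ?thesis by (simp add: X_def)
qed

lemma cross_full:
  assumes F: "crosses j F" and ij: "i < 3" "j < 3" "i \<noteq> j"
  shows "F (curve D (b i)) - F (curve D (a i)) = of_real (crossing_sign (curve D) (x j i, x i j))"
  using cross_part[OF F ij, of "a i" "b i"] x_int[OF ij] ab[of i] ij by auto

lemma sign_values: "i < 3 \<Longrightarrow> j < 3 \<Longrightarrow> i \<noteq> j \<Longrightarrow>
    crossing_sign (curve D) (x i j, x j i) = 1 \<or> crossing_sign (curve D) (x i j, x j i) = -1"
  using double_det[OF D x_double[of i j]] by (auto simp: crossing_sign_def sgn_if)

text \<open>Go along strand \<open>i\<close> from its first end to the crossing with strand
  \<open>j\<close>, then along \<open>j\<close> to its last end, and count crossings with strand
  \<open>k\<close>. On the circle the winding number about strand \<open>k\<close> has only two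
  values. If strands \<open>i\<close> and \<open>j\<close> cross \<open>k\<close> with the same
  sign, they jump between these values in the same direction, and exactly one of the two crossings
  lies on the route; if the signs differ, both lie on it or neither does.\<close>

lemma triangle_constraint:
  assumes F: "crosses k F" and ijk: "i < 3" "j < 3" "k < 3" "i \<noteq> j" "j \<noteq> k" "i \<noteq> k"
    and two: "\<And>z. norm (z - c) = r \<Longrightarrow> z \<notin> curve D ` {a k..b k} \<Longrightarrow> F z = m \<or> F z = n"
  shows "crossing_sign (curve D) (x i k, x k i) * sgn (x i k - x i j) =
    crossing_sign (curve D) (x j k, x k j) * sgn (x j k - x j i)"
proof -
  define s where "s = crossing_sign (curve D) (x k i, x i k)"
  define s' where "s' = crossing_sign (curve D) (x k j, x j k)"
  have ne: "x i k \<noteq> x i j" "x j k \<noteq> x j i" using x_ne[of i k j] x_ne[of j k i] ijk by auto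
  have s: "s = 1 \<or> s = -1" "s' = 1 \<or> s' = -1"
    using sign_values[of k i] sign_values[of k j] ijk by (auto simp: s_def s'_def)
  have two': "F (curve D t) = m \<or> F (curve D t) = n" if "t = a l \<or> t = b l" "l < 3" "l \<noteq> k" for t l
    using two[of "curve D t"] ends_sphere[of l] end_off[of l k t] that ijk by auto
  have 1: "F (curve D (b i)) - F (curve D (a i)) = of_real s" and 2: "F (curve D (b j)) - F (curve D (a j)) = of_real s'"
    using cross_full[OF F, of i] cross_full[OF F, of j] ijk by (auto simp: s_def s'_def)
  have 3: "F (curve D (x i j)) - F (curve D (a i)) = of_real (if x i k < x i j then s else 0)"
    using cross_part[OF F, of i "a i" "x i j"] x_int[of i j] x_int[of i k] ne ijk by (auto simp: s_def)
  have 4: "F (curve D (b j)) - F (curve D (x j i)) = of_real (if x j i < x j k then s' else 0)"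
    using cross_part[OF F, of j "x j i" "b j"] x_int[of j i] x_int[of j k] ne ijk by (auto simp: s'_def)
  have meet: "curve D (x j i) = curve D (x i j)" using x_meet[of j i] ijk by auto
  have sw: "crossing_sign (curve D) (x i k, x k i) = - s" "crossing_sign (curve D) (x j k, x k j) = - s'"
    unfolding s_def s'_def by (rule crossing_sign_swap)+
  have five: "F (curve D (b j)) - F (curve D (a i)) =
      of_real ((if x i k < x i j then s else 0) + (if x j i < x j k then s' else 0))"
  proof -
    have "F (curve D (b j)) - F (curve D (a i)) =
        (F (curve D (x i j)) - F (curve D (a i))) + (F (curve D (b j)) - F (curve D (x i j)))" by simp
    then show ?thesis unfolding 3 4[unfolded meet] of_real_add .
  qed
  have t4: "F (curve D (a i)) = m \<or> F (curve D (a i)) = n" "F (curve D (b i)) = m \<or> F (curve D (b i)) = n"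
     "F (curve D (a j)) = m \<or> F (curve D (a j)) = n" "F (curve D (b j)) = m \<or> F (curve D (b j)) = n"
    using two' ijk by auto
  show ?thesis unfolding sw
  proof (cases "s = s'")
    case True
    have "F (curve D (b j)) - F (curve D (a i)) = of_real s"
      using 1 2 t4 s True by (auto simp: algebra_simps)
    then have "(if x i k < x i j then s else 0) + (if x j i < x j k then s' else 0) = s"
      using five by (metis of_real_eq_iff)
    then show "- s * sgn (x i k - x i j) = - s' * sgn (x j k - x j i)"
      using s ne True by (auto simp: sgn_if split: if_splits)
  next
    case False
    then have "s' = - s" using s by auto
    then have "F (curve D (b j)) - F (curve D (a i)) = 0"
      using 1 2 t4 s by (auto simp: algebra_simps)
    then have "(if x i k < x i j then s else 0) + (if x j i < x j k then s' else 0) = 0"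
      using five by (metis of_real_eq_0_iff)
    then show "- s * sgn (x i k - x i j) = - s' * sgn (x j k - x j i)"
      using s ne \<open>s' = - s\<close> by (auto simp: sgn_if split: if_splits)
  qed
qed

end

text \<open>The three shapes of \<open>P\<close> leave all three inner chords, none, or only that of
  strands 1 and 2. In the last case the reversals along the strands involve virtual crossings, which
  the chord diagram does not see.\<close>

lemma diagram_invariant_move3:
  assumes DE: "virtual_diagram D" "virtual_diagram E" and m: "move3 P D E"
    and P: "P = (\<lambda>i j. i < j) \<or> P = (\<lambda>i j. False) \<or> P = (\<lambda>i j. i = 1 \<and> j = 2)"
  shows "diagram_invariant E = diagram_invariant D"
proof -
  from m obtain a b x y where so: "same_outside_disc D E 3 a b"
    and x: "triple_crossings P D a b x" and y: "triple_crossings P E a b y"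
    and ord: "\<And>i j k. i < 3 \<Longrightarrow> j < 3 \<Longrightarrow> k < 3 \<Longrightarrow> i \<noteq> j \<Longrightarrow> j \<noteq> k \<Longrightarrow> i \<noteq> k \<Longrightarrow> x i j < x i k \<longleftrightarrow> y i k < y i j"
    unfolding move3_def by blast
  obtain c r where "local_move D E c r 3 a b" using same_outside_disc_local_move[OF DE so] by blast
  then interpret local_move D E c r 3 a b .
  interpret TD: triple D c r a b x
    using x unfolding triple_crossings_def by unfold_locales blast+
  interpret TE: triple E c r a b y
    using y unfolding triple_crossings_def by unfold_locales blast+
  have third: "\<exists>k<3. k \<noteq> i \<and> k \<noteq> j" for i j :: nat
  proof -
    have "\<not> {..<3} \<subseteq> {i, j}"
    proof
      assume "{..<3} \<subseteq> {i, j}"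
      then have "card {..<3::nat} \<le> card {i, j}" by (intro card_mono) auto
      then show False using card_insert_le_m1[of 2 "{j}" i] by simp
    qed
    then show ?thesis by auto
  qed
  \<comment> \<open>A crossing at a strand end lies on the circle, so it is an end of the partner
    strand too. Such ends are shared by both diagrams.\<close>
  have same_end: "x i j = t \<longleftrightarrow> y i j = t" if ij: "i < 3" "j < 3" "i \<noteq> j" and t: "t = a i \<or> t = b i" for i j t
  proof -
    have tt: "t \<in> {a i..b i}" "norm (curve D t - c) = r" "norm (curve E t - c) = r" "curve D t = curve E t"
      using t ij D.ends_sphere[of i] E.ends_sphere[of i] ends_eq[of i] D.ab[of i] by auto
    show ?thesis
    proof
      assume xt: "x i j = t"
      have v: "x j i \<in> {a j..b j}" "curve D (x j i) = curve D t" using TD.x_mem[of j i] TD.x_meet[of j i] ij xt by auto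
      then have e: "x j i = a j \<or> x j i = b j" using D.sphere_ends[of j] ij tt by simp
      then have "curve D (x j i) = curve E (x j i)" using ends_eq[of j] ij by auto
      then show "y i j = t" using TE.x_uniq[OF ij, of t "x j i"] v tt by simp
    next
      assume xt: "y i j = t"
      have v: "y j i \<in> {a j..b j}" "curve E (y j i) = curve E t" using TE.x_mem[of j i] TE.x_meet[of j i] ij xt by auto
      then have e: "y j i = a j \<or> y j i = b j" using E.sphere_ends[of j] ij tt by simp
      then have "curve D (y j i) = curve E (y j i)" using ends_eq[of j] ij by auto
      then show "x i j = t" using TD.x_uniq[OF ij, of t "y j i"] v tt by simp
    qed
  qed
  \<comment> \<open>Such a crossing would be extreme on its strand before and after the move,
    against the reversal of its order with the crossing with the third strand.\<close>
  have not_end: "x i j \<noteq> a i" "x i j \<noteq> b i" if ij: "i < 3" "j < 3" "i \<noteq> j" for i j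
  proof -
    obtain k where k: "k < 3" "k \<noteq> i" "k \<noteq> j" using third by blast
    have xk: "x i k \<in> {a i..b i}" "y i k \<in> {a i..b i}" "x i j \<noteq> x i k"
      using TD.x_mem[of i k] TE.x_mem[of i k] TD.x_ne[of i j k] k ij by auto
    show "x i j \<noteq> a i"
    proof
      assume e: "x i j = a i"
      then have "y i j = a i" using same_end[OF ij] by simp
      then show False using ord[of i j k] xk e k ij by simp
    qed
    show "x i j \<noteq> b i"
    proof
      assume e: "x i j = b i"
      then have "y i j = b i" using same_end[OF ij] by simp
      then show False using ord[of i k j] xk e k ij by simp
    qed
  qed
  have not_end': "y i j \<noteq> a i" "y i j \<noteq> b i" if "i < 3" "j < 3" "i \<noteq> j" for i j
    using not_end[OF that] same_end[OF that] by blast+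
  have xint: "x i j \<in> {a i<..<b i}" if "i < 3" "j < 3" "i \<noteq> j" for i j
    using TD.x_mem[OF that] not_end[OF that] not_end[OF that, THEN not_sym] by (simp add: less_le)
  have yint: "y i j \<in> {a i<..<b i}" if "i < 3" "j < 3" "i \<noteq> j" for i j
    using TE.x_mem[OF that] not_end'[OF that] not_end'[OF that, THEN not_sym] by (simp add: less_le)
  interpret TD: triple_interior D c r a b x by unfold_locales (rule xint)
  interpret TE: triple_interior E c r a b y by unfold_locales (rule yint)
  \<comment> \<open>Along the whole of strand \<open>j\<close> the winding number about strand
    \<open>i\<close> changes by the sign of their crossing; the change is read off on the circle,
    where both diagrams give the same values.\<close>
  have sgn_eq: "crossing_sign (curve E) (y i j, y j i) = crossing_sign (curve D) (x i j, x j i)"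
    if ij: "i < 3" "j < 3" "i \<noteq> j" for i j
  proof -
    obtain F G m n where F: "D.crosses i F" and G: "E.crosses i G"
      and FG: "\<And>z. norm (z - c) = r \<Longrightarrow> z \<notin> curve D ` {a i..b i} \<Longrightarrow> F z = G z \<and> (F z = m \<or> F z = n)"
      by (rule strand_index[of i]) (use TD.inj TE.inj ij in auto)
    have "F (curve D (a j)) = G (curve D (a j))" "F (curve D (b j)) = G (curve D (b j))"
      using FG D.ends_sphere[of j] TD.end_off[of j i] ij by simp_all
    then have "complex_of_real (crossing_sign (curve D) (x i j, x j i)) = of_real (crossing_sign (curve E) (y i j, y j i))"
      using TD.cross_full[OF F, of j] TE.cross_full[OF G, of j] ends_eq[of j] ij by simp
    then show ?thesis by simp
  qed
  have constraint: "crossing_sign (curve D) (x i k, x k i) * sgn (x i k - x i j) =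
      crossing_sign (curve D) (x j k, x k j) * sgn (x j k - x j i)"
    if ijk: "i < 3" "j < 3" "k < 3" "i \<noteq> j" "j \<noteq> k" "i \<noteq> k" for i j k
  proof -
    obtain F G m n where F: "D.crosses k F"
      and FG: "\<And>z. norm (z - c) = r \<Longrightarrow> z \<notin> curve D ` {a k..b k} \<Longrightarrow> F z = G z \<and> (F z = m \<or> F z = n)"
      by (rule strand_index[of k]) (use TD.inj TE.inj ijk in auto)
    show ?thesis by (rule TD.triangle_constraint[OF F ijk, where m = m and n = n]) (use FG in blast)
  qed
  have PD: "over D (x i j) (x j i) = P i j" "over E (y i j) (y j i) = P i j" if "i < 3" "j < 3" "i \<noteq> j" for i j
    using x y that unfolding triple_crossings_def by blast+
  have ID: "inner_chords D 3 a b = {(x i j, x j i) |i j. i < 3 \<and> j < 3 \<and> i \<noteq> j \<and> (P i j \<or> P j i)}"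
    by (rule TD.chord_mem) (rule PD)
  have IE: "inner_chords E 3 a b = {(y i j, y j i) |i j. i < 3 \<and> j < 3 \<and> i \<noteq> j \<and> (P i j \<or> P j i)}"
    by (rule TE.chord_mem) (rule PD)
  have so_x: "sgn (x i j - p) = sgn (a i - p) \<and> sgn (y i j - p) = sgn (a i - p) \<and> a i \<noteq> p"
    if "p \<notin> U" "i < 3" "j < 3" "i \<noteq> j" for p i j
    using sgn_outer[OF that(1,2)] TD.x_mem[of i j] TE.x_mem[of i j] that by blast
  have si_x: "sgn (x i j - x i' j') = sgn (a i - a i') \<and> sgn (y i j - y i' j') = sgn (a i - a i') \<and> a i \<noteq> a i'"
    if "i < 3" "j < 3" "i \<noteq> j" "i' < 3" "j' < 3" "i' \<noteq> j'" "i \<noteq> i'" for i j i' j'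
    using sgn_inner[of i i'] TD.x_mem[of i j] TE.x_mem[of i j] TD.x_mem[of i' j'] TE.x_mem[of i' j'] that by blast
  consider "P = (\<lambda>i j. i < j)" | "P = (\<lambda>i j. False)" | "P = (\<lambda>i j. i = 1 \<and> j = 2)" using P by blast
  then show ?thesis
  proof cases
    case 1
    have I: "{(z i j, z j i) |i j. i < 3 \<and> j < 3 \<and> i \<noteq> j \<and> (P i j \<or> P j i)} =
      (\<lambda>p. (z (fst p) (snd p), z (snd p) (fst p))) ` {p \<in> {..<3} \<times> {..<3}. fst p \<noteq> snd p}"
      (is "?L = ?R") for z :: "nat \<Rightarrow> nat \<Rightarrow> real"
    proof (intro equalityI subsetI)
      fix p assume "p \<in> ?L"
      then obtain i j where "p = (z i j, z j i)" "i < 3" "j < 3" "i \<noteq> j" by blast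
      then show "p \<in> ?R" by (intro image_eqI[of _ _ "(i, j)"]) auto
    next
      fix p assume "p \<in> ?R"
      then obtain i j where "p = (z i j, z j i)" "i < 3" "j < 3" "i \<noteq> j" by auto
      moreover from this have "P i j \<or> P j i" unfolding 1 by auto
      ultimately show "p \<in> ?L" by blast
    qed
    show ?thesis unfolding diagram_invariant_D diagram_invariant_E ID IE I
    \<comment> \<open>The first end of a strand serves as its representative position.\<close>
    proof (rule gauss_invariant_triangle[where z = a and s = "\<lambda>i j. crossing_sign (curve D) (x i j, x j i)"])
      show "alternating (outer_chords D 3 a b) (crossing_sign (curve D))" by (rule D.alternating_outer)
      then show "finite (outer_chords D 3 a b)" by (simp add: alternating_def)
      show "sgn (y i j - y i k) = - sgn (x i j - x i k) \<and> x i j \<noteq> x i k"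
        if "i < 3" "j < 3" "k < 3" "i \<noteq> j" "j \<noteq> k" "i \<noteq> k" for i j k
        using ord[of i j k] ord[of i k j] TD.x_ne[of i j k] TE.x_ne[of i j k] that by (auto simp: sgn_if)
    qed (use outer_sign sgn_eq crossing_sign_swap so_x si_x outer_points(1) constraint in blast)+
  next
    case 2
    then show ?thesis unfolding diagram_invariant_D diagram_invariant_E ID IE by (simp add: outer_gauss_invariant)
  next
    case 3
    have I: "{(z i j, z j i) |i j. i < 3 \<and> j < 3 \<and> i \<noteq> j \<and> (P i j \<or> P j i)} = {(z 1 2, z 2 1), (z 2 1, z 1 2)}"
      (is "?L = ?R") for z :: "nat \<Rightarrow> nat \<Rightarrow> real"
    proof -
      have "?L = {(z i j, z j i) |i j. i = 1 \<and> j = 2 \<or> i = 2 \<and> j = 1}"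
        unfolding 3 by (rule Collect_cong, intro iff_exI) auto
      also have "\<dots> = ?R" by blast
      finally show ?thesis .
    qed
    define Q where "Q = outer_chords D 3 a b"
    \<comment> \<open>Only the two ends of the classical chord move, each within its own strand. No
      other chord ends on the strands, so the cyclic order is kept.\<close>
    define \<psi> where "\<psi> p = (if p = x 1 2 then y 1 2 else if p = x 2 1 then y 2 1 else p)" for p
    have ne: "x 1 2 \<noteq> x 2 1" using si_x[of 1 2 2 1] by (auto simp: sgn_zero_iff)
    have U12: "x 1 2 \<in> U" "x 2 1 \<in> U" using D.in_U[of 1] D.in_U[of 2] TD.x_mem[of 1 2] TD.x_mem[of 2 1] by auto
    have \<psi>: "\<psi> (x 1 2) = y 1 2" "\<psi> (x 2 1) = y 2 1" "p \<notin> U \<Longrightarrow> \<psi> p = p" for p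
      using ne U12 by (auto simp: \<psi>_def)
    define S where "S = insert (x 1 2) (insert (x 2 1) (- U))"
    have sg: "sgn (\<psi> p - \<psi> q) = sgn (p - q)" if "p \<in> S" "q \<in> S" for p q
    proof -
      have 1: "sgn (y 1 2 - t) = sgn (x 1 2 - t)" "sgn (y 2 1 - t) = sgn (x 2 1 - t)" if "t \<notin> U" for t
        using so_x[OF that, of 1 2] so_x[OF that, of 2 1] by auto
      have 2: "sgn (t - y 1 2) = sgn (t - x 1 2)" "sgn (t - y 2 1) = sgn (t - x 2 1)" if "t \<notin> U" for t
        using 1[OF that] sgn_sub_swap[of t] by metis+
      have 3: "sgn (y 1 2 - y 2 1) = sgn (x 1 2 - x 2 1)" "sgn (y 2 1 - y 1 2) = sgn (x 2 1 - x 1 2)"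
        using si_x[of 1 2 2 1] si_x[of 2 1 1 2] by auto
      show ?thesis using that 1 2 3 \<psi> by (auto simp: S_def)
    qed
    have inj: "inj_on \<psi> S" using sg by (intro inj_onI) (metis eq_iff_diff_eq_0 sgn_zero_iff)
    have im: "map_prod \<psi> \<psi> ` (Q \<union> {(x 1 2, x 2 1), (x 2 1, x 1 2)}) = Q \<union> {(y 1 2, y 2 1), (y 2 1, y 1 2)}"
    proof -
      have "map_prod \<psi> \<psi> p = p" if "p \<in> Q" for p
        using that outer_points[of "fst p" "snd p"] \<psi>(3) unfolding Q_def by (cases p) simp
      then have "map_prod \<psi> \<psi> ` Q = Q" by simp
      then show ?thesis using \<psi> by (simp add: image_Un)
    qed
    have "gauss_invariant (map_prod \<psi> \<psi> ` (Q \<union> {(x 1 2, x 2 1), (x 2 1, x 1 2)})) (crossing_sign (curve E)) =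
      gauss_invariant (Q \<union> {(x 1 2, x 2 1), (x 2 1, x 1 2)}) (crossing_sign (curve D))"
    proof (rule gauss_invariant_map[OF inj])
      show "Q \<union> {(x 1 2, x 2 1), (x 2 1, x 1 2)} \<subseteq> S \<times> S"
        using outer_points unfolding Q_def S_def by auto
      show "cyclic_sign (\<psi> s) (\<psi> t) (\<psi> u) = cyclic_sign s t u" if "s \<in> S" "t \<in> S" "u \<in> S" for s t u
        using sg that by (simp add: cyclic_sign_def)
      show "crossing_sign (curve E) (map_prod \<psi> \<psi> p) = crossing_sign (curve D) p"
        if p: "p \<in> Q \<union> {(x 1 2, x 2 1), (x 2 1, x 1 2)}" for p
      proof (cases "p \<in> Q")
        case True
        then show ?thesis
          using outer_sign outer_points[of "fst p" "snd p"] \<psi>(3) unfolding Q_def by (cases p) simp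
      next
        case False
        then show ?thesis using p sgn_eq[of 1 2] sgn_eq[of 2 1] \<psi> by auto
      qed
    qed
    then show ?thesis unfolding diagram_invariant_D diagram_invariant_E ID IE I Q_def[symmetric] im .
  qed
qed

lemma diagram_invariant_move: "virtual_move D E \<Longrightarrow> diagram_invariant E = diagram_invariant D"
  unfolding virtual_move_def reidemeister1_def reidemeister2_def reidemeister3_def
    virtual1_def virtual2_def virtual3_def mixed_def
  using diagram_invariant_isotopic diagram_invariant_move1[of D E classical_at] diagram_invariant_move1[of D E virtual_at]
    diagram_invariant_move2[of D E over] diagram_invariant_move2[of D E virtual_at]
    diagram_invariant_move3[of D E "\<lambda>i j. i < j"] diagram_invariant_move3[of D E "\<lambda>i j. False"] diagram_invariant_move3[of D E "\<lambda>i j. i = 1 \<and> j = 2"]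
  by blast

lemma diagram_invariant_equivalent: "virtually_equivalent D E \<Longrightarrow> diagram_invariant E = diagram_invariant D"
  unfolding virtually_equivalent_def
  by (induction rule: equivclp_induct) (auto simp: diagram_invariant_move)

section \<open>Classical diagrams\<close>

lemma not_Ints_near: "x \<noteq> y \<Longrightarrow> \<bar>x - y\<bar> < 1 \<Longrightarrow> x - y \<notin> \<int>" for x y :: real
proof
  assume "x \<noteq> y" "\<bar>x - y\<bar> < 1" "x - y \<in> \<int>"
  then obtain z where z: "x - y = of_int z" by (auto elim: Ints_cases)
  then have "\<bar>real_of_int z\<bar> < 1" using \<open>\<bar>x - y\<bar> < 1\<close> by linarith
  then have "z = 0" by linarith
  then show False using z \<open>x \<noteq> y\<close> by simp
qed

text \<open>The crossing splits the curve into the loop over \<open>{s..t}\<close> and the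
  complementary arc. The arc leaves the corner and returns to it with the same winding number about
  the loop, so the signs of its crossings with the loop add up to 0. The index is twice that sum,
  because crossings of either part with itself cancel.\<close>

lemma chord_index_classical:
  assumes D: "virtual_diagram D" and cl: "only_classical D" and st: "(s, t) \<in> chords D" "s < t"
  shows "chord_index (chords D) (crossing_sign (curve D)) (s, t) = 0"
proof -
  let ?\<gamma> = "curve D" and ?e = "crossing_sign (curve D)"
  have s01: "0 \<le> s" "t < 1" and dst: "double_pt ?\<gamma> s t" using st by (auto simp: chords_def classical_at_def)
  have loop: "?\<gamma> s = ?\<gamma> t" using dst by (simp add: double_pt_def)
  define Out where "Out = {0..<s} \<union> {t<..<1}"
  define A where "A = {(p, q) \<in> chords D. p \<in> {s<..<t} \<and> q \<in> Out}"
  \<comment> \<open>Here the absence of virtual crossings enters: every double point of the curve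
    counts as a chord.\<close>
  have ch: "(p, q) \<in> chords D \<longleftrightarrow> p \<in> {0..<1} \<and> q \<in> {0..<1} \<and> p \<noteq> q \<and> ?\<gamma> p = ?\<gamma> q" for p q
  proof
    assume r: "p \<in> {0..<1} \<and> q \<in> {0..<1} \<and> p \<noteq> q \<and> ?\<gamma> p = ?\<gamma> q"
    then have "p - q \<notin> \<int>" by (intro not_Ints_near) auto
    then have "double_pt ?\<gamma> p q" using r by (simp add: double_pt_def)
    then show "(p, q) \<in> chords D" using cl r unfolding only_classical_def chords_def by blast
  qed (auto simp: chords_def classical_at_def double_pt_def)
  have triple: "p = p'" if "(p, q) \<in> chords D" "(q, p') \<in> chords D" for p q p'
  proof (rule ccontr)
    assume "p \<noteq> p'"
    then have "p - p' \<notin> \<int>" using that unfolding ch by (intro not_Ints_near) auto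
    moreover have "p - p' \<in> \<int>" using no_triple[OF D, of p q p'] that by (auto simp: chords_def classical_at_def)
    ultimately show False by simp
  qed
  have alt: "alternating (chords D) ?e" by (rule alternating_chords[OF D])
  have sym: "(q, p) \<in> chords D" if "(p, q) \<in> chords D" for p q using that unfolding ch by auto
  have cy: "cyclic_sign s t p = (if p \<in> {s<..<t} then 1 else if p = s \<or> p = t then 0 else -1)" for p
    using st(2) by (auto simp: cyclic_sign_def sgn_if)
  \<comment> \<open>Subtracting twice the indicator of \<open>A\<close> makes the chord function
    symmetric under the swap: a crossing between loop and arc gets -1 at both ends instead of 1 and
    -1. The symmetric remainder has signed sum 0.\<close>
  have "(\<Sum>p\<in>chords D. ?e p * (cyclic_sign s t (fst p) - 2 * of_bool (p \<in> A))) = 0"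
  proof (rule sum_alternating[OF alt])
    fix p q assume pq: "(p, q) \<in> chords D"
    have e: "?e (q, p) = - ?e (p, q)" by (rule crossing_sign_swap)
    have ends: "p = s \<Longrightarrow> q = t" "p = t \<Longrightarrow> q = s" "q = s \<Longrightarrow> p = t" "q = t \<Longrightarrow> p = s"
      using triple[of t s q] triple[of s t q] triple[of p s t] triple[of p t s] pq st(1) sym[OF st(1)] by blast+
    have in_out: "p \<in> {s<..<t} \<or> p = s \<or> p = t \<or> p \<in> Out" "q \<in> {s<..<t} \<or> q = s \<or> q = t \<or> q \<in> Out"
      using pq unfolding ch Out_def by auto
    have "cyclic_sign s t q - 2 * of_bool ((q, p) \<in> A) = cyclic_sign s t p - 2 * of_bool ((p, q) \<in> A)"
    proof -
      define I where "I = {s<..<t}"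
      have inA: "(p, q) \<in> A \<longleftrightarrow> p \<in> I \<and> q \<in> Out" "(q, p) \<in> A \<longleftrightarrow> q \<in> I \<and> p \<in> Out"
        using pq sym[OF pq] by (simp_all add: A_def I_def)
      have cO: "x \<in> Out \<Longrightarrow> cyclic_sign s t x = -1 \<and> x \<notin> I" and cI: "x \<in> I \<Longrightarrow> cyclic_sign s t x = 1 \<and> x \<notin> Out" for x
        using st(2) unfolding cy Out_def I_def by auto
      have e0: "s \<notin> Out" "t \<notin> Out" "s \<notin> I" "t \<notin> I" using st(2) by (auto simp: Out_def I_def)
      consider "p = s" "q = t" | "p = t" "q = s" | "p \<in> I" "q \<in> I" | "p \<in> I" "q \<in> Out"
        | "p \<in> Out" "q \<in> I" | "p \<in> Out" "q \<in> Out" using ends in_out unfolding I_def by blast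
      then show ?thesis unfolding inA
        by cases (use cO[of p] cO[of q] cI[of p] cI[of q] e0 in simp_all)
    qed
    then show "?e (q, p) * (cyclic_sign s t (fst (q, p)) - 2 * of_bool ((q, p) \<in> A)) =
        - (?e (p, q) * (cyclic_sign s t (fst (p, q)) - 2 * of_bool ((p, q) \<in> A)))"
      unfolding e by simp
  qed
  then have "chord_index (chords D) ?e (s, t) = 2 * (\<Sum>p\<in>chords D. ?e p * of_bool (p \<in> A))"
    by (simp add: chord_index_def right_diff_distrib sum_subtractf sum_distrib_left mult_ac)
  also have "(\<Sum>p\<in>chords D. ?e p * of_bool (p \<in> A)) = sum ?e A"
  proof -
    have "A = chords D \<inter> A" by (auto simp: A_def)
    then have "sum ?e A = sum ?e (chords D \<inter> A)" by simp
    also have "\<dots> = (\<Sum>p\<in>chords D. if p \<in> A then ?e p else 0)" by (rule sum.inter_restrict[OF finite_chords[OF D]])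
    also have "\<dots> = (\<Sum>p\<in>chords D. ?e p * of_bool (p \<in> A))" by (rule sum.cong) simp_all
    finally show ?thesis by simp
  qed
  finally have idx: "chord_index (chords D) ?e (s, t) = 2 * sum ?e A" .

  obtain \<delta>0 where \<delta>0: "0 < \<delta>0" "\<And>\<delta>. 0 < \<delta> \<Longrightarrow> \<delta> < \<delta>0 \<Longrightarrow>
      ?\<gamma> (t + \<delta>) \<notin> ?\<gamma> ` {s..t} \<and> ?\<gamma> (s - \<delta>) \<notin> ?\<gamma> ` {s..t} \<and>
      winding_number (subpath s t ?\<gamma>) (?\<gamma> (t + \<delta>)) = winding_number (subpath s t ?\<gamma>) (?\<gamma> (s - \<delta>))"
  proof (rule winding_number_corner[OF st(2) curve_continuous[OF D] loop _ curve_deriv[OF D] curve_deriv[OF D] double_det[OF D dst]])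
    show "u = s \<or> u = t" if "u \<in> {s..t}" "?\<gamma> u = ?\<gamma> t" for u
    proof (rule ccontr)
      assume "\<not> ?thesis"
      then have "(u, t) \<in> chords D" using that s01 unfolding ch by auto
      then show False using triple[OF _ sym[OF st(1)]] \<open>\<not> _\<close> by blast
    qed
  qed blast
  define \<delta> where "\<delta> = min (\<delta>0 / 2) ((s + 1 - t) / 4)"
  have "\<delta> \<le> (s + 1 - t) / 4" unfolding \<delta>_def by (rule min.cobounded2)
  then have "4 * \<delta> \<le> s + 1 - t" by simp
  moreover have "0 < \<delta>" "\<delta> \<le> \<delta>0 / 2" using \<delta>0(1) s01 st(2) by (simp_all add: \<delta>_def)
  ultimately have \<delta>: "0 < \<delta>" "\<delta> < \<delta>0" "t + \<delta> < s + 1 - \<delta>" by - linarith+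
  have per: "?\<gamma> (q + 1) = ?\<gamma> q" "velocity ?\<gamma> (q + 1) = velocity ?\<gamma> q" for q
    using curve_period[OF D, of q 1] velocity_period[OF D, of q 1] by simp_all
  \<comment> \<open>The complementary arc is unrolled to the interval from \<open>t\<close> to
    \<open>s + 1\<close>, so that passing the base point needs no case distinction; ends before
    \<open>s\<close> are shifted by a period.\<close>
  define g where "g p = (if t < snd p then snd p else snd p + 1)" for p :: "real \<times> real"
  define L where "L = subpath s t ?\<gamma>"
  have L: "path L" "pathfinish L = pathstart L" "path_image L = ?\<gamma> ` {s..t}"
    using path_subpath_cont[OF curve_continuous[OF D] st(2)] loop st(2) by (simp_all add: L_def path_image_subpath)
  have gA: "t < g (p, q) \<and> g (p, q) < s + 1 \<and> ?\<gamma> (g (p, q)) = ?\<gamma> p \<and> velocity ?\<gamma> (g (p, q)) = velocity ?\<gamma> q"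
    if "(p, q) \<in> A" for p q
    using that s01 st(2) per unfolding A_def ch Out_def g_def by auto
  have inj: "inj_on g A"
  proof (rule inj_onI)
    fix c d assume cd: "c \<in> A" "d \<in> A" "g c = g d"
    then have "snd c = snd d" using s01 st(2) by (auto simp: A_def g_def Out_def split: if_splits)
    moreover from this have "fst c = fst d"
      using triple[of "fst c" "snd c" "fst d"] sym cd(1,2) unfolding A_def by (auto split: prod.splits)
    ultimately show "c = d" by (simp add: prod_eq_iff)
  qed
  have preim: "\<exists>p q. (p, q) \<in> A \<and> g (p, q) = x" if x: "t < x" "x < s + 1" "?\<gamma> x \<in> ?\<gamma> ` {s..t}" for x
  proof -
    obtain u where u: "u \<in> {s..t}" "?\<gamma> x = ?\<gamma> u" using x(3) by blast
    define q where "q = (if x < 1 then x else x - 1)"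
    have q: "q \<in> Out" "?\<gamma> q = ?\<gamma> x" using x per(1)[of "x - 1"] by (auto simp: q_def Out_def)
    then have q01: "q \<in> {0..<1}" "q \<notin> {s..t}" using s01 st(2) by (auto simp: Out_def)
    then have uq: "(u, q) \<in> chords D" using u q(2) s01 unfolding ch by auto
    have "s \<noteq> q" "t \<noteq> q" using q01(2) st(2) by auto
    then have "u \<noteq> s" "u \<noteq> t" using triple[of t s q] triple[of s t q] uq st(1) sym[OF st(1)] by blast+
    then have "(u, q) \<in> A" using uq u(1) q(1) by (auto simp: A_def)
    moreover have "g (u, q) = x" using x st(2) by (auto simp: g_def q_def)
    ultimately show ?thesis by blast
  qed
  have X: "{x \<in> {t + \<delta>..s + 1 - \<delta>}. ?\<gamma> x \<in> path_image L} = g ` A"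
  proof (intro equalityI subsetI)
    fix x assume "x \<in> {x \<in> {t + \<delta>..s + 1 - \<delta>}. ?\<gamma> x \<in> path_image L}"
    then have "\<exists>p q. (p, q) \<in> A \<and> g (p, q) = x" using \<delta>(1) unfolding L(3) by (intro preim) auto
    then show "x \<in> g ` A" by force
  next
    fix x assume "x \<in> g ` A"
    then obtain p q where pq: "(p, q) \<in> A" "x = g (p, q)" by auto
    have p: "p \<in> {s..t}" using pq(1) by (auto simp: A_def)
    have x: "t < x" "x < s + 1" "?\<gamma> x = ?\<gamma> p" using gA[OF pq(1)] pq(2) by auto
    have "\<not> x < t + \<delta>" using \<delta>0(2)[of "x - t"] \<delta> x p by auto
    moreover have "\<not> s + 1 - \<delta> < x"
    proof
      assume "s + 1 - \<delta> < x"
      then have "?\<gamma> (x - 1) \<notin> ?\<gamma> ` {s..t}" using \<delta>0(2)[of "s - (x - 1)"] \<delta> x by auto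
      moreover have "?\<gamma> (x - 1) = ?\<gamma> p" using per(1)[of "x - 1"] x(3) by simp
      ultimately show False using p by (metis imageI)
    qed
    ultimately show "x \<in> {x \<in> {t + \<delta>..s + 1 - \<delta>}. ?\<gamma> x \<in> path_image L}"
      using x p unfolding L(3) by auto
  qed
  have finA: "finite A" by (rule finite_subset[OF _ finite_chords[OF D]]) (auto simp: A_def)
  define j where "j x = ?e (inv_into A g x)" for x
  have jg: "j (g c) = ?e c" if "c \<in> A" for c using inv_into_f_f[OF inj that] by (simp add: j_def)
  have "winding_number L (?\<gamma> (s + 1 - \<delta>)) - winding_number L (?\<gamma> (t + \<delta>)) =
      of_real (\<Sum>x | x \<in> {t + \<delta>..s + 1 - \<delta>} \<and> ?\<gamma> x \<in> path_image L. j x)"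
  proof (rule winding_number_crossings[OF L(1,2) curve_continuous[OF D] \<delta>(3)])
    show "finite {x \<in> {t + \<delta>..s + 1 - \<delta>}. ?\<gamma> x \<in> path_image L}" unfolding X using finA by simp
    show "?\<gamma> (t + \<delta>) \<notin> path_image L" "?\<gamma> (s + 1 - \<delta>) \<notin> path_image L"
      using \<delta>0(2)[OF \<delta>(1,2)] per(1)[of "s - \<delta>"] unfolding L(3) by (simp_all add: algebra_simps)
    fix x assume "x \<in> {t + \<delta>..s + 1 - \<delta>}" "?\<gamma> x \<in> path_image L"
    then have "x \<in> g ` A" using X by blast
    then obtain p q where pq: "(p, q) \<in> A" "x = g (p, q)" by auto
    have gx: "?\<gamma> x = ?\<gamma> p" "velocity ?\<gamma> x = velocity ?\<gamma> q" using gA[OF pq(1)] pq(2) by auto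
    have p: "p \<in> {s<..<t}" "(p, q) \<in> chords D" "q \<in> Out" using pq(1) by (auto simp: A_def)
    define w where "w = (p - s) / (t - s)"
    have w: "0 < w" "w < 1" "(t - s) * w + s = p" using p st(2) by (auto simp: w_def field_simps)
    have uniq: "L w' = ?\<gamma> x \<longleftrightarrow> w' = w" if w': "w' \<in> {0..1}" for w'
    proof
      assume Lw: "L w' = ?\<gamma> x"
      define u where "u = (t - s) * w' + s"
      have "0 \<le> (t - s) * w'" "(t - s) * w' \<le> (t - s) * 1"
        using w' st(2) by (auto intro!: mult_left_mono)
      then have u: "u \<in> {s..t}" by (auto simp: u_def)
      have "?\<gamma> u = ?\<gamma> q" using Lw gx p(2) unfolding ch by (simp add: L_def subpath_def u_def)
      then have "(u, q) \<in> chords D" using u p s01 st(2) unfolding ch Out_def by auto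
      then have "u = p" using triple[OF _ sym[OF p(2)]] by blast
      then have "(t - s) * w' = (t - s) * w" using w(3) unfolding u_def by linarith
      then show "w' = w" using st(2) by simp
    next
      assume "w' = w" then show "L w' = ?\<gamma> x" using w(3) gx by (simp add: L_def subpath_def)
    qed
    have "((?\<gamma> \<circ> (\<lambda>w. (t - s) * w + s)) has_vector_derivative (t - s) *\<^sub>R velocity ?\<gamma> ((t - s) * w + s)) (at w)"
      by (rule vector_diff_chain_at[OF _ curve_deriv[OF D]]) (auto intro!: derivative_eq_intros)
    then have dL: "(L has_vector_derivative (t - s) *\<^sub>R velocity ?\<gamma> p) (at w)"
      unfolding w(3) by (simp add: L_def subpath_def o_def)
    have "double_pt ?\<gamma> p q" using p(2) by (simp add: chords_def classical_at_def)
    then have det: "det2 (velocity ?\<gamma> p) (velocity ?\<gamma> q) \<noteq> 0" by (rule double_det[OF D])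
    have d: "det2 ((t - s) *\<^sub>R velocity ?\<gamma> p) (velocity ?\<gamma> x) = (t - s) * det2 (velocity ?\<gamma> p) (velocity ?\<gamma> q)"
      unfolding gx by (simp add: det2_eq algebra_simps)
    have jx: "j x = sgn (det2 (velocity ?\<gamma> p) (velocity ?\<gamma> q))"
      using jg[OF pq(1)] unfolding pq(2) by (simp add: crossing_sign_def)
    show "\<exists>w v' d. 0 < w \<and> w < 1 \<and> (\<forall>u'\<in>{0..1}. L u' = ?\<gamma> x \<longleftrightarrow> u' = w) \<and>
        (L has_vector_derivative v') (at w) \<and> (?\<gamma> has_vector_derivative d) (at x) \<and>
        det2 v' d \<noteq> 0 \<and> sgn (det2 v' d) = j x"
      by (rule exI[of _ w], rule exI[of _ "(t - s) *\<^sub>R velocity ?\<gamma> p"], rule exI[of _ "velocity ?\<gamma> x"])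
        (use w uniq dL curve_deriv[OF D] d det jx st(2) in \<open>simp add: sgn_mult\<close>)
  qed
  \<comment> \<open>Up to a period the right end of the interval is \<open>s - \<delta>\<close>, so
    the property of the corner compares exactly these two points.\<close>
  moreover have "winding_number L (?\<gamma> (s + 1 - \<delta>)) = winding_number L (?\<gamma> (t + \<delta>))"
    using \<delta>0(2)[OF \<delta>(1,2)] per(1)[of "s - \<delta>"] unfolding L_def by (simp add: algebra_simps)
  ultimately have "complex_of_real (sum j (g ` A)) = 0" unfolding X by (simp del: of_real_sum)
  then have "sum j (g ` A) = 0" unfolding of_real_eq_0_iff .
  moreover have "sum j (g ` A) = sum ?e A" using jg by (subst sum.reindex[OF inj]) simp
  ultimately show ?thesis unfolding idx by simp
qed

lemma diagram_invariant_only_classical: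
  assumes D: "virtual_diagram D" and cl: "only_classical D"
  shows "diagram_invariant D = 0"
proof -
  have "chord_index (chords D) (crossing_sign (curve D)) c = 0" if c: "c \<in> chords D" for c
  proof -
    obtain s t where st: "c = (s, t)" by (cases c)
    have ts: "(t, s) \<in> chords D" using alternating_chords[OF D] c st by (auto simp: alternating_def)
    consider "s < t" | "t < s" using c st by (force simp: chords_def classical_at_def double_pt_def)
    then show ?thesis
    proof cases
      case 1 then show ?thesis using chord_index_classical[OF D cl] c st by blast
    next
      case 2
      have "chord_index (chords D) (crossing_sign (curve D)) (s, t) = - chord_index (chords D) (crossing_sign (curve D)) (t, s)"
        unfolding chord_index_def by (simp add: cyclic_sign_swap[of s t] sum_negf)
      then show ?thesis using chord_index_classical[OF D cl ts 2] st by simp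
    qed
  qed
  then show ?thesis by (simp add: diagram_invariant_def gauss_invariant_def)
qed

section \<open>The Kishino diagram\<close>

text \<open>
  The eight semicircles in the order in which they are traversed: semicircle \<open>k\<close> is run through while
  \<open>21 * frac t\<close> is between \<open>breakpoint k\<close> and \<open>breakpoint (k + 1)\<close>, from left to right iff \<open>direction k = 1\<close>, and it
  is an upper one iff \<open>side k = 1\<close>.
\<close>

definition breakpoint :: "nat \<Rightarrow> real" where "breakpoint k = [0, 2, 3, 5, 13/2, 9, 27/2, 17, 21] ! k"
definition center :: "nat \<Rightarrow> real" where "center k = [1, 5/2, 2, 7/4, 15/4, 11/4, 9/4, 2] ! k"
definition radius :: "nat \<Rightarrow> real" where "radius k = [1, 1/2, 1, 3/4, 5/4, 9/4, 7/4, 2] ! k"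
definition direction :: "nat \<Rightarrow> real" where "direction k = [1, 1, -1, 1, 1, -1, 1, -1] ! k"
definition side :: "nat \<Rightarrow> real" where "side k = [-1, 1, -1, 1, -1, 1, -1, 1] ! k"

lemmas tables = breakpoint_def center_def radius_def direction_def side_def

definition piece :: "real \<Rightarrow> nat" where
  "piece x = (if x < 2 then 0 else if x < 3 then 1 else if x < 5 then 2 else if x < 13/2 then 3
     else if x < 9 then 4 else if x < 27/2 then 5 else if x < 17 then 6 else 7)"

definition angle :: "nat \<Rightarrow> real \<Rightarrow> real" where
  "angle k x = pi * (x - breakpoint k) / (2 * radius k)"

definition semicircle :: "nat \<Rightarrow> real \<Rightarrow> complex" where
  "semicircle k x = Complex (center k - direction k * radius k * cos (angle k x)) (side k * radius k * sin (angle k x))"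

definition arc_velocity :: "nat \<Rightarrow> real \<Rightarrow> complex" where
  "arc_velocity k x = Complex (pi / 2 * direction k * sin (angle k x)) (pi / 2 * side k * cos (angle k x))"

section \<open>Smoothness of the Kishino curve\<close>

lemma less8: "k < 8 \<longleftrightarrow> k = 0 \<or> k = 1 \<or> k = 2 \<or> k = 3 \<or> k = 4 \<or> k = 5 \<or> k = 6 \<or> k = (7::nat)"
  by auto

lemma kishino_curve_arc: "kishino_curve t = semicircle (piece (21 * frac t)) (21 * frac t)"
proof -
  define x where "x = 21 * frac t"
  have "lower_arc 0 2 (x / 2) = semicircle 0 x" "upper_arc 2 3 (x - 2) = semicircle 1 x"
    "lower_arc 3 1 ((x - 3) / 2) = semicircle 2 x" "upper_arc 1 (5/2) ((x - 5) / (3/2)) = semicircle 3 x"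
    "lower_arc (5/2) 5 ((x - 13/2) / (5/2)) = semicircle 4 x" "upper_arc 5 (1/2) ((x - 9) / (9/2)) = semicircle 5 x"
    "lower_arc (1/2) 4 ((x - 27/2) / (7/2)) = semicircle 6 x" "upper_arc 4 0 ((x - 17) / 4) = semicircle 7 x"
    by (simp_all add: lower_arc_def upper_arc_def semicircle_def angle_def tables) (simp_all add: algebra_simps)
  then show ?thesis unfolding kishino_curve_def Let_def x_def[symmetric] piece_def by simp
qed

lemma piece_range:
  assumes "0 \<le> x" "x < 21"
  shows "piece x < 8" "breakpoint (piece x) \<le> x" "x < breakpoint (piece x + 1)"
  using assms by (auto simp: piece_def breakpoint_def)

lemma piece_eq: "k < 8 \<Longrightarrow> breakpoint k \<le> x \<Longrightarrow> x < breakpoint (k + 1) \<Longrightarrow> piece x = k"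
  unfolding less8 by (auto simp: piece_def breakpoint_def)

lemma breakpoint_mono: "k < 8 \<Longrightarrow> 0 \<le> breakpoint k \<and> breakpoint k < breakpoint (k + 1) \<and> breakpoint (k + 1) \<le> 21 \<and> breakpoint (k + 1) = breakpoint k + 2 * radius k \<and> 0 < radius k"
  unfolding less8 by (auto simp: tables)

lemma direction_side: "k < 8 \<Longrightarrow> direction k * direction k = 1 \<and> side k * side k = 1"
  unfolding less8 by (auto simp: tables)

lemma angle_range:
  assumes "k < 8" "breakpoint k \<le> x" "x < breakpoint (k + 1)" shows "0 \<le> angle k x" "angle k x < pi"
proof -
  have r: "0 < radius k" "x - breakpoint k < 2 * radius k" using breakpoint_mono[OF assms(1)] assms by auto
  then show "0 \<le> angle k x" using assms by (simp add: angle_def)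
  have "(x - breakpoint k) / (2 * radius k) < 1" using r by simp
  then have "pi * ((x - breakpoint k) / (2 * radius k)) < pi * 1" by (intro mult_strict_left_mono) auto
  then show "angle k x < pi" by (simp add: angle_def)
qed

lemma arc_deriv:
  assumes "k < 8" shows "(semicircle k has_vector_derivative arc_velocity k x) (at x)"
proof -
  have r: "0 < radius k" using breakpoint_mono[OF assms] by simp
  have "((\<lambda>x. angle k x) has_real_derivative pi / (2 * radius k)) (at x)"
    unfolding angle_def using r by (auto intro!: derivative_eq_intros)
  then have "((\<lambda>x. center k - direction k * radius k * cos (angle k x)) has_real_derivative pi / 2 * direction k * sin (angle k x)) (at x)"
    "((\<lambda>x. side k * radius k * sin (angle k x)) has_real_derivative pi / 2 * side k * cos (angle k x)) (at x)"
    using r by (auto intro!: derivative_eq_intros)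
  then show ?thesis
    unfolding has_vector_derivative_complex_iff semicircle_def arc_velocity_def by simp
qed

lemma arc_velocity_continuous: "continuous_on S (arc_velocity k)"
proof -
  have "angle k = (\<lambda>x. pi / (2 * radius k) * (x - breakpoint k))" by (simp add: angle_def fun_eq_iff)
  then show ?thesis unfolding arc_velocity_def by (simp only:) (intro continuous_intros)
qed

text \<open>All semicircles end on the real axis with vertical tangents and share the speed \<pi>/2.
  Upper and lower ones alternate, so one is left in the vertical direction in which the next
  begins.\<close>

lemma arc_joint: "k < 7 \<Longrightarrow> semicircle k (breakpoint (k + 1)) = semicircle (k + 1) (breakpoint (k + 1)) \<and>
    arc_velocity k (breakpoint (k + 1)) = arc_velocity (k + 1) (breakpoint (k + 1))"
  and arc_joint0: "semicircle 7 21 = semicircle 0 0 \<and> arc_velocity 7 21 = arc_velocity 0 0"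
proof -
  assume "k < 7"
  then have "k = 0 \<or> k = 1 \<or> k = 2 \<or> k = 3 \<or> k = 4 \<or> k = 5 \<or> k = 6" by auto
  then show "semicircle k (breakpoint (k + 1)) = semicircle (k + 1) (breakpoint (k + 1)) \<and>
    arc_velocity k (breakpoint (k + 1)) = arc_velocity (k + 1) (breakpoint (k + 1))"
    by (elim disjE) (simp_all add: semicircle_def arc_velocity_def angle_def tables)
qed (simp add: semicircle_def arc_velocity_def angle_def tables)

definition kishino_tangent :: "real \<Rightarrow> complex" where
  "kishino_tangent t = 21 *\<^sub>R arc_velocity (piece (21 * frac t)) (21 * frac t)"

lemma kishino_at:
  assumes "k < 8" "breakpoint k \<le> 21 * t - 21 * of_int n" "21 * t - 21 * of_int n < breakpoint (k + 1)"
  shows "kishino_curve t = semicircle k (21 * t - 21 * of_int n)" "kishino_tangent t = 21 *\<^sub>R arc_velocity k (21 * t - 21 * of_int n)"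
    "21 * frac t = 21 * t - 21 * of_int n" "piece (21 * frac t) = k"
proof -
  have "\<lfloor>t\<rfloor> = n" using breakpoint_mono[OF assms(1)] assms by (intro floor_unique) auto
  then show f: "21 * frac t = 21 * t - 21 * of_int n" by (simp add: frac_def)
  then show p: "piece (21 * frac t) = k" using piece_eq[OF assms] by simp
  show "kishino_curve t = semicircle k (21 * t - 21 * of_int n)" "kishino_tangent t = 21 *\<^sub>R arc_velocity k (21 * t - 21 * of_int n)"
    unfolding kishino_curve_arc kishino_tangent_def p unfolding f by simp_all
qed

text \<open>Around every parameter the curve is given by one explicit formula on each side, and the
  two match to first order. The integers \<open>m\<close> and \<open>n\<close> differ at the base
  point, where the left formula belongs to the previous period.\<close>

lemma kishino_local:
  "\<exists>\<epsilon>>0. \<exists>i j m n. i < 8 \<and> j < 8 \<and>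
     (\<forall>t. t0 - \<epsilon> < t \<and> t < t0 \<longrightarrow> kishino_curve t = semicircle i (21 * t - 21 * of_int m) \<and> kishino_tangent t = 21 *\<^sub>R arc_velocity i (21 * t - 21 * of_int m)) \<and>
     (\<forall>t. t0 \<le> t \<and> t < t0 + \<epsilon> \<longrightarrow> kishino_curve t = semicircle j (21 * t - 21 * of_int n) \<and> kishino_tangent t = 21 *\<^sub>R arc_velocity j (21 * t - 21 * of_int n)) \<and>
     semicircle i (21 * t0 - 21 * of_int m) = semicircle j (21 * t0 - 21 * of_int n) \<and>
     arc_velocity i (21 * t0 - 21 * of_int m) = arc_velocity j (21 * t0 - 21 * of_int n)"
proof -
  define n where "n = \<lfloor>t0\<rfloor>"
  define x where "x = 21 * frac t0"
  have x: "x = 21 * t0 - 21 * of_int n" by (simp add: x_def n_def frac_def)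
  have x0: "0 \<le> x" "x < 21" by (auto simp: x_def frac_lt_1)
  define k where "k = piece x"
  have k: "k < 8" "breakpoint k \<le> x" "x < breakpoint (k + 1)" using piece_range[OF x0] by (simp_all add: k_def)
  have right: "kishino_curve t = semicircle k (21 * t - 21 * of_int n) \<and> kishino_tangent t = 21 *\<^sub>R arc_velocity k (21 * t - 21 * of_int n)"
    if "t0 \<le> t" "t < t0 + (breakpoint (k + 1) - x) / 21" for t
  proof -
    have "breakpoint k \<le> 21 * t - 21 * of_int n" "21 * t - 21 * of_int n < breakpoint (k + 1)"
      using that k(2) unfolding x by (auto simp: field_simps)
    then show ?thesis using kishino_at[OF k(1)] by blast
  qed
  have "\<exists>\<epsilon>>0. \<exists>i m. i < 8 \<and>
     (\<forall>t. t0 - \<epsilon> < t \<and> t < t0 \<longrightarrow> kishino_curve t = semicircle i (21 * t - 21 * of_int m) \<and> kishino_tangent t = 21 *\<^sub>R arc_velocity i (21 * t - 21 * of_int m)) \<and>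
     semicircle i (21 * t0 - 21 * of_int m) = semicircle k (21 * t0 - 21 * of_int n) \<and>
     arc_velocity i (21 * t0 - 21 * of_int m) = arc_velocity k (21 * t0 - 21 * of_int n)"
  proof -
    have "breakpoint 0 = 0" by (simp add: breakpoint_def)
    then consider "breakpoint k < x" | "breakpoint k = x" "0 < k" | "x = 0" "k = 0" using k(2) by (metis less_eq_real_def gr0I)
    then show ?thesis
    proof cases
      case 1
      show ?thesis
      proof (rule exI[of _ "(x - breakpoint k) / 21"], intro conjI exI[of _ k] exI[of _ n] allI impI)
        fix t assume t: "t0 - (x - breakpoint k) / 21 < t \<and> t < t0"
        then have "breakpoint k \<le> 21 * t - 21 * of_int n" "21 * t - 21 * of_int n < breakpoint (k + 1)"
          using k(3) unfolding x by (auto simp: field_simps)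
        then show "kishino_curve t = semicircle k (21 * t - 21 * of_int n)" "kishino_tangent t = 21 *\<^sub>R arc_velocity k (21 * t - 21 * of_int n)"
          using kishino_at[OF k(1)] by blast+
      qed (use 1 k in auto)
    next
      case 2
      define i where "i = k - 1"
      have i: "i < 8" "i < 7" "k = i + 1" using 2 k by (auto simp: i_def)
      have bi: "breakpoint i < breakpoint k" using breakpoint_mono[OF i(1)] i(3) by simp
      show ?thesis
      proof (rule exI[of _ "(breakpoint k - breakpoint i) / 21"], intro conjI exI[of _ i] exI[of _ n] allI impI)
        fix t assume t: "t0 - (breakpoint k - breakpoint i) / 21 < t \<and> t < t0"
        have bx: "breakpoint k = 21 * t0 - 21 * of_int n" using 2(1) x by simp
        have "breakpoint i \<le> 21 * t - 21 * of_int n" "21 * t - 21 * of_int n < breakpoint (i + 1)"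
          using t bx i(3) by (auto simp: field_simps)
        then show "kishino_curve t = semicircle i (21 * t - 21 * of_int n)" "kishino_tangent t = 21 *\<^sub>R arc_velocity i (21 * t - 21 * of_int n)"
          using kishino_at[OF i(1)] by blast+
      next
        show "semicircle i (21 * t0 - 21 * of_int n) = semicircle k (21 * t0 - 21 * of_int n)"
          "arc_velocity i (21 * t0 - 21 * of_int n) = arc_velocity k (21 * t0 - 21 * of_int n)"
          using arc_joint[OF i(2)] 2(1) unfolding x[symmetric] i(3) by simp_all
      qed (use bi i in auto)
    next
      case 3
      have t0: "t0 = of_int n" using 3 x by simp
      have b: "breakpoint 7 = 17" "breakpoint (7 + 1) = 21" by (simp_all add: breakpoint_def)
      show ?thesis
      \<comment> \<open>Before an integer the curve runs through the last semicircle, which occupies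
        the interval from 17 to 21 on the scale of 21 per period.\<close>
      proof (rule exI[of _ "4 / 21"], intro conjI exI[of _ "7::nat"] exI[of _ "n - 1"] allI impI)
        fix t assume t: "t0 - 4 / 21 < t \<and> t < t0"
        have "breakpoint 7 \<le> 21 * t - 21 * of_int (n - 1)" "21 * t - 21 * of_int (n - 1) < breakpoint (7 + 1)"
          using t t0 unfolding b by auto
        then show "kishino_curve t = semicircle 7 (21 * t - 21 * of_int (n - 1))" "kishino_tangent t = 21 *\<^sub>R arc_velocity 7 (21 * t - 21 * of_int (n - 1))"
          using kishino_at(1,2)[of 7 t "n - 1"] by auto
      next
        show "semicircle 7 (21 * t0 - 21 * of_int (n - 1)) = semicircle k (21 * t0 - 21 * of_int n)"
          "arc_velocity 7 (21 * t0 - 21 * of_int (n - 1)) = arc_velocity k (21 * t0 - 21 * of_int n)"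
          using arc_joint0 3(2) t0 by simp_all
      qed auto
    qed
  qed
  then obtain \<epsilon> i m where \<epsilon>: "0 < \<epsilon>" "i < 8"
     "\<And>t. t0 - \<epsilon> < t \<Longrightarrow> t < t0 \<Longrightarrow> kishino_curve t = semicircle i (21 * t - 21 * of_int m) \<and> kishino_tangent t = 21 *\<^sub>R arc_velocity i (21 * t - 21 * of_int m)"
     "semicircle i (21 * t0 - 21 * of_int m) = semicircle k (21 * t0 - 21 * of_int n)"
     "arc_velocity i (21 * t0 - 21 * of_int m) = arc_velocity k (21 * t0 - 21 * of_int n)" by blast
  show ?thesis
    by (rule exI[of _ "min \<epsilon> ((breakpoint (k + 1) - x) / 21)"], intro conjI exI[of _ i] exI[of _ k] exI[of _ m] exI[of _ n] allI impI)
       (use \<epsilon> right k in auto)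
qed

lemma has_vector_derivative_glue:
  fixes f f1 f2 :: "real \<Rightarrow> 'a::real_normed_vector"
  assumes "(f1 has_vector_derivative v) (at x)" "(f2 has_vector_derivative v) (at x)" and "0 < \<epsilon>"
    and l: "\<And>t. x - \<epsilon> < t \<Longrightarrow> t < x \<Longrightarrow> f t = f1 t" and r: "\<And>t. x \<le> t \<Longrightarrow> t < x + \<epsilon> \<Longrightarrow> f t = f2 t" and eq: "f1 x = f2 x"
  shows "(f has_vector_derivative v) (at x)"
  unfolding has_vector_derivative_def has_derivative_at_alt
proof (intro conjI allI impI)
  show "bounded_linear (\<lambda>t. t *\<^sub>R v)" by (rule bounded_linear_scaleR_left)
  fix e :: real assume e: "0 < e"
  obtain d1 where d1: "0 < d1" "\<And>y. norm (y - x) < d1 \<Longrightarrow> norm (f1 y - f1 x - (y - x) *\<^sub>R v) \<le> e * norm (y - x)"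
    using assms(1) e unfolding has_vector_derivative_def has_derivative_at_alt by blast
  obtain d2 where d2: "0 < d2" "\<And>y. norm (y - x) < d2 \<Longrightarrow> norm (f2 y - f2 x - (y - x) *\<^sub>R v) \<le> e * norm (y - x)"
    using assms(2) e unfolding has_vector_derivative_def has_derivative_at_alt by blast
  have fx: "f x = f2 x" using r \<open>0 < \<epsilon>\<close> by simp
  show "\<exists>d>0. \<forall>y. norm (y - x) < d \<longrightarrow> norm (f y - f x - (y - x) *\<^sub>R v) \<le> e * norm (y - x)"
  proof (intro exI[of _ "min \<epsilon> (min d1 d2)"] conjI allI impI)
    fix y assume y: "norm (y - x) < min \<epsilon> (min d1 d2)"
    show "norm (f y - f x - (y - x) *\<^sub>R v) \<le> e * norm (y - x)"
    proof (cases "y < x")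
      case True
      then have "f y = f1 y" using l[of y] y by simp
      then show ?thesis using d1(2)[of y] y fx eq by simp
    next
      case False
      then have "f y = f2 y" using r[of y] y by simp
      then show ?thesis using d2(2)[of y] y fx by simp
    qed
  qed (use assms(3) d1 d2 in auto)
qed

lemma isCont_glue:
  fixes f f1 f2 :: "real \<Rightarrow> 'a::real_normed_vector"
  assumes "isCont f1 x" "isCont f2 x" and "0 < \<epsilon>"
    and l: "\<And>t. x - \<epsilon> < t \<Longrightarrow> t < x \<Longrightarrow> f t = f1 t" and r: "\<And>t. x \<le> t \<Longrightarrow> t < x + \<epsilon> \<Longrightarrow> f t = f2 t" and eq: "f1 x = f2 x"
  shows "isCont f x"
  unfolding continuous_at_eps_delta
proof (intro allI impI)
  fix e :: real assume e: "0 < e"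
  obtain d1 where d1: "0 < d1" "\<And>y. dist y x < d1 \<Longrightarrow> dist (f1 y) (f1 x) < e"
    using assms(1) e unfolding continuous_at_eps_delta by blast
  obtain d2 where d2: "0 < d2" "\<And>y. dist y x < d2 \<Longrightarrow> dist (f2 y) (f2 x) < e"
    using assms(2) e unfolding continuous_at_eps_delta by blast
  have fx: "f x = f2 x" using r \<open>0 < \<epsilon>\<close> by simp
  show "\<exists>d>0. \<forall>y. dist y x < d \<longrightarrow> dist (f y) (f x) < e"
  proof (intro exI[of _ "min \<epsilon> (min d1 d2)"] conjI allI impI)
    fix y assume y: "dist y x < min \<epsilon> (min d1 d2)"
    show "dist (f y) (f x) < e"
    proof (cases "y < x")
      case True
      then have "f y = f1 y" using l[of y] y by (simp add: dist_real_def)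
      then show ?thesis using d1(2)[of y] y fx eq by simp
    next
      case False
      then have "f y = f2 y" using r[of y] y by (simp add: dist_real_def)
      then show ?thesis using d2(2)[of y] y fx by simp
    qed
  qed (use assms(3) d1 d2 in auto)
qed

lemma kishino_deriv: "(kishino_curve has_vector_derivative kishino_tangent t) (at t)"
  and kishino_tangent_cont: "isCont kishino_tangent t"
proof -
  obtain \<epsilon> i j m n where L: "0 < \<epsilon>" "i < 8" "j < 8"
     "\<And>s. t - \<epsilon> < s \<Longrightarrow> s < t \<Longrightarrow> kishino_curve s = semicircle i (21 * s - 21 * of_int m) \<and> kishino_tangent s = 21 *\<^sub>R arc_velocity i (21 * s - 21 * of_int m)"
     "\<And>s. t \<le> s \<Longrightarrow> s < t + \<epsilon> \<Longrightarrow> kishino_curve s = semicircle j (21 * s - 21 * of_int n) \<and> kishino_tangent s = 21 *\<^sub>R arc_velocity j (21 * s - 21 * of_int n)"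
     "semicircle i (21 * t - 21 * of_int m) = semicircle j (21 * t - 21 * of_int n)"
     "arc_velocity i (21 * t - 21 * of_int m) = arc_velocity j (21 * t - 21 * of_int n)"
    using kishino_local[of t] by blast
  have d: "((\<lambda>s. semicircle k (21 * s - 21 * of_int p)) has_vector_derivative 21 *\<^sub>R arc_velocity k (21 * t - 21 * of_int p)) (at t)" if "k < 8" for k p
  proof -
    have "((semicircle k \<circ> (\<lambda>s. 21 * s - 21 * of_int p)) has_vector_derivative 21 *\<^sub>R arc_velocity k (21 * t - 21 * of_int p)) (at t)"
      by (rule vector_diff_chain_at[OF _ arc_deriv[OF that]]) (auto intro!: derivative_eq_intros)
    then show ?thesis by (simp add: o_def)
  qed
  have kt: "kishino_tangent t = 21 *\<^sub>R arc_velocity j (21 * t - 21 * of_int n)" using L(1) L(5)[of t] by simp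
  show "(kishino_curve has_vector_derivative kishino_tangent t) (at t)" unfolding kt
    by (rule has_vector_derivative_glue[OF d[OF L(2), of m, unfolded L(7)] d[OF L(3), of n] L(1)]) (use L in auto)
  have c: "isCont (\<lambda>s. 21 *\<^sub>R arc_velocity k (21 * s - 21 * of_int p)) t" for k p
  proof -
    have "continuous_on UNIV (\<lambda>s. 21 *\<^sub>R arc_velocity k (21 * s - 21 * of_int p))"
      by (intro continuous_intros continuous_on_compose2[OF arc_velocity_continuous[of UNIV]]) auto
    then show ?thesis by (simp add: continuous_on_eq_continuous_at)
  qed
  show "isCont kishino_tangent t"
    by (rule isCont_glue[OF c[of i m] c[of j n] L(1)]) (use L in auto)
qed

lemma velocity_kishino: "velocity kishino_curve t = kishino_tangent t"
  unfolding velocity_def using kishino_deriv by (rule vector_derivative_at)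


section \<open>Double points of the Kishino curve\<close>

definition start :: "nat \<Rightarrow> real" where "start k = [0, 2, 3, 1, 5/2, 5, 1/2, 4] ! k"

text \<open>
  \<open>start k\<close> is the abscissa of the first point of semicircle \<open>k\<close>, and \<open>meet i j X\<close> means that the
  semicircles \<open>i\<close> and \<open>j\<close> cross at abscissa \<open>X\<close>.
\<close>

definition meet :: "nat \<Rightarrow> nat \<Rightarrow> real \<Rightarrow> bool" where
  "meet i j X \<longleftrightarrow> (i, j, X) \<in> {(0, 2, 3/2), (2, 0, 3/2), (0, 6, 4/5), (6, 0, 4/5), (2, 4, 19/7), (4, 2, 19/7),
     (4, 6, 7/2), (6, 4, 7/2), (1, 3, 7/3), (3, 1, 7/3), (5, 7, 5/3), (7, 5, 5/3)}"

text \<open>An implicit description in place of angles. On the half-open parameter interval the only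
  real point is the start. The tangent is the radius vector turned by a right angle and rescaled, so
  at a crossing both tangents are expressed through the coordinates of the common point.\<close>

lemma semicircle_coords:
  assumes k: "k < 8" "breakpoint k \<le> x" "x < breakpoint (k + 1)"
  shows "(Re (semicircle k x) - center k)\<^sup>2 + (Im (semicircle k x))\<^sup>2 = (radius k)\<^sup>2" "0 \<le> side k * Im (semicircle k x)"
    "\<bar>Re (semicircle k x) - center k\<bar> \<le> radius k" "Im (semicircle k x) = 0 \<Longrightarrow> Re (semicircle k x) = start k"
    "arc_velocity k x = of_real (pi / 2 * (direction k * side k / radius k)) * Complex (Im (semicircle k x)) (center k - Re (semicircle k x))"
proof -
  have r: "0 < radius k" using breakpoint_mono[OF k(1)] by simp
  have d: "direction k * direction k = 1" "side k * side k = 1" using direction_side[OF k(1)] by simp_all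
  have a: "0 \<le> angle k x" "angle k x < pi" using angle_range[OF k] by simp_all
  then have s: "0 \<le> sin (angle k x)" by (intro sin_ge_zero) auto
  have R: "Re (semicircle k x) = center k - direction k * radius k * cos (angle k x)" and I: "Im (semicircle k x) = side k * radius k * sin (angle k x)"
    by (simp_all add: semicircle_def)
  have "(Re (semicircle k x) - center k)\<^sup>2 + (Im (semicircle k x))\<^sup>2 =
      (direction k * direction k) * (radius k)\<^sup>2 * (cos (angle k x))\<^sup>2 + (side k * side k) * (radius k)\<^sup>2 * (sin (angle k x))\<^sup>2"
    unfolding R I by (simp add: power2_eq_square)
  also have "\<dots> = (radius k)\<^sup>2 * ((cos (angle k x))\<^sup>2 + (sin (angle k x))\<^sup>2)" unfolding d by (simp only: mult_1 distrib_left)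
  also have "\<dots> = (radius k)\<^sup>2" by simp
  finally show 1: "(Re (semicircle k x) - center k)\<^sup>2 + (Im (semicircle k x))\<^sup>2 = (radius k)\<^sup>2" .
  have "side k * Im (semicircle k x) = (side k * side k) * (radius k * sin (angle k x))" unfolding I by simp
  then show "0 \<le> side k * Im (semicircle k x)" unfolding d using r s by simp
  have "(Re (semicircle k x) - center k)\<^sup>2 \<le> (radius k)\<^sup>2" using 1 by (metis le_add_same_cancel1 zero_le_power2)
  then show "\<bar>Re (semicircle k x) - center k\<bar> \<le> radius k" using r by (simp add: abs_le_square_iff[symmetric])
  have st: "start k = center k - direction k * radius k"
    using k(1) unfolding less8 by (auto simp: start_def tables)
  show "Re (semicircle k x) = start k" if "Im (semicircle k x) = 0"
  proof -
    have "sin (angle k x) = 0" using that r d(2) unfolding I by auto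
    then have "angle k x = 0" using a sin_gt_zero[of "angle k x"] by fastforce
    then show ?thesis unfolding R st by simp
  qed
  have K: "direction k * side k / radius k * Im (semicircle k x) = direction k * sin (angle k x)"
    "direction k * side k / radius k * (center k - Re (semicircle k x)) = side k * cos (angle k x)"
    unfolding R I using r d by (simp_all add: field_simps)
  have "of_real c * Complex u v = Complex (c * u) (c * v)" for c u v by (simp add: complex_eq_iff)
  then show "arc_velocity k x = of_real (pi / 2 * (direction k * side k / radius k)) * Complex (Im (semicircle k x)) (center k - Re (semicircle k x))"
    unfolding arc_velocity_def by (simp only: mult.assoc[of "pi / 2"] K)
qed

lemma semicircle_inj:
  assumes k: "k < 8" "breakpoint k \<le> x" "x < breakpoint (k + 1)" "breakpoint k \<le> y" "y < breakpoint (k + 1)" and "Re (semicircle k x) = Re (semicircle k y)"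
  shows "x = y"
proof -
  have r: "0 < radius k" and d: "direction k \<noteq> 0" using breakpoint_mono[OF k(1)] direction_side[OF k(1)] by auto
  have "cos (angle k x) = cos (angle k y)" using assms(6) r d by (simp add: semicircle_def)
  then have "angle k x = angle k y"
    by (rule cos_inj_pi[rotated -1])
      (rule angle_range(1)[OF k(1-3)] less_imp_le[OF angle_range(2)[OF k(1-3)]]
        angle_range(1)[OF k(1,4,5)] less_imp_le[OF angle_range(2)[OF k(1,4,5)]])+
  then show ?thesis using r by (simp add: angle_def)
qed

lemma side_cases: "k < 8 \<Longrightarrow> side k = 1 \<or> side k = -1"
  unfolding less8 by (elim disjE) (simp_all add: side_def)

lemma start_inj: "i < 8 \<Longrightarrow> j < 8 \<Longrightarrow> start i = start j \<Longrightarrow> i = j"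
  unfolding less8 by (elim disjE) (simp_all add: start_def)

lemma same_side: "i < 8 \<Longrightarrow> j < 8 \<Longrightarrow> side i = side j \<Longrightarrow> i \<noteq> j \<Longrightarrow>
    i = 0 \<and> j = 2 \<or> i = 0 \<and> j = 4 \<or> i = 0 \<and> j = 6 \<or> i = 2 \<and> j = 0 \<or> i = 2 \<and> j = 4 \<or> i = 2 \<and> j = 6 \<or>
    i = 4 \<and> j = 0 \<or> i = 4 \<and> j = 2 \<or> i = 4 \<and> j = 6 \<or> i = 6 \<and> j = 0 \<or> i = 6 \<and> j = 2 \<or> i = 6 \<and> j = 4 \<or>
    i = 1 \<and> j = 3 \<or> i = 1 \<and> j = 5 \<or> i = 1 \<and> j = 7 \<or> i = 3 \<and> j = 1 \<or> i = 3 \<and> j = 5 \<or> i = 3 \<and> j = 7 \<or>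
    i = 5 \<and> j = 1 \<or> i = 5 \<and> j = 3 \<or> i = 5 \<and> j = 7 \<or> i = 7 \<and> j = 1 \<or> i = 7 \<and> j = 3 \<or> i = 7 \<and> j = 5"
  unfolding less8 by (elim disjE) (simp_all add: side_def)

text \<open>Subtracting the equations of two circles leaves a linear equation for the abscissa. The
  remaining pairs of the same side have nested or disjoint abscissa ranges, and for them the
  solution falls outside of the bounds.\<close>

lemma circles_meet:
  assumes "i < 8" "j < 8" "i \<noteq> j" "side i = side j"
    and "2 * center i * X + radius i * radius i - center i * center i = 2 * center j * X + radius j * radius j - center j * center j"
    and "center i - radius i \<le> X" "X \<le> center i + radius i" "center j - radius j \<le> X" "X \<le> center j + radius j"
  shows "meet i j X"
  using same_side[OF assms(1,2,4,3)] assms(5-)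
  by (elim disjE conjE; hypsubst; simp add: center_def radius_def meet_def)

text \<open>An upper and a lower semicircle could share only a real point. There each of them is at
  its start, and the eight starts are distinct.\<close>

lemma semicircle_meet:
  assumes i: "i < 8" "breakpoint i \<le> x" "x < breakpoint (i + 1)" and j: "j < 8" "breakpoint j \<le> y" "y < breakpoint (j + 1)"
    and ij: "i \<noteq> j" and eq: "semicircle i x = semicircle j y"
  shows "meet i j (Re (semicircle i x))" "Im (semicircle i x) \<noteq> 0" "side i = side j"
proof -
  define X where "X = Re (semicircle i x)"
  define Y where "Y = Im (semicircle i x)"
  define Q where "Q = X * X + Y * Y"
  have "(X - center i)\<^sup>2 + Y\<^sup>2 = (radius i)\<^sup>2" "(X - center j)\<^sup>2 + Y\<^sup>2 = (radius j)\<^sup>2"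
    using semicircle_coords(1)[OF i] semicircle_coords(1)[OF j] eq by (simp_all add: X_def Y_def)
  then have Q: "Q = 2 * (center i * X) + (radius i * radius i - center i * center i)" "Q = 2 * (center j * X) + (radius j * radius j - center j * center j)"
    unfolding Q_def by (simp_all add: power2_eq_square algebra_simps)
  have s: "0 \<le> side i * Y" "0 \<le> side j * Y" and r: "\<bar>X - center i\<bar> \<le> radius i" "\<bar>X - center j\<bar> \<le> radius j"
    and z: "Y = 0 \<Longrightarrow> X = start i" "Y = 0 \<Longrightarrow> X = start j"
    using semicircle_coords(2-4)[OF i] semicircle_coords(2-4)[OF j] eq by (simp_all add: X_def Y_def)
  have ss: "side i = side j"
  proof (rule ccontr)
    assume "side i \<noteq> side j"
    then have "Y = 0" using s side_cases[OF i(1)] side_cases[OF j(1)] by auto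
    then have "start i = start j" using z by simp
    then show False using ij start_inj[OF i(1) j(1)] by simp
  qed
  show "side i = side j" by (rule ss)
  have m: "meet i j X"
    by (rule circles_meet[OF i(1) j(1) ij ss]) (use Q r in \<open>simp_all add: abs_le_iff mult.assoc\<close>)
  then show "meet i j (Re (semicircle i x))" by (simp add: X_def)
  have "X \<noteq> start i" using m by (auto simp: meet_def start_def)
  then show "Im (semicircle i x) \<noteq> 0" using z(1) by (auto simp: Y_def)
qed

abbreviation piece_of :: "real \<Rightarrow> nat" where "piece_of t \<equiv> piece (21 * frac t)"

lemma piece_of: "piece_of t < 8" "breakpoint (piece_of t) \<le> 21 * frac t" "21 * frac t < breakpoint (piece_of t + 1)"
  using piece_range[of "21 * frac t"] by (auto simp: frac_lt_1)

lemma kishino_inj: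
  assumes "piece_of s = piece_of t" "Re (kishino_curve s) = Re (kishino_curve t)"
  shows "frac s = frac t"
proof -
  have "21 * frac s = 21 * frac t"
    by (rule semicircle_inj[OF piece_of(1,2,3)[of s]]) (use assms piece_of[of t] in \<open>simp_all add: kishino_curve_arc\<close>)
  then show ?thesis by simp
qed

lemma frac_eq_Ints: "frac s = frac t \<Longrightarrow> s - t \<in> \<int>"
proof -
  assume "frac s = frac t"
  then have "s - t = of_int (\<lfloor>s\<rfloor> - \<lfloor>t\<rfloor>)" by (simp add: frac_def)
  then show ?thesis by (simp only: Ints_of_int)
qed

lemma kishino_double:
  assumes "double_pt kishino_curve s t"
  shows "meet (piece_of s) (piece_of t) (Re (kishino_curve s))" "Im (kishino_curve s) \<noteq> 0"
    "side (piece_of s) = side (piece_of t)" "piece_of s \<noteq> piece_of t"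
proof -
  have eq: "kishino_curve s = kishino_curve t" and ne: "s - t \<notin> \<int>" using assms by (simp_all add: double_pt_def)
  show p: "piece_of s \<noteq> piece_of t" using kishino_inj[of s t] frac_eq_Ints[of s t] eq ne by auto
  note m = semicircle_meet[OF piece_of(1,2,3)[of s] piece_of(1,2,3)[of t] p]
  show "meet (piece_of s) (piece_of t) (Re (kishino_curve s))" "Im (kishino_curve s) \<noteq> 0"
    "side (piece_of s) = side (piece_of t)"
    using m eq unfolding kishino_curve_arc by blast+
qed

lemma meet_sym: "meet i j X \<Longrightarrow> meet j i X"
  unfolding meet_def by (elim insertE emptyE) simp_all

lemma meet_unique: assumes "meet i j X" "meet i j X'" shows "X = X'"
proof -
  \<comment> \<open>The products 3, 7, 15, 35, 8 and 48 tell the six unordered pairs of meeting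
    semicircles apart.\<close>
  have *: "X = (if (i + 1) * (j + 1) = 3 then 3/2 else if (i + 1) * (j + 1) = 7 then 4/5 else if (i + 1) * (j + 1) = 15 then 19/7
      else if (i + 1) * (j + 1) = 35 then 7/2 else if (i + 1) * (j + 1) = 8 then 7/3 else 5/3)" if "meet i j X" for X
    using that unfolding meet_def by (elim insertE emptyE) simp_all
  show ?thesis by (rule trans[OF *[OF assms(1)] *[OF assms(2), symmetric]])
qed

lemma meet_trans: assumes "meet i j X" "meet j l X" shows "i = l"
proof -
  \<comment> \<open>The six abscissas are distinct, so an abscissa determines the pair, and the
    partner is recovered from the sum of the two indices. This excludes triple points.\<close>
  have *: "i = (if X = 3/2 then 2 - j else if X = 4/5 then 6 - j else if X = 19/7 then 6 - j
      else if X = 7/2 then 10 - j else if X = 7/3 then 4 - j else 12 - j)" if "meet i j X" for i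
    using that unfolding meet_def by (elim insertE emptyE) simp_all
  show ?thesis by (rule trans[OF *[OF assms(1)] *[OF meet_sym[OF assms(2)], symmetric]])
qed

lemma kishino_tangent_eq: "kishino_tangent t = of_real (21 * (pi / 2) * (direction (piece_of t) * side (piece_of t) / radius (piece_of t))) *
    Complex (Im (kishino_curve t)) (center (piece_of t) - Re (kishino_curve t))"
  unfolding kishino_tangent_def kishino_curve_arc semicircle_coords(5)[OF piece_of]
  by (simp add: scaleR_conv_of_real mult.assoc)

lemma kishino_tangent_nonzero: "kishino_tangent t \<noteq> 0"
proof
  let ?a = "angle (piece_of t) (21 * frac t)"
  have d: "direction (piece_of t) \<noteq> 0" "side (piece_of t) \<noteq> 0" using direction_side[OF piece_of(1)[of t]] by auto
  assume "kishino_tangent t = 0"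
  then have "sin ?a = 0" "cos ?a = 0" using d by (simp_all add: kishino_tangent_def arc_velocity_def complex_eq_iff)
  then show False using sin_cos_squared_add[of ?a] by simp
qed

text \<open>Both tangents are multiples of turned radius vectors to the same point, so the
  determinant is the ordinate times the difference of the centers, up to the factors of speed and
  direction. The sign of the ordinate is the common side.\<close>

lemma kishino_tangent_det:
  assumes "double_pt kishino_curve s t"
  shows "sgn (det2 (kishino_tangent s) (kishino_tangent t)) =
    direction (piece_of s) * direction (piece_of t) * side (piece_of s) * sgn (center (piece_of t) - center (piece_of s))"
    "det2 (kishino_tangent s) (kishino_tangent t) \<noteq> 0"
proof -
  define i where "i = piece_of s" define j where "j = piece_of t"
  define X where "X = Re (kishino_curve s)" define Y where "Y = Im (kishino_curve s)"
  have eq: "kishino_curve t = kishino_curve s" using assms by (simp add: double_pt_def)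
  have ij: "i < 8" "j < 8" using piece_of by (simp_all add: i_def j_def)
  have r: "0 < radius i" "0 < radius j" using breakpoint_mono ij by auto
  have dd: "direction k = 1 \<or> direction k = -1" if "k < 8" for k
    using that unfolding less8 by (elim disjE) (simp_all add: direction_def)
  note m = kishino_double[OF assms, folded i_def j_def X_def Y_def]
  define K where "K = (21 * (pi / 2))\<^sup>2 / (radius i * radius j)"
  have K: "0 < K" using r by (simp add: K_def)
  have D: "det2 (kishino_tangent s) (kishino_tangent t) = K * (direction i * direction j * (side i * side j) * Y * (center j - center i))"
    unfolding kishino_tangent_eq eq i_def[symmetric] j_def[symmetric] X_def[symmetric] Y_def[symmetric] K_def
    by (simp add: det2_eq power2_eq_square algebra_simps add_divide_distrib diff_divide_distrib)
  have Y: "sgn Y = side i"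
    using semicircle_coords(2)[OF piece_of(1-3)[of s], folded kishino_curve_arc] m(2) side_cases[OF ij(1)]
    unfolding i_def[symmetric] Y_def[symmetric] by (auto simp: sgn_if)
  have c: "center j - center i \<noteq> 0" using m(1) by (auto simp: meet_def center_def)
  show "sgn (det2 (kishino_tangent s) (kishino_tangent t)) = direction (piece_of s) * direction (piece_of t) * side (piece_of s) * sgn (center (piece_of t) - center (piece_of s))"
    unfolding D using K Y dd[OF ij(1)] dd[OF ij(2)] side_cases[OF ij(1)] m(3)
    unfolding i_def[symmetric] j_def[symmetric] by (auto simp: sgn_mult)
  show "det2 (kishino_tangent s) (kishino_tangent t) \<noteq> 0"
    unfolding D using K c m(2) dd[OF ij(1)] dd[OF ij(2)] side_cases[OF ij(1)] m(3) by auto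
qed

lemma kishino_period: "kishino_curve (t + 1) = kishino_curve t"
  by (simp add: kishino_curve_def frac_1_eq)

text \<open>Double points are finite in number since the pair of semicircles determines one: two
  semicircles meet at one abscissa at most, and on a semicircle the abscissa determines the
  parameter.\<close>

lemma kishino_immersion: "generic_immersion kishino_curve"
  unfolding generic_immersion_def
proof (intro conjI allI impI)
  show "kishino_curve (t + 1) = kishino_curve t" for t by (rule kishino_period)
  have "continuous_on UNIV kishino_tangent" using kishino_tangent_cont by (simp add: continuous_on_eq_continuous_at)
  then show "kishino_curve C1_differentiable_on UNIV"
    unfolding C1_differentiable_on_def using kishino_deriv by blast
  show "vector_derivative kishino_curve (at t) \<noteq> 0" for t
    using kishino_tangent_nonzero velocity_kishino[of t] by (simp add: velocity_def)
  let ?S = "{(s, t). s \<in> {0..<1} \<and> t \<in> {0..<1} \<and> double_pt kishino_curve s t}"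
  have "inj_on (\<lambda>(s, t). (piece_of s, piece_of t)) ?S"
  proof (rule inj_onI, clarify)
    fix s t s' t' :: real
    assume st: "s \<in> {0..<1}" "t \<in> {0..<1}" "double_pt kishino_curve s t"
      and st': "s' \<in> {0..<1}" "t' \<in> {0..<1}" "double_pt kishino_curve s' t'"
      and p: "piece_of s = piece_of s'" "piece_of t = piece_of t'"
    have X: "Re (kishino_curve s) = Re (kishino_curve s')"
      using meet_unique kishino_double(1)[OF st(3)] kishino_double(1)[OF st'(3)] p by metis
    then have "Re (kishino_curve t) = Re (kishino_curve t')" using st(3) st'(3) by (simp add: double_pt_def)
    then have "frac s = frac s'" "frac t = frac t'" using kishino_inj p X by blast+
    then show "s = s' \<and> t = t'" using st st' by (simp only: frac_eq_id)
  qed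
  moreover have "finite ((\<lambda>(s, t). (piece_of s, piece_of t)) ` ?S)"
    by (rule finite_subset[of _ "{..<8} \<times> {..<8}"]) (use piece_of(1) in auto)
  ultimately show "finite ?S" using finite_imageD by blast
  show "Im (cnj (vector_derivative kishino_curve (at s)) * vector_derivative kishino_curve (at t)) \<noteq> 0"
    if "double_pt kishino_curve s t" for s t
    using kishino_tangent_det(2)[OF that] unfolding velocity_kishino[symmetric] by (simp add: det2_def velocity_def)
  show "s - u \<in> \<int>" if "double_pt kishino_curve s t \<and> double_pt kishino_curve t u" for s t u
  proof -
    have e: "kishino_curve s = kishino_curve t" "kishino_curve t = kishino_curve u" using that by (auto simp: double_pt_def)
    have "piece_of s = piece_of u"
      using meet_trans kishino_double(1)[of s t] kishino_double(1)[of t u] that e by metis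
    then show ?thesis using kishino_inj[of s u] frac_eq_Ints[of s u] e by simp
  qed
qed

lemma kishino_arc_at_piece:
  "kishino_arc_at t = [kishino_arc.A, kishino_arc.B, kishino_arc.C, kishino_arc.D, kishino_arc.D,
     kishino_arc.E, kishino_arc.E, kishino_arc.F] ! piece_of t"
  unfolding kishino_arc_at_def Let_def piece_def by simp

lemma curve_kishino [simp]: "curve kishino = kishino_curve"
  by (simp add: kishino_def)

lemma over_kishino: "over kishino s t \<longleftrightarrow> double_pt kishino_curve s t \<and>
    (kishino_arc_at s, kishino_arc_at t) \<in> {(kishino_arc.E, kishino_arc.D), (kishino_arc.E, kishino_arc.A),
      (kishino_arc.D, kishino_arc.C), (kishino_arc.A, kishino_arc.C)}"
  by (simp add: kishino_def)

lemma virtual_diagram_kishino: "virtual_diagram kishino"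
  unfolding virtual_diagram_def
proof (intro conjI allI impI)
  show "generic_immersion (curve kishino)" using kishino_immersion by simp
  show "double_pt (curve kishino) s t" if "over kishino s t" for s t using that by (simp add: over_kishino)
  show "\<not> over kishino t s" if "over kishino s t" for s t using that by (auto simp: over_kishino)
  have I: "s + 1 - t \<in> \<int> \<longleftrightarrow> s - t \<in> \<int>" "s - (t + 1) \<in> \<int> \<longleftrightarrow> s - t \<in> \<int>" for s t :: real
  proof -
    have e: "s + 1 - t = (s - t) + 1" "s - (t + 1) = (s - t) - 1" by simp_all
    show "s + 1 - t \<in> \<int> \<longleftrightarrow> s - t \<in> \<int>" "s - (t + 1) \<in> \<int> \<longleftrightarrow> s - t \<in> \<int>"
      unfolding e by (metis Ints_1 Ints_add Ints_diff add_diff_cancel_right' diff_add_cancel)+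
  qed
  show "over kishino (s + 1) t = over kishino s t" "over kishino s (t + 1) = over kishino s t" for s t
    unfolding over_kishino double_pt_def kishino_period kishino_arc_at_def frac_1_eq I by simp_all
qed

text \<open>Of the six meetings the four below the real axis are classical and the two above it, of
  \<open>B\<close> with \<open>D\<close> and of \<open>E\<close> with \<open>F\<close>, are
  virtual.\<close>

lemma classical_kishino: "classical_at kishino s t \<longleftrightarrow> double_pt kishino_curve s t \<and> side (piece_of s) = -1"
proof (cases "double_pt kishino_curve s t")
  case True
  define i where "i = piece_of s" define j where "j = piece_of t"
  have m: "meet i j (Re (kishino_curve s))" using kishino_double(1)[OF True] by (simp add: i_def j_def)
  define L where "L = [kishino_arc.A, kishino_arc.B, kishino_arc.C, kishino_arc.D, kishino_arc.D,
     kishino_arc.E, kishino_arc.E, kishino_arc.F]"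
  define R where "R = {(kishino_arc.E, kishino_arc.D), (kishino_arc.E, kishino_arc.A),
      (kishino_arc.D, kishino_arc.C), (kishino_arc.A, kishino_arc.C)}"
  have "double_pt kishino_curve t s" using True double_pt_sym by blast
  then have "classical_at kishino s t \<longleftrightarrow> (L ! i, L ! j) \<in> R \<or> (L ! j, L ! i) \<in> R"
    using True unfolding classical_at_def over_kishino kishino_arc_at_piece i_def j_def L_def R_def by simp
  also have "\<dots> \<longleftrightarrow> side i = -1"
    using m unfolding meet_def by (elim insertE emptyE) (simp_all add: L_def R_def side_def)
  finally show ?thesis using True by (simp add: i_def)
next
  case False
  then show ?thesis by (simp add: classical_at_def)
qed

section \<open>The Gauss diagram of the Kishino curve and its value\<close>

definition at_abscissa :: "nat \<Rightarrow> real \<Rightarrow> real" where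
  "at_abscissa k X = (breakpoint k + 2 * radius k * arccos (direction k * (center k - X) / radius k) / pi) / 21"

lemma at_abscissa:
  assumes k: "k < 8" and X: "\<bar>center k - X\<bar> < radius k"
  defines "t \<equiv> at_abscissa k X"
  shows "0 \<le> t" "t < 1" "breakpoint k \<le> 21 * t" "21 * t < breakpoint (k + 1)" "piece_of t = k"
    "kishino_curve t = Complex X (side k * sqrt ((radius k)\<^sup>2 - (center k - X)\<^sup>2))"
proof -
  have r: "0 < radius k" "0 \<le> breakpoint k" "breakpoint (k + 1) \<le> 21" "breakpoint (k + 1) = breakpoint k + 2 * radius k" using breakpoint_mono[OF k] by auto
  have d: "direction k * direction k = 1" "direction k = 1 \<or> direction k = -1" using k unfolding less8 by (elim disjE; simp add: direction_def)+
  define u where "u = direction k * (center k - X) / radius k"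
  have "\<bar>u\<bar> < 1" using X r d(2) by (auto simp: u_def abs_mult)
  then have u: "-1 < u" "u < 1" by auto
  then have ar: "0 \<le> arccos u" "arccos u < pi" using arccos_lt_bounded[of u] by auto
  have t21: "21 * t = breakpoint k + 2 * radius k * arccos u / pi" by (simp add: t_def at_abscissa_def u_def)
  have "0 \<le> 2 * radius k * arccos u / pi" using r ar by simp
  moreover have "2 * radius k * arccos u / pi < 2 * radius k" using r ar by (simp add: field_simps)
  ultimately show b: "breakpoint k \<le> 21 * t" "21 * t < breakpoint (k + 1)" using t21 r by auto
  then show t01: "0 \<le> t" "t < 1" using r by auto
  then have fr: "frac t = t" by simp
  show p: "piece_of t = k" unfolding fr by (rule piece_eq[OF k b])
  have "angle k (21 * t) = arccos u" using r unfolding angle_def t21 by simp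
  then have c: "cos (angle k (21 * t)) = u" "sin (angle k (21 * t)) = sqrt (1 - u\<^sup>2)" using u by (simp_all add: sin_arccos)
  have "radius k * sqrt (1 - u\<^sup>2) = sqrt ((radius k)\<^sup>2 * (1 - u\<^sup>2))" using r by (simp add: real_sqrt_mult)
  also have "(radius k)\<^sup>2 * (1 - u\<^sup>2) = (radius k)\<^sup>2 - (direction k * direction k) * (center k - X)\<^sup>2"
    using r by (simp add: u_def power_divide field_simps power2_eq_square)
  finally have "radius k * sqrt (1 - u\<^sup>2) = sqrt ((radius k)\<^sup>2 - (center k - X)\<^sup>2)" using d by simp
  moreover have "direction k * radius k * u = center k - X" using r d by (simp add: u_def)
  ultimately show "kishino_curve t = Complex X (side k * sqrt ((radius k)\<^sup>2 - (center k - X)\<^sup>2))"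
    unfolding kishino_curve_arc p unfolding fr semicircle_def c by (simp add: mult.assoc)
qed

lemma at_abscissa_eq:
  assumes "s \<in> {0..<1}" "piece_of s = k" "Re (kishino_curve s) = X" "\<bar>center k - X\<bar> < radius k"
  shows "s = at_abscissa k X"
proof -
  have "k < 8" using piece_of(1)[of s] assms(2) by simp
  note a = at_abscissa[OF this assms(4)]
  have "frac s = frac (at_abscissa k X)" by (rule kishino_inj) (use assms a in simp_all)
  then show ?thesis using assms(1) a(1,2) by simp
qed

lemma at_abscissa_less:
  assumes k: "k < 8" and X: "\<bar>center k - X\<bar> < radius k" "\<bar>center k - X'\<bar> < radius k" and "direction k * X < direction k * X'"
  shows "at_abscissa k X < at_abscissa k X'"
proof -
  have r: "0 < radius k" using breakpoint_mono[OF k] by simp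
  have d: "direction k = 1 \<or> direction k = -1" using k unfolding less8 by (elim disjE; simp add: direction_def)+
  have b: "-1 \<le> direction k * (center k - X') / radius k" "direction k * (center k - X) / radius k \<le> 1"
    using X r d by (auto simp: field_simps abs_less_iff)
  have "direction k * (center k - X') / radius k < direction k * (center k - X) / radius k"
    using assms(4) r by (intro divide_strict_right_mono) (simp_all add: algebra_simps)
  then have "arccos (direction k * (center k - X) / radius k) < arccos (direction k * (center k - X') / radius k)"
    using b by (subst arccos_less_arccos) simp_all
  then have "2 * radius k * arccos (direction k * (center k - X) / radius k) / pi < 2 * radius k * arccos (direction k * (center k - X') / radius k) / pi"
    using r by (intro divide_strict_right_mono mult_strict_left_mono) auto
  then show ?thesis by (simp add: at_abscissa_def)
qed

text \<open>The ends of the chords, numbered from 1 to 8 in the order in which they occur on the circle.\<close>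

definition kishino_points :: "real \<Rightarrow> real" where
  "kishino_points y = (if y = 1 then at_abscissa 0 (4/5) else if y = 2 then at_abscissa 0 (3/2)
     else if y = 3 then at_abscissa 2 (19/7) else if y = 4 then at_abscissa 2 (3/2)
     else if y = 5 then at_abscissa 4 (19/7) else if y = 6 then at_abscissa 4 (7/2)
     else if y = 7 then at_abscissa 6 (4/5) else at_abscissa 6 (7/2))"

text \<open>Read cyclically from 2 on, the ends spell the word w y w y z x z x with w = {2, 4}, y =
  {3, 5}, z = {6, 8} and x = {1, 7}.\<close>

definition gauss_code :: "(real \<times> real) set" where
  "gauss_code = {(1, 7), (7, 1), (2, 4), (4, 2), (3, 5), (5, 3), (6, 8), (8, 6)}"

text \<open>Within a semicircle the order is that of the abscissas in the direction of travel, which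
  is leftwards on semicircle 2. Different semicircles are separated by the break points.\<close>

lemma kishino_points_mono:
  assumes "p \<in> {1, 2, 3, 4, 5, 6, 7, 8}" "q \<in> {1, 2, 3, 4, 5, 6, 7, 8}"
  shows "sgn (kishino_points p - kishino_points q) = sgn (p - q)"
proof -
  have "at_abscissa 0 (4/5) < at_abscissa 0 (3/2)" "at_abscissa 2 (19/7) < at_abscissa 2 (3/2)"
    "at_abscissa 4 (19/7) < at_abscissa 4 (7/2)" "at_abscissa 6 (4/5) < at_abscissa 6 (7/2)"
    by (rule at_abscissa_less; simp add: tables)+
  moreover have "21 * at_abscissa 0 (3/2) < 2" "3 \<le> 21 * at_abscissa 2 (19/7)" "21 * at_abscissa 2 (3/2) < 5"
    "13/2 \<le> 21 * at_abscissa 4 (19/7)" "21 * at_abscissa 4 (7/2) < 9" "27/2 \<le> 21 * at_abscissa 6 (4/5)"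
    using at_abscissa(4)[of 0 "3/2"] at_abscissa(3)[of 2 "19/7"] at_abscissa(4)[of 2 "3/2"]
      at_abscissa(3)[of 4 "19/7"] at_abscissa(4)[of 4 "7/2"] at_abscissa(3)[of 6 "4/5"]
    by (simp_all add: tables)
  ultimately have m: "kishino_points 1 < kishino_points 2" "kishino_points 2 < kishino_points 3"
    "kishino_points 3 < kishino_points 4" "kishino_points 4 < kishino_points 5" "kishino_points 5 < kishino_points 6"
    "kishino_points 6 < kishino_points 7" "kishino_points 7 < kishino_points 8"
    by (simp_all add: kishino_points_def)
  have step: "kishino_points (real n) < kishino_points (real (Suc n))" if n: "1 \<le> n" "n < 8" for n
  proof -
    have "n = 1 \<or> n = 2 \<or> n = 3 \<or> n = 4 \<or> n = 5 \<or> n = 6 \<or> n = 7" using n by auto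
    then show ?thesis by (elim disjE) (use m in simp_all)
  qed
  have mono: "kishino_points (real n) < kishino_points (real l)" if "1 \<le> n" "n < l" "l \<le> 8" for n l :: nat
    using that(2,3)
  proof (induction l rule: less_induct)
    case (less l)
    then obtain l' where l': "l = Suc l'" by (cases l) auto
    then show ?case
    proof (cases "n = l'")
      case True then show ?thesis using step[of n] less that(1) l' by simp
    next
      case False
      then have "kishino_points (real n) < kishino_points (real l')" using less l' by simp
      also have "\<dots> < kishino_points (real l)" using step[of l'] less that(1) l' by simp
      finally show ?thesis .
    qed
  qed
  have nat: "\<exists>n. 1 \<le> n \<and> n \<le> 8 \<and> p = real n" if p: "p \<in> {1, 2, 3, 4, 5, 6, 7, 8}" for p
  proof -
    have "p \<in> real ` {1, 2, 3, 4, 5, 6, 7, 8}" using p by simp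
    then obtain n where "p = real n" "n \<in> {1, 2, 3, 4, 5, 6, 7, 8}" by (rule imageE)
    then show ?thesis by (intro exI[of _ n]) auto
  qed
  have "kishino_points p < kishino_points q" if pq: "p < q" "p \<in> {1, 2, 3, 4, 5, 6, 7, 8}" "q \<in> {1, 2, 3, 4, 5, 6, 7, 8}" for p q
  proof -
    obtain n l where "1 \<le> n" "n \<le> 8" "p = real n" "l \<le> 8" "q = real l" using nat[OF pq(2)] nat[OF pq(3)] by blast
    then show ?thesis using mono[of n l] pq(1) by simp
  qed
  then have "p < q \<Longrightarrow> kishino_points p < kishino_points q" "q < p \<Longrightarrow> kishino_points q < kishino_points p"
    using assms by blast+
  then show ?thesis by (cases p q rule: linorder_cases) simp_all
qed

lemma kishino_points_facts:
  shows "piece_of (kishino_points 1) = 0" "piece_of (kishino_points 2) = 0" "piece_of (kishino_points 3) = 2"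
    "piece_of (kishino_points 4) = 2" "piece_of (kishino_points 5) = 4" "piece_of (kishino_points 6) = 4"
    "piece_of (kishino_points 7) = 6" "piece_of (kishino_points 8) = 6"
    "kishino_curve (kishino_points 1) = kishino_curve (kishino_points 7)"
    "kishino_curve (kishino_points 2) = kishino_curve (kishino_points 4)"
    "kishino_curve (kishino_points 3) = kishino_curve (kishino_points 5)"
    "kishino_curve (kishino_points 6) = kishino_curve (kishino_points 8)"
    "p \<in> {1, 2, 3, 4, 5, 6, 7, 8} \<Longrightarrow> kishino_points p \<in> {0..<1}"
proof -
  note a = at_abscissa[of 0 "4/5"] at_abscissa[of 0 "3/2"] at_abscissa[of 2 "19/7"] at_abscissa[of 2 "3/2"]
    at_abscissa[of 4 "19/7"] at_abscissa[of 4 "7/2"] at_abscissa[of 6 "4/5"] at_abscissa[of 6 "7/2"]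
  show "piece_of (kishino_points 1) = 0" "piece_of (kishino_points 2) = 0" "piece_of (kishino_points 3) = 2"
    "piece_of (kishino_points 4) = 2" "piece_of (kishino_points 5) = 4" "piece_of (kishino_points 6) = 4"
    "piece_of (kishino_points 7) = 6" "piece_of (kishino_points 8) = 6"
    using a(5,11,17,23,29,35,41,47) by (simp_all add: kishino_points_def center_def radius_def)
  show "kishino_curve (kishino_points 1) = kishino_curve (kishino_points 7)"
    "kishino_curve (kishino_points 2) = kishino_curve (kishino_points 4)"
    "kishino_curve (kishino_points 3) = kishino_curve (kishino_points 5)"
    "kishino_curve (kishino_points 6) = kishino_curve (kishino_points 8)"
    using a(6,12,18,24,30,36,42,48) by (simp_all add: kishino_points_def center_def radius_def side_def power2_eq_square)
  show "kishino_points p \<in> {0..<1}" if "p \<in> {1, 2, 3, 4, 5, 6, 7, 8}"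
    using a(1,2,7,8,13,14,19,20,25,26,31,32,37,38,43,44) that by (auto simp: kishino_points_def center_def radius_def)
qed

lemma chords_kishino: "chords kishino = map_prod kishino_points kishino_points ` gauss_code"
proof (intro equalityI subsetI)
  fix c assume "c \<in> chords kishino"
  then obtain s t where c: "c = (s, t)" "s \<in> {0..<1}" "t \<in> {0..<1}" and cl: "double_pt kishino_curve s t" "side (piece_of s) = -1"
    by (auto simp: chords_def classical_kishino)
  define i where "i = piece_of s" define j where "j = piece_of t" define X where "X = Re (kishino_curve s)"
  have m: "meet i j X" "side i = -1" using kishino_double(1)[OF cl(1)] cl(2) by (simp_all add: i_def j_def X_def)
  have X: "Re (kishino_curve t) = X" using cl(1) by (simp add: double_pt_def X_def)
  have s: "\<bar>center i - X\<bar> < radius i \<Longrightarrow> s = at_abscissa i X" and t: "\<bar>center j - X\<bar> < radius j \<Longrightarrow> t = at_abscissa j X"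
    using at_abscissa_eq[of s i X] at_abscissa_eq[of t j X] c X by (simp_all add: i_def j_def X_def)
  have "\<bar>center i - X\<bar> < radius i \<and> \<bar>center j - X\<bar> < radius j"
    using m(1) by (auto simp: meet_def center_def radius_def)
  then have st: "c = (at_abscissa i X, at_abscissa j X)" using s t c by simp
  define T where "T = map_prod kishino_points kishino_points ` gauss_code"
  have T: "T = {(at_abscissa 0 (4/5), at_abscissa 6 (4/5)), (at_abscissa 6 (4/5), at_abscissa 0 (4/5)),
      (at_abscissa 0 (3/2), at_abscissa 2 (3/2)), (at_abscissa 2 (3/2), at_abscissa 0 (3/2)),
      (at_abscissa 2 (19/7), at_abscissa 4 (19/7)), (at_abscissa 4 (19/7), at_abscissa 2 (19/7)),
      (at_abscissa 4 (7/2), at_abscissa 6 (7/2)), (at_abscissa 6 (7/2), at_abscissa 4 (7/2))}"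
    by (simp add: T_def gauss_code_def kishino_points_def)
  have "(at_abscissa i X, at_abscissa j X) \<in> T"
    using m(1,2) unfolding meet_def by (elim insertE emptyE Pair_inject; simp only:; simp add: T side_def)
  then show "c \<in> map_prod kishino_points kishino_points ` gauss_code" unfolding st T_def .
next
  fix c assume "c \<in> map_prod kishino_points kishino_points ` gauss_code"
  then obtain p q where pq: "(p, q) \<in> gauss_code" "c = (kishino_points p, kishino_points q)" by auto
  have S: "p \<in> {1, 2, 3, 4, 5, 6, 7, 8}" "q \<in> {1, 2, 3, 4, 5, 6, 7, 8}" "p \<noteq> q" using pq(1) by (auto simp: gauss_code_def)
  have r: "kishino_points p \<in> {0..<1}" "kishino_points q \<in> {0..<1}" using kishino_points_facts(13) S by blast+
  have "kishino_points p \<noteq> kishino_points q"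
    using kishino_points_mono[OF S(1,2)] S(3) by (auto simp: sgn_zero_iff)
  then have "kishino_points p - kishino_points q \<notin> \<int>" using r by (intro not_Ints_near) auto
  moreover have "kishino_curve (kishino_points p) = kishino_curve (kishino_points q) \<and> side (piece_of (kishino_points p)) = -1"
    using pq(1) unfolding gauss_code_def
    by (elim insertE emptyE) (simp_all add: kishino_points_facts(1-12) side_def)
  ultimately show "c \<in> chords kishino"
    using r pq(2) by (auto simp: chords_def classical_kishino double_pt_def)
qed

text \<open>The only nonzero pairings are those of {1, 7} with {2, 4} and of {3, 5} with {6, 8},
  with square 16. In each case the products of sign and index are -2 and 2, which gives -64. Two
  orders and four choices of directions yield 2 * 8 * (-64).\<close>

lemma gauss_code_value:
  fixes e :: "real \<times> real \<Rightarrow> real"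
  defines "P \<equiv> gauss_code"
  assumes e: "e (1, 7) = -1" "e (2, 4) = 1" "e (3, 5) = 1" "e (6, 8) = 1"
    and alt: "\<And>p q. e (q, p) = - e (p, q)"
  shows "gauss_invariant P e = -1024"
proof -
  have S: "sum f P = f (1, 7) + f (7, 1) + f (2, 4) + f (4, 2) + f (3, 5) + f (5, 3) + f (6, 8) + f (8, 6)" for f :: "_ \<Rightarrow> real"
    unfolding P_def gauss_code_def by simp
  have e': "e (7, 1) = 1" "e (4, 2) = -1" "e (5, 3) = -1" "e (8, 6) = -1" using alt[of 7 1] alt[of 4 2] alt[of 5 3] alt[of 8 6] e by simp_all
  have idx: "chord_index P e (1, 7) = 2" "chord_index P e (2, 4) = 2" "chord_index P e (3, 5) = -2" "chord_index P e (6, 8) = 2"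
    unfolding chord_index_def S by (simp_all add: e e' cyclic_sign_def)
  have pair: "chord_pairing P e (1, 7) (1, 7) = 0" "chord_pairing P e (1, 7) (2, 4) = -4" "chord_pairing P e (1, 7) (3, 5) = 0"
      "chord_pairing P e (1, 7) (6, 8) = 0" "chord_pairing P e (2, 4) (1, 7) = 4" "chord_pairing P e (2, 4) (2, 4) = 0"
      "chord_pairing P e (2, 4) (3, 5) = 0" "chord_pairing P e (2, 4) (6, 8) = 0" "chord_pairing P e (3, 5) (1, 7) = 0"
      "chord_pairing P e (3, 5) (2, 4) = 0" "chord_pairing P e (3, 5) (3, 5) = 0" "chord_pairing P e (3, 5) (6, 8) = 4"
      "chord_pairing P e (6, 8) (1, 7) = 0" "chord_pairing P e (6, 8) (2, 4) = 0" "chord_pairing P e (6, 8) (3, 5) = -4"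
      "chord_pairing P e (6, 8) (6, 8) = 0"
    unfolding chord_pairing_def S by (simp_all add: e e' cyclic_sign_def)
  have sym: "(q, p) \<in> P" if "(p, q) \<in> P" for p q using that by (auto simp: P_def gauss_code_def)
  have al: "alternating P e" unfolding alternating_def
  proof (intro conjI ballI)
    show "finite P" by (simp add: P_def gauss_code_def)
    fix c assume "c \<in> P"
    then show "case c of (p, q) \<Rightarrow> (q, p) \<in> P \<and> e (q, p) = - e (p, q)"
      using sym[of "fst c" "snd c"] alt[of "snd c" "fst c"] by (simp add: split_beta)
  qed
  have isw: "chord_index P e (b, a) = - chord_index P e (a, b)" for a b
    unfolding chord_index_def by (simp add: cyclic_sign_swap[of b a] sum_negf)
  have psw: "chord_pairing P e c (b, a) = - chord_pairing P e c (a, b)" for a b c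
    using chord_pairing_skew[OF al, of c "(b, a)"] chord_pairing_skew[OF al, of c "(a, b)"] chord_pairing_swap[of P e b a c] by simp
  show ?thesis unfolding gauss_invariant_def S
    by (simp add: e e' idx pair isw[of 7 1] isw[of 4 2] isw[of 5 3] isw[of 8 6] psw[of _ 7 1] psw[of _ 4 2] psw[of _ 5 3] psw[of _ 8 6]
      chord_pairing_swap[of P e 7 1] chord_pairing_swap[of P e 4 2] chord_pairing_swap[of P e 5 3] chord_pairing_swap[of P e 8 6])
qed

lemma diagram_invariant_kishino: "diagram_invariant kishino = -1024"
proof -
  define e where "e p = crossing_sign kishino_curve (map_prod kishino_points kishino_points p)" for p
  have dbl: "double_pt kishino_curve (kishino_points p) (kishino_points q)" if "(p, q) \<in> gauss_code" for p q
  proof -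
    have "(kishino_points p, kishino_points q) \<in> chords kishino" unfolding chords_kishino using that by force
    then show ?thesis by (simp add: chords_def classical_kishino)
  qed
  have val: "e (p, q) = direction (piece_of (kishino_points p)) * direction (piece_of (kishino_points q)) *
      side (piece_of (kishino_points p)) * sgn (center (piece_of (kishino_points q)) - center (piece_of (kishino_points p)))"
    if "(p, q) \<in> gauss_code" for p q
    using kishino_tangent_det(1)[OF dbl[OF that]] by (simp add: e_def crossing_sign_def velocity_kishino)
  have "gauss_invariant gauss_code e = -1024"
  proof (rule gauss_code_value)
    show "e (1, 7) = -1" "e (2, 4) = 1" "e (3, 5) = 1" "e (6, 8) = 1"
      by (subst val; simp add: gauss_code_def kishino_points_facts direction_def side_def center_def)+
    show "e (q, p) = - e (p, q)" for p q unfolding e_def map_prod_simp by (rule crossing_sign_swap)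
  qed
  moreover have "gauss_invariant (map_prod kishino_points kishino_points ` gauss_code) (crossing_sign kishino_curve) = gauss_invariant gauss_code e"
  proof (rule gauss_invariant_map)
    show "inj_on kishino_points {1, 2, 3, 4, 5, 6, 7, 8}"
      by (rule inj_onI) (metis kishino_points_mono eq_iff_diff_eq_0 sgn_zero_iff)
    show "gauss_code \<subseteq> {1, 2, 3, 4, 5, 6, 7, 8} \<times> {1, 2, 3, 4, 5, 6, 7, 8}" by (auto simp: gauss_code_def)
    show "cyclic_sign (kishino_points a) (kishino_points b) (kishino_points x) = cyclic_sign a b x"
      if "a \<in> {1, 2, 3, 4, 5, 6, 7, 8}" "b \<in> {1, 2, 3, 4, 5, 6, 7, 8}" "x \<in> {1, 2, 3, 4, 5, 6, 7, 8}" for a b x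
      unfolding cyclic_sign_def using kishino_points_mono[OF that(3,1)] kishino_points_mono[OF that(2,3)] kishino_points_mono[OF that(2,1)] by simp
  qed (simp add: e_def)
  ultimately show ?thesis unfolding diagram_invariant_def chords_kishino by simp
qed

theorem proposition5p1:
  shows "virtual_diagram kishino \<and>
    \<not> (\<exists>D. virtual_diagram D \<and> only_classical D \<and> virtually_equivalent kishino D)"
proof (intro conjI notI)
  show "virtual_diagram kishino" by (rule virtual_diagram_kishino)
  assume "\<exists>D. virtual_diagram D \<and> only_classical D \<and> virtually_equivalent kishino D"
  then obtain D where "virtual_diagram D" "only_classical D" "virtually_equivalent kishino D" by blast
  then have "diagram_invariant D = 0" "diagram_invariant D = diagram_invariant kishino" using diagram_invariant_only_classical diagram_invariant_equivalent by blast+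
  then show False using diagram_invariant_kishino by simp
qed

end
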